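(* Suppose $y=0$, that $\beta,\lambda>0$ are constants, and that the target position $\Xi_T\in\mathbb R$ is deterministic. Then $$V(\varepsilon)=\frac{\lambda\,\Xi_T^2}{\beta T+2}+\frac{2\sqrt{\beta\lambda}\,\Xi_T^2}{(\beta T+2)^2}\sqrt\varepsilon+O(\varepsilon),\qquad\varepsilon\downarrow0.$$ Consequently, if $\Xi_T\ne0$, then $$V(\varepsilon)-V(0)\sim\frac{2\sqrt{\beta\lambda}\,\Xi_T^2}{(\beta T+2)^2}\sqrt\varepsilon,\qquad\varepsilon\downarrow0,$$ and hence the rate $V(\varepsilon)-V(0)=O(\sqrt\varepsilon)$ is sharp.
   Context: Fix $T\in(0,\infty)$ and a filtered probability space $(\Omega,\mathcal F,(\mathcal F_t)_{t\in[0,T]},\mathbb P)$ satisfying the usual conditions. $\mathcal Q$ is the set of càdlàg semimartingales $Q$ with $\mathbb E[\sup_{t\le T}|Q_t|^2]<\infty$, $Q_{0-}=0$ and $Q_T=\Xi_T$. For $Q\in\mathcal Q$, the impact process $Y^Q$ solves $dY_t=-\beta Y_t\,dt+\lambda\,dQ_t$, $Y_{0-}=y=0$. The execution cost is $$J_0(Q)=\mathbb E\Big[\int_0^TY^Q_{t-}\,dQ_t+\tfrac12[Y^Q,Q]_T\Big]=\mathbb E\Big[\int_0^T\tfrac{\beta}{\lambda}(Y^Q_t)^2\,dt+\tfrac1{2\lambda}(Y^Q_T)^2\Big],$$ where integrals are over closed intervals and quadratic covariation includes jumps at time zero. $\mathcal Q_{\rm ac}\subset\mathcal Q$ is the set of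 $Q_t=\int_0^tu_s\,ds$ with $u$ progressively measurable, $\mathbb E\int_0^Tu_t^2\,dt<\infty$ and $Q_T=\Xi_T$. For $\varepsilon>0$ and $Q\in\mathcal Q_{\rm ac}$ let $J_\varepsilon(Q)=J_0(Q)+\varepsilon\,\mathbb E\int_0^T\dot Q_t^2\,dt$. Finally, $V(0)=\inf_{Q\in\mathcal Q}J_0(Q)$ and $V(\varepsilon)=\inf_{Q\in\mathcal Q_{\rm ac}}J_\varepsilon(Q)$ for $\varepsilon>0$. $f\sim g$ means $f/g\to1$. *)

theory Defs
  imports "HOL-Probability.Probability" "HOL-Library.Landau_Symbols"
begin

section \<open>Filtered probability spaces and processes on \<open>[0,T]\<close>\<close>

text \<open>
  Processes and filtrations are indexed by \<^typ>\<open>real\<close>, but only their values on \<open>[0,T]\<close> matter.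
\<close>

locale usual_filtered_prob_space = prob_space M + complete_measure M for M :: "'a measure" +
  fixes F :: "real \<Rightarrow> 'a measure" and T :: real
  assumes T_pos: "0 < T"
    and subalg: "\<And>t. t \<in> {0..T} \<Longrightarrow> subalgebra M (F t)"
    and mono: "\<And>s t. 0 \<le> s \<Longrightarrow> s \<le> t \<Longrightarrow> t \<le> T \<Longrightarrow> sets (F s) \<subseteq> sets (F t)"
    and null_sets_F0: "null_sets M \<subseteq> sets (F 0)"
    and right_cont: "\<And>t. 0 \<le> t \<Longrightarrow> t < T \<Longrightarrow> sets (F t) = (\<Inter>s\<in>{t<..T}. sets (F s))"

definition cadlag_on :: "real \<Rightarrow> (real \<Rightarrow> real) \<Rightarrow> bool" where
  "cadlag_on T f \<longleftrightarrow>
     (\<forall>t. 0 \<le> t \<and> t < T \<longrightarrow> (f \<longlongrightarrow> f t) (at_right t)) \<and>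
     (\<forall>t. 0 < t \<and> t \<le> T \<longrightarrow> (\<exists>l. (f \<longlongrightarrow> l) (at_left t)))"

definition finite_variation_on :: "real \<Rightarrow> (real \<Rightarrow> real) \<Rightarrow> bool" where
  "finite_variation_on T f \<longleftrightarrow>
     (\<exists>B. \<forall>(n::nat) p. 0 \<le> p 0 \<and> p n \<le> T \<and> (\<forall>i<n. p i \<le> p (Suc i)) \<longrightarrow>
        (\<Sum>i<n. \<bar>f (p (Suc i)) - f (p i)\<bar>) \<le> B)"

definition adapted_cadlag ::
  "'a measure \<Rightarrow> (real \<Rightarrow> 'a measure) \<Rightarrow> real \<Rightarrow> (real \<Rightarrow> 'a \<Rightarrow> real) \<Rightarrow> bool" where
  "adapted_cadlag M F T X \<longleftrightarrow>
     (\<forall>t\<in>{0..T}. X t \<in> borel_measurable (F t)) \<and>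
     (\<forall>\<omega>\<in>space M. cadlag_on T (\<lambda>t. X t \<omega>))"

definition progressively_measurable ::
  "(real \<Rightarrow> 'a measure) \<Rightarrow> real \<Rightarrow> (real \<Rightarrow> 'a \<Rightarrow> real) \<Rightarrow> bool" where
  "progressively_measurable F T u \<longleftrightarrow>
     (\<forall>t\<in>{0..T}. (\<lambda>(s, \<omega>). u s \<omega>) \<in> borel_measurable (restrict_space borel {0..t} \<Otimes>\<^sub>M F t))"


section \<open>Semimartingales\<close>

definition cadlag_martingale ::
  "'a measure \<Rightarrow> (real \<Rightarrow> 'a measure) \<Rightarrow> real \<Rightarrow> (real \<Rightarrow> 'a \<Rightarrow> real) \<Rightarrow> bool" where
  "cadlag_martingale M F T X \<longleftrightarrow>
     adapted_cadlag M F T X \<and> (\<forall>t\<in>{0..T}. integrable M (X t)) \<and>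
     (\<forall>s t. 0 \<le> s \<and> s \<le> t \<and> t \<le> T \<longrightarrow> (AE \<omega> in M. real_cond_exp M (F s) (X t) \<omega> = X s \<omega>))"

text \<open>
  Stopping times on \<open>[0,T]\<close> are encoded as real-valued functions; a value above \<open>T\<close> plays the role
  of infinity. (The library's \<^const>\<open>stopping_time\<close> would constrain \<open>F t\<close> also for \<open>t\<close> outside
  \<open>[0,T]\<close>.) A localising sequence almost surely stops nothing on \<open>[0,T]\<close> from some index on.
\<close>

definition localising_sequence ::
  "'a measure \<Rightarrow> (real \<Rightarrow> 'a measure) \<Rightarrow> real \<Rightarrow> (nat \<Rightarrow> 'a \<Rightarrow> real) \<Rightarrow> bool" where
  "localising_sequence M F T \<tau> \<longleftrightarrow>
     (\<forall>n. \<forall>t\<in>{0..T}. {\<omega>\<in>space M. \<tau> n \<omega> \<le> t} \<in> sets (F t)) \<and>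
     (\<forall>n. \<forall>\<omega>\<in>space M. 0 \<le> \<tau> n \<omega> \<and> \<tau> n \<omega> \<le> \<tau> (Suc n) \<omega>) \<and>
     (AE \<omega> in M. \<exists>n. T \<le> \<tau> n \<omega>)"

definition local_martingale ::
  "'a measure \<Rightarrow> (real \<Rightarrow> 'a measure) \<Rightarrow> real \<Rightarrow> (real \<Rightarrow> 'a \<Rightarrow> real) \<Rightarrow> bool" where
  "local_martingale M F T X \<longleftrightarrow>
     adapted_cadlag M F T X \<and>
     (\<exists>\<tau>. localising_sequence M F T \<tau> \<and>
        (\<forall>n. cadlag_martingale M F T (\<lambda>t \<omega>. X (min t (\<tau> n \<omega>)) \<omega>)))"

definition semimartingale ::
  "'a measure \<Rightarrow> (real \<Rightarrow> 'a measure) \<Rightarrow> real \<Rightarrow> (real \<Rightarrow> 'a \<Rightarrow> real) \<Rightarrow> bool" where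
  "semimartingale M F T X \<longleftrightarrow>
     adapted_cadlag M F T X \<and>
     (\<exists>N A. local_martingale M F T N \<and>
        adapted_cadlag M F T A \<and> (\<forall>\<omega>\<in>space M. finite_variation_on T (\<lambda>t. A t \<omega>)) \<and>
        (\<forall>\<omega>\<in>space M. N 0 \<omega> = 0 \<and> A 0 \<omega> = 0) \<and>
        (\<forall>\<omega>\<in>space M. \<forall>t\<in>{0..T}. X t \<omega> = X 0 \<omega> + N t \<omega> + A t \<omega>))"


section \<open>Stochastic integral and quadratic covariation over \<open>[0,T]\<close>\<close>

text \<open>Measurability is required because \<^const>\<open>measure\<close> is \<open>0\<close> on non-measurable sets.\<close>

definition conv_in_prob :: "'a measure \<Rightarrow> (nat \<Rightarrow> 'a \<Rightarrow> real) \<Rightarrow> ('a \<Rightarrow> real) \<Rightarrow> bool" where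
  "conv_in_prob M S Z \<longleftrightarrow>
     (\<forall>n. S n \<in> borel_measurable M) \<and> Z \<in> borel_measurable M \<and>
     (\<forall>e>0. (\<lambda>n. measure M {\<omega>\<in>space M. e < \<bar>S n \<omega> - Z \<omega>\<bar>}) \<longlonglongrightarrow> 0)"

text \<open>Partitions \<open>0 = p\<^sub>n(0) \<le> \<dots> \<le> p\<^sub>n(k\<^sub>n) = T\<close> whose mesh tends to zero.\<close>

definition partition_seq :: "real \<Rightarrow> (nat \<Rightarrow> nat) \<Rightarrow> (nat \<Rightarrow> nat \<Rightarrow> real) \<Rightarrow> bool" where
  "partition_seq T k p \<longleftrightarrow>
     (\<forall>n. p n 0 = 0 \<and> p n (k n) = T \<and> (\<forall>i<k n. p n i \<le> p n (Suc i))) \<and>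
     (\<forall>\<delta>>0. \<forall>\<^sub>F n in sequentially. \<forall>i<k n. p n (Suc i) - p n i < \<delta>)"

text \<open>
  Left-point sums and covariation sums for paths \<open>h\<close> and \<open>x\<close>. The numbers \<open>h0\<close> and \<open>x0\<close> are the
  values of \<open>h\<close> and \<open>x\<close> at \<open>0-\<close>; the first summand is the contribution of the jump at time zero.
\<close>

definition integral_sum ::
  "real \<Rightarrow> (real \<Rightarrow> real) \<Rightarrow> real \<Rightarrow> (real \<Rightarrow> real) \<Rightarrow> nat \<Rightarrow> (nat \<Rightarrow> real) \<Rightarrow> real" where
  "integral_sum h0 h x0 x k p =
     h0 * (x 0 - x0) + (\<Sum>i<k. h (p i) * (x (p (Suc i)) - x (p i)))"

definition covariation_sum ::
  "real \<Rightarrow> (real \<Rightarrow> real) \<Rightarrow> real \<Rightarrow> (real \<Rightarrow> real) \<Rightarrow> nat \<Rightarrow> (nat \<Rightarrow> real) \<Rightarrow> real" where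
  "covariation_sum h0 h x0 x k p =
     (h 0 - h0) * (x 0 - x0) +
     (\<Sum>i<k. (h (p (Suc i)) - h (p i)) * (x (p (Suc i)) - x (p i)))"

text \<open>
  For adapted cadlag \<open>H\<close> and semimartingales \<open>X\<close>, the integral of \<open>H\<^sub>-\<close> against \<open>X\<close> over \<open>[0,T]\<close> is
  the limit in probability of left-point sums along every sequence of partitions with vanishing
  mesh, and \<open>[H,X]\<^sub>T\<close> (for semimartingale \<open>H\<close>) is that of the covariation sums.
\<close>

definition is_stoch_integral ::
  "'a measure \<Rightarrow> real \<Rightarrow> real \<Rightarrow> (real \<Rightarrow> 'a \<Rightarrow> real) \<Rightarrow> real \<Rightarrow> (real \<Rightarrow> 'a \<Rightarrow> real) \<Rightarrow>
   ('a \<Rightarrow> real) \<Rightarrow> bool" where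
  "is_stoch_integral M T h0 H x0 X I \<longleftrightarrow>
     (\<forall>k p. partition_seq T k p \<longrightarrow>
        conv_in_prob M
          (\<lambda>n \<omega>. integral_sum h0 (\<lambda>t. H t \<omega>) x0 (\<lambda>t. X t \<omega>) (k n) (p n)) I)"

definition is_covariation ::
  "'a measure \<Rightarrow> real \<Rightarrow> real \<Rightarrow> (real \<Rightarrow> 'a \<Rightarrow> real) \<Rightarrow> real \<Rightarrow> (real \<Rightarrow> 'a \<Rightarrow> real) \<Rightarrow>
   ('a \<Rightarrow> real) \<Rightarrow> bool" where
  "is_covariation M T h0 H x0 X C \<longleftrightarrow>
     (\<forall>k p. partition_seq T k p \<longrightarrow>
        conv_in_prob M
          (\<lambda>n \<omega>. covariation_sum h0 (\<lambda>t. H t \<omega>) x0 (\<lambda>t. X t \<omega>) (k n) (p n)) C)"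


section \<open>Strategies, impact and costs\<close>

text \<open>\<open>\<Q>\<close>; the condition \<open>Q\<^bsub>0-\<^esub> = 0\<close> is the convention used for the jump of \<open>Q\<close> at time zero.\<close>

definition strategies ::
  "'a measure \<Rightarrow> (real \<Rightarrow> 'a measure) \<Rightarrow> real \<Rightarrow> real \<Rightarrow> (real \<Rightarrow> 'a \<Rightarrow> real) set" where
  "strategies M F T \<Xi> =
     {Q. semimartingale M F T Q \<and>
         (\<integral>\<^sup>+\<omega>. (SUP t\<in>{0..T}. ennreal (\<bar>Q t \<omega>\<bar>\<^sup>2)) \<partial>M) < \<infinity> \<and>
         (AE \<omega> in M. Q T \<omega> = \<Xi>)}"

definition solves_impact ::
  "real \<Rightarrow> real \<Rightarrow> real \<Rightarrow> real \<Rightarrow> (real \<Rightarrow> real) \<Rightarrow> (real \<Rightarrow> real) \<Rightarrow> bool" where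
  "solves_impact T \<beta> lam y q f \<longleftrightarrow>
     cadlag_on T f \<and> (\<forall>t\<in>{0..T}. f t = y - \<beta> * (LBINT s:{0..t}. f s) + lam * q t)"

text \<open>
  \<open>dY\<^sub>t = -\<beta> Y\<^sub>t dt + \<lambda> dQ\<^sub>t\<close>, \<open>Y\<^bsub>0-\<^esub> = y\<close>, involves no stochastic integral and is
  solved path by path; the solution is unique on \<open>[0,T]\<close>.
\<close>

definition impact ::
  "real \<Rightarrow> real \<Rightarrow> real \<Rightarrow> real \<Rightarrow> (real \<Rightarrow> 'a \<Rightarrow> real) \<Rightarrow> real \<Rightarrow> 'a \<Rightarrow> real" where
  "impact T \<beta> lam y Q t \<omega> = (SOME f. solves_impact T \<beta> lam y (\<lambda>s. Q s \<omega>) f) t"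

text \<open>
  \<open>\<integral>\<^bsub>[0,T]\<^esub> Y\<^bsub>t-\<^esub> dQ\<^sub>t + [Y,Q]\<^sub>T / 2\<close>, with \<open>Y\<close> the impact process, as the limit of the
  sum of the approximating sums of the two terms. Both terms are limits in probability of their
  sums, so this is the same random variable up to null sets: lemma \<open>J0_eq\<close> below. The combined
  sums are Stratonovich sums, and since \<open>lam * Q\<close> and \<open>Y\<close> differ by a Lipschitz path they even
  converge pathwise; \<open>Z\<close> is unique up to null sets.
\<close>

definition is_execution_cost ::
  "'a measure \<Rightarrow> real \<Rightarrow> real \<Rightarrow> real \<Rightarrow> real \<Rightarrow> (real \<Rightarrow> 'a \<Rightarrow> real) \<Rightarrow> ('a \<Rightarrow> real) \<Rightarrow> bool" where
  "is_execution_cost M T \<beta> lam y Q Z \<longleftrightarrow>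
     (\<forall>k p. partition_seq T k p \<longrightarrow>
        conv_in_prob M
          (\<lambda>n \<omega>.
             integral_sum y (\<lambda>t. impact T \<beta> lam y Q t \<omega>) 0 (\<lambda>t. Q t \<omega>) (k n) (p n) +
             1 / 2 * covariation_sum y (\<lambda>t. impact T \<beta> lam y Q t \<omega>) 0 (\<lambda>t. Q t \<omega>) (k n) (p n)) Z)"

definition J0 ::
  "'a measure \<Rightarrow> real \<Rightarrow> real \<Rightarrow> real \<Rightarrow> real \<Rightarrow> (real \<Rightarrow> 'a \<Rightarrow> real) \<Rightarrow> real" where
  "J0 M T \<beta> lam y Q = integral\<^sup>L M (SOME Z. is_execution_cost M T \<beta> lam y Q Z)"

definition is_rate ::
  "'a measure \<Rightarrow> (real \<Rightarrow> 'a measure) \<Rightarrow> real \<Rightarrow> (real \<Rightarrow> 'a \<Rightarrow> real) \<Rightarrow>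
   (real \<Rightarrow> 'a \<Rightarrow> real) \<Rightarrow> bool" where
  "is_rate M F T Q u \<longleftrightarrow>
     progressively_measurable F T u \<and>
     (\<integral>\<^sup>+\<omega>. (\<integral>\<^sup>+s\<in>{0..T}. ennreal ((u s \<omega>)\<^sup>2) \<partial>lborel) \<partial>M) < \<infinity> \<and>
     (AE \<omega> in M. \<forall>t\<in>{0..T}. Q t \<omega> = (LBINT s:{0..t}. u s \<omega>))"

definition ac_strategies ::
  "'a measure \<Rightarrow> (real \<Rightarrow> 'a measure) \<Rightarrow> real \<Rightarrow> real \<Rightarrow> (real \<Rightarrow> 'a \<Rightarrow> real) set" where
  "ac_strategies M F T \<Xi> = {Q \<in> strategies M F T \<Xi>. \<exists>u. is_rate M F T Q u}"

text \<open>The rate is unique up to \<open>dt \<otimes> P\<close>-null sets.\<close>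

definition rate ::
  "'a measure \<Rightarrow> (real \<Rightarrow> 'a measure) \<Rightarrow> real \<Rightarrow> (real \<Rightarrow> 'a \<Rightarrow> real) \<Rightarrow> real \<Rightarrow> 'a \<Rightarrow> real" where
  "rate M F T Q = (SOME u. is_rate M F T Q u)"

definition J_eps ::
  "'a measure \<Rightarrow> (real \<Rightarrow> 'a measure) \<Rightarrow> real \<Rightarrow> real \<Rightarrow> real \<Rightarrow> real \<Rightarrow> real \<Rightarrow>
   (real \<Rightarrow> 'a \<Rightarrow> real) \<Rightarrow> real" where
  "J_eps M F T \<beta> lam y \<epsilon> Q =
     J0 M T \<beta> lam y Q + \<epsilon> * (\<integral>\<omega>. (LBINT s:{0..T}. (rate M F T Q s \<omega>)\<^sup>2) \<partial>M)"

definition V ::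
  "'a measure \<Rightarrow> (real \<Rightarrow> 'a measure) \<Rightarrow> real \<Rightarrow> real \<Rightarrow> real \<Rightarrow> real \<Rightarrow> real \<Rightarrow> real \<Rightarrow> real" where
  "V M F T \<beta> lam y \<Xi> \<epsilon> =
     (if \<epsilon> = 0 then (INF Q\<in>strategies M F T \<Xi>. J0 M T \<beta> lam y Q)
      else (INF Q\<in>ac_strategies M F T \<Xi>. J_eps M F T \<beta> lam y \<epsilon> Q))"


section \<open>The execution cost as integral plus half the covariation\<close>

lemma (in prob_space) conv_in_prob_unique:
  assumes "conv_in_prob M S Y" "conv_in_prob M S Z"
  shows "AE \<omega> in M. Y \<omega> = Z \<omega>"
proof -
  have [measurable]: "S n \<in> borel_measurable M" "Y \<in> borel_measurable M" "Z \<in> borel_measurable M" for n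
    using assms by (auto simp: conv_in_prob_def)
  have null: "AE \<omega> in M. \<not> e < \<bar>Y \<omega> - Z \<omega>\<bar>" if e: "e > 0" for e
  proof -
    let ?A = "\<lambda>n. {\<omega>\<in>space M. e/2 < \<bar>S n \<omega> - Y \<omega>\<bar>}"
    let ?B = "\<lambda>n. {\<omega>\<in>space M. e/2 < \<bar>S n \<omega> - Z \<omega>\<bar>}"
    let ?C = "{\<omega>\<in>space M. e < \<bar>Y \<omega> - Z \<omega>\<bar>}"
    have "(\<lambda>n. prob (?A n) + prob (?B n)) \<longlonglongrightarrow> 0 + 0"
      using assms half_gt_zero[OF e] unfolding conv_in_prob_def by (intro tendsto_add) blast+
    moreover have "prob ?C \<le> prob (?A n) + prob (?B n)" for n
    proof -
      have "prob ?C \<le> prob (?A n \<union> ?B n)"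
        by (rule finite_measure_mono) (auto, smt (verit) field_sum_of_halves)
      also have "\<dots> \<le> prob (?A n) + prob (?B n)"
        by (rule measure_Un_le) auto
      finally show ?thesis .
    qed
    ultimately have "prob ?C \<le> 0 + 0"
      by (intro LIMSEQ_le_const) auto
    then have "prob ?C = 0"
      using measure_nonneg[of M ?C] by linarith
    then show ?thesis
      by (subst (asm) prob_eq_0) auto
  qed
  have "AE \<omega> in M. \<forall>n. \<not> 1 / real (Suc n) < \<bar>Y \<omega> - Z \<omega>\<bar>"
    by (subst AE_all_countable) (auto intro!: null)
  then show ?thesis
  proof eventually_elim
    case (elim \<omega>)
    show ?case
    proof (rule ccontr)
      assume "Y \<omega> \<noteq> Z \<omega>"
      then have "0 < \<bar>Y \<omega> - Z \<omega>\<bar>" by simp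
      then show False using elim by (metis nat_approx_posE)
    qed
  qed
qed

lemma (in prob_space) conv_in_prob_add_half:
  assumes "conv_in_prob M S Y" "conv_in_prob M R Z"
  shows "conv_in_prob M (\<lambda>n \<omega>. S n \<omega> + 1 / 2 * R n \<omega>) (\<lambda>\<omega>. Y \<omega> + 1 / 2 * Z \<omega>)"
proof -
  have [measurable]: "S n \<in> borel_measurable M" "R n \<in> borel_measurable M"
    "Y \<in> borel_measurable M" "Z \<in> borel_measurable M" for n
    using assms by (auto simp: conv_in_prob_def)
  have "(\<lambda>n. prob {\<omega>\<in>space M. e < \<bar>S n \<omega> + 1/2 * R n \<omega> - (Y \<omega> + 1/2 * Z \<omega>)\<bar>}) \<longlonglongrightarrow> 0"
    if e: "e > 0" for e
  proof -
    let ?A = "\<lambda>n. {\<omega>\<in>space M. e/2 < \<bar>S n \<omega> - Y \<omega>\<bar>}"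
    let ?B = "\<lambda>n. {\<omega>\<in>space M. e < \<bar>R n \<omega> - Z \<omega>\<bar>}"
    let ?C = "\<lambda>n. {\<omega>\<in>space M. e < \<bar>S n \<omega> + 1/2 * R n \<omega> - (Y \<omega> + 1/2 * Z \<omega>)\<bar>}"
    have lim: "(\<lambda>n. prob (?A n) + prob (?B n)) \<longlonglongrightarrow> 0"
      using assms e half_gt_zero[OF e] unfolding conv_in_prob_def
      by (intro tendsto_add_zero) blast+
    have le: "prob (?C n) \<le> prob (?A n) + prob (?B n)" for n
    proof -
      have "prob (?C n) \<le> prob (?A n \<union> ?B n)"
      proof (rule finite_measure_mono)
        show "?C n \<subseteq> ?A n \<union> ?B n"
        proof
          fix \<omega> assume "\<omega> \<in> ?C n"
          then show "\<omega> \<in> ?A n \<union> ?B n"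
            by (simp add: abs_if split: if_splits) linarith+
        qed
      qed auto
      also have "\<dots> \<le> prob (?A n) + prob (?B n)"
        by (rule measure_Un_le) auto
      finally show ?thesis .
    qed
    show ?thesis
      by (rule tendsto_sandwich[OF _ always_eventually[OF allI, OF le] tendsto_const lim])
        (auto intro!: always_eventually)
  qed
  then show ?thesis by (simp add: conv_in_prob_def)
qed

lemma exists_partition_seq:
  assumes "0 < T"
  shows "\<exists>k p. partition_seq T k p"
proof (intro exI)
  show "partition_seq T Suc (\<lambda>n i. T * real i / real (Suc n))"
    unfolding partition_seq_def
  proof (intro conjI allI impI)
    fix \<delta> :: real assume "\<delta> > 0"
    have "(\<lambda>n. T / real (Suc n)) \<longlonglongrightarrow> 0"
      using LIMSEQ_Suc[OF lim_const_over_n[of T]] by simp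
    then have "\<forall>\<^sub>F n in sequentially. T / real (Suc n) < \<delta>"
      using \<open>\<delta> > 0\<close> by (rule order_tendstoD)
    then show "\<forall>\<^sub>F n in sequentially. \<forall>i<Suc n.
        T * real (Suc i) / real (Suc n) - T * real i / real (Suc n) < \<delta>"
      by eventually_elim (simp add: diff_divide_distrib[symmetric] algebra_simps)
  qed (use assms in \<open>auto intro!: divide_right_mono mult_left_mono\<close>)
qed

lemma (in prob_space) J0_eq:
  assumes "0 < T"
    and I: "is_stoch_integral M T y (impact T \<beta> lam y Q) 0 Q I"
    and C: "is_covariation M T y (impact T \<beta> lam y Q) 0 Q C"
  shows "J0 M T \<beta> lam y Q = (\<integral>\<omega>. I \<omega> + 1 / 2 * C \<omega> \<partial>M)"
proof -
  let ?Z = "SOME Z. is_execution_cost M T \<beta> lam y Q Z"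
  have IC: "is_execution_cost M T \<beta> lam y Q (\<lambda>\<omega>. I \<omega> + 1 / 2 * C \<omega>)"
    unfolding is_execution_cost_def
  proof (intro allI impI conv_in_prob_add_half)
    fix k p assume kp: "partition_seq T k p"
    show "conv_in_prob M (\<lambda>n \<omega>.
        integral_sum y (\<lambda>t. impact T \<beta> lam y Q t \<omega>) 0 (\<lambda>t. Q t \<omega>) (k n) (p n)) I"
      using I kp by (simp add: is_stoch_integral_def)
    show "conv_in_prob M (\<lambda>n \<omega>.
        covariation_sum y (\<lambda>t. impact T \<beta> lam y Q t \<omega>) 0 (\<lambda>t. Q t \<omega>) (k n) (p n)) C"
      using C kp by (simp add: is_covariation_def)
  qed
  then have Z: "is_execution_cost M T \<beta> lam y Q ?Z"
    by (rule someI[where P = "is_execution_cost M T \<beta> lam y Q"])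
  obtain k p where kp: "partition_seq T k p"
    using exists_partition_seq[OF assms(1)] by blast
  have conv: "conv_in_prob M (\<lambda>n \<omega>.
      integral_sum y (\<lambda>t. impact T \<beta> lam y Q t \<omega>) 0 (\<lambda>t. Q t \<omega>) (k n) (p n) +
      1 / 2 * covariation_sum y (\<lambda>t. impact T \<beta> lam y Q t \<omega>) 0 (\<lambda>t. Q t \<omega>) (k n) (p n)) W"
    if "is_execution_cost M T \<beta> lam y Q W" for W
    using that kp by (auto simp: is_execution_cost_def)
  have "AE \<omega> in M. ?Z \<omega> = I \<omega> + 1 / 2 * C \<omega>"
    by (rule conv_in_prob_unique[OF conv[OF Z] conv[OF IC]])
  moreover have "?Z \<in> borel_measurable M" "(\<lambda>\<omega>. I \<omega> + 1 / 2 * C \<omega>) \<in> borel_measurable M"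
    using conv[OF Z] conv[OF IC] by (auto simp: conv_in_prob_def)
  ultimately show ?thesis
    unfolding J0_def by (intro integral_cong_AE) auto
qed

end

theory Submission
  imports Defs "HOL-Real_Asymp.Real_Asymp"
begin

text \<open>
  Both problems are solved path by path. Along a path the Stratonovich sums telescope up to a
  Riemann sum, so the execution cost is \<open>Y\<^sub>T\<^sup>2 / (2 lam) + \<beta> / lam \<integral> Y\<^sup>2\<close>. For
  \<open>\<epsilon> = 0\<close> it is bounded below by completing the square around the optimal impact, which is
  constant on \<open>[0,T)\<close> and doubles at \<open>T\<close>. For \<open>\<epsilon> > 0\<close> the Euler-Lagrange system has a solution \<open>(Z, v)\<close> with
  \<open>v = (1 - w) / \<epsilon>\<close>, where \<open>w\<close> is a constant plus a multiple of \<open>cosh (\<kappa> (t - T / 2))\<close> and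
  \<open>\<kappa>\<^sup>2 = \<beta>\<^sup>2 + \<beta> lam / \<epsilon>\<close>; its pairing with any \<open>(Y, u)\<close> is \<open>\<integral> u\<close>, which is fixed by the
  terminal constraint. Completing the square gives \<open>V \<epsilon> = \<Xi>\<^sup>2 / \<integral> v\<close> exactly, with an explicit
  \<open>\<integral> v\<close> that is then expanded. The value at \<open>\<epsilon> = 0\<close> is squeezed between the lower bound and
  the limit of \<open>V \<epsilon>\<close>.
\<close>

section \<open>Cadlag paths and Riemann sums\<close>

text \<open>Randomness cannot lower the cost: the terminal position is deterministic, so the
  deterministic optimum bounds the cost along almost every path, and the bound survives taking
  expectations. The probabilistic work that remains is that \<open>J0\<close> and
  \<open>rate\<close> are built on \<open>SOME\<close>; both have to be identified almost surely
  with explicit objects. The system for \<open>(Z, v)\<close> couples the state equation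
  \<open>Z' = lam * v - \<beta> * Z\<close> with the adjoint equation
  \<open>w' = \<beta> * (w - Z)\<close>. Its solution departs from equilibrium only in layers of
  width about \<open>1 / \<kappa>\<close> at the two ends. They smooth out the two jumps of the
  unpenalised optimum, and since \<open>1 / \<kappa>\<close> is of order
  \<open>sqrt \<epsilon>\<close> they produce the second term of the expansion. The jumping optimum
  itself is not constructed: its value is the limit of the values of smooth competitors, so only
  deterministic Lipschitz strategies have to be certified as semimartingales.\<close>

lemma cadlag_on_subset: "cadlag_on T f \<Longrightarrow> t \<le> T \<Longrightarrow> cadlag_on t f"
  by (auto simp: cadlag_on_def)

text \<open>This is the local substitute for continuity. Right of \<open>x\<close> values are
  compared with \<open>f x\<close>; left of \<open>x\<close> they are only compared with each other,
  because the left limit may differ from \<open>f x\<close>. Testing only points of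
  \<open>{0..T}\<close> makes the right half trivial at \<open>T\<close> and the left half vacuous
  at \<open>0\<close>.\<close>

lemma cadlag_on_local:
  assumes "cadlag_on T f" "0 \<le> x" "x \<le> T" "0 < e"
  shows "\<exists>d>0. (\<forall>y\<in>{0..T}. x \<le> y \<and> y < x + d \<longrightarrow> \<bar>f y - f x\<bar> < e) \<and>
    (\<forall>y\<in>{0..T}. \<forall>z\<in>{0..T}. x - d < y \<and> y < x \<and> x - d < z \<and> z < x \<longrightarrow> \<bar>f y - f z\<bar> < e)"
proof -
  have "\<exists>d>0. \<forall>y\<in>{0..T}. x \<le> y \<and> y < x + d \<longrightarrow> \<bar>f y - f x\<bar> < e"
  proof (cases "x < T")
    case True
    then have "(f \<longlongrightarrow> f x) (at_right x)" using assms by (auto simp: cadlag_on_def)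
    then have "\<forall>\<^sub>F y in at_right x. dist (f y) (f x) < e" using \<open>0 < e\<close> by (rule tendstoD)
    then obtain b where b: "b > x" "\<And>y. y > x \<Longrightarrow> y < b \<Longrightarrow> \<bar>f y - f x\<bar> < e"
      unfolding eventually_at_right[OF True] by (auto simp: dist_real_def)
    have "\<bar>f y - f x\<bar> < e" if "x \<le> y" "y < x + (b - x)" for y
      using that b \<open>0 < e\<close> by (cases "y = x") auto
    then show ?thesis using b(1) by (intro exI[of _ "b - x"]) auto
  next
    case False
    then show ?thesis using assms by (intro exI[of _ 1]) (auto dest!: antisym)
  qed
  then obtain d1 where d1: "d1 > 0" "\<forall>y\<in>{0..T}. x \<le> y \<and> y < x + d1 \<longrightarrow> \<bar>f y - f x\<bar> < e" by blast
  have "\<exists>d>0. \<forall>y\<in>{0..T}. \<forall>z\<in>{0..T}. x - d < y \<and> y < x \<and> x - d < z \<and> z < x \<longrightarrow> \<bar>f y - f z\<bar> < e"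
  proof (cases "0 < x")
    case True
    then obtain l where "(f \<longlongrightarrow> l) (at_left x)" using assms by (auto simp: cadlag_on_def)
    then have "\<forall>\<^sub>F y in at_left x. dist (f y) l < e/2" using \<open>0 < e\<close> by (intro tendstoD) auto
    then obtain b where b: "b < x" "\<And>y. y > b \<Longrightarrow> y < x \<Longrightarrow> \<bar>f y - l\<bar> < e/2"
      unfolding eventually_at_left[OF True] by (auto simp: dist_real_def)
    have "\<bar>f y - f z\<bar> < e" if "x - (x - b) < y" "y < x" "x - (x - b) < z" "z < x" for y z
      using b(2)[of y] b(2)[of z] that by linarith
    then show ?thesis using b(1) by (intro exI[of _ "x - b"]) auto
  next
    case False
    then show ?thesis by (intro exI[of _ 1]) auto
  qed
  then obtain d2 where "d2 > 0" "\<forall>y\<in>{0..T}. \<forall>z\<in>{0..T}.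
      x - d2 < y \<and> y < x \<and> x - d2 < z \<and> z < x \<longrightarrow> \<bar>f y - f z\<bar> < e" by blast
  moreover have "x - min d1 d2 < y \<Longrightarrow> x - d2 < y" "y < x + min d1 d2 \<Longrightarrow> y < x + d1" for y by auto
  ultimately show ?thesis
    using d1 by (intro exI[of _ "min d1 d2"] conjI ballI impI) (simp, blast+)
qed

lemma cadlag_on_bounded:
  assumes "cadlag_on T f"
  shows "\<exists>B. \<forall>x\<in>{0..T}. \<bar>f x\<bar> \<le> B"
proof (cases "0 \<le> T")
  case True
  \<comment> \<open>The name \<open>S\<close> hides the domain from the bisection rule, which
    generalises every visible \<open>{0..T}\<close>; the domain must stay fixed while the interval
    shrinks.\<close>
  define S where "S = {0..T}"
  from True have "\<exists>B. \<forall>x\<in>S \<inter> {0..T}. \<bar>f x\<bar> \<le> B"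
  proof (induction rule: Bolzano)
    case (trans a b c)
    then obtain B1 B2 where B: "\<forall>x\<in>S \<inter> {a..b}. \<bar>f x\<bar> \<le> B1"
      "\<forall>x\<in>S \<inter> {b..c}. \<bar>f x\<bar> \<le> B2" by blast
    have "\<bar>f x\<bar> \<le> max B1 B2" if "x \<in> S \<inter> {a..c}" for x
      using B[rule_format, of x] that by (cases "x \<le> b") auto
    then show ?case by blast
  next
    case (local x)
    then obtain d where d: "d > 0"
      "\<And>y. y \<in> S \<Longrightarrow> x \<le> y \<Longrightarrow> y < x + d \<Longrightarrow> \<bar>f y - f x\<bar> < 1"
      "\<And>y z. y \<in> S \<Longrightarrow> z \<in> S \<Longrightarrow>
        x - d < y \<Longrightarrow> y < x \<Longrightarrow> x - d < z \<Longrightarrow> z < x \<Longrightarrow> \<bar>f y - f z\<bar> < 1"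
      using cadlag_on_local[OF assms, of x 1] by (auto simp: S_def)
    obtain z where z: "\<And>y. y \<in> S \<Longrightarrow> x - d < y \<Longrightarrow> y < x \<Longrightarrow> \<bar>f y - f z\<bar> < 1"
      using d(3) by blast
    have "\<bar>f y\<bar> \<le> \<bar>f x\<bar> + \<bar>f z\<bar> + 1" if "y \<in> S" "x - d < y" "y < x + d" for y
      using d(2)[of y] z[of y] that by (cases "x \<le> y") auto
    then have "\<forall>y\<in>S \<inter> {a..b}. \<bar>f y\<bar> \<le> \<bar>f x\<bar> + \<bar>f z\<bar> + 1"
      if "a \<le> x" "x \<le> b" "b - a < d" for a b
      using that by simp
    then show ?case using d(1) by blast
  qed
  then show ?thesis by (simp add: S_def)
qed auto

text \<open>Bisection: near \<open>x\<close> the oscillation is small on each side separately, so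
  \<open>{x}\<close> is an admissible exceptional set there. Gluing two intervals adds their common
  endpoint, so that an interval avoiding the exceptional set lies entirely in one of the
  two.\<close>

lemma cadlag_on_oscillation:
  assumes "cadlag_on T f" "0 < e"
  shows "\<exists>D. finite D \<and> (\<forall>x\<in>{0..T}. \<forall>y\<in>{0..T}. x \<le> y \<and> D \<inter> {x..y} = {} \<longrightarrow> \<bar>f x - f y\<bar> < e)"
proof (cases "0 \<le> T")
  case True
  define S where "S = {0..T}"
  from True have "\<exists>D. finite D \<and> (\<forall>x\<in>S. \<forall>y\<in>S.
      0 \<le> x \<and> x \<le> y \<and> y \<le> T \<and> D \<inter> {x..y} = {} \<longrightarrow> \<bar>f x - f y\<bar> < e)"
  proof (induction rule: Bolzano)
    case (trans a b c)
    from trans(1) obtain D1 where D1: "finite D1" "\<forall>x\<in>S. \<forall>y\<in>S.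
      a \<le> x \<and> x \<le> y \<and> y \<le> b \<and> D1 \<inter> {x..y} = {} \<longrightarrow> \<bar>f x - f y\<bar> < e" by (elim exE conjE)
    from trans(2) obtain D2 where D2: "finite D2" "\<forall>x\<in>S. \<forall>y\<in>S.
      b \<le> x \<and> x \<le> y \<and> y \<le> c \<and> D2 \<inter> {x..y} = {} \<longrightarrow> \<bar>f x - f y\<bar> < e" by (elim exE conjE)
    have "\<bar>f x - f y\<bar> < e" if "x \<in> S" "y \<in> S" "a \<le> x" "x \<le> y" "y \<le> c"
      and disj: "(insert b (D1 \<union> D2)) \<inter> {x..y} = {}" for x y
    proof -
      from disj have "b < x \<or> y < b" by auto
      moreover have "D1 \<inter> {x..y} = {}" "D2 \<inter> {x..y} = {}" using disj by auto
      ultimately show ?thesis using that D1(2) D2(2) by (metis less_imp_le order_trans)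
    qed
    then show ?case using D1(1) D2(1) by (intro exI[of _ "insert b (D1 \<union> D2)"] conjI ballI impI) simp_all
  next
    case (local x)
    then obtain d where d: "d > 0"
      "\<And>y. y \<in> S \<Longrightarrow> x \<le> y \<Longrightarrow> y < x + d \<Longrightarrow> \<bar>f y - f x\<bar> < e / 2"
      "\<And>y z. y \<in> S \<Longrightarrow> z \<in> S \<Longrightarrow>
        x - d < y \<Longrightarrow> y < x \<Longrightarrow> x - d < z \<Longrightarrow> z < x \<Longrightarrow> \<bar>f y - f z\<bar> < e / 2"
      using cadlag_on_local[OF assms(1), of x "e/2"] assms(2) by (auto simp: S_def)
    have "\<bar>f y - f z\<bar> < e" if "y \<in> S" "z \<in> S" "x - d < y" "z < x + d" "y \<le> z"
      and disj: "{x} \<inter> {y..z} = {}" for y z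
    proof -
      from disj have "x < y \<or> z < x" by auto
      then show ?thesis
      proof
        assume "x < y"
        then have "\<bar>f y - f x\<bar> < e / 2" "\<bar>f z - f x\<bar> < e / 2" using d(2)[of y] d(2)[of z] that by simp_all
        then show ?thesis by linarith
      next
        assume "z < x"
        then show ?thesis using d(3)[of y z] that assms(2) by auto
      qed
    qed
    then have osc: "\<forall>y\<in>S. \<forall>z\<in>S. a \<le> y \<and> y \<le> z \<and> z \<le> b \<and> {x} \<inter> {y..z} = {} \<longrightarrow> \<bar>f y - f z\<bar> < e"
      if "a \<le> x \<and> x \<le> b \<and> b - a < d" for a b
      using that by simp
    show ?case
    proof (intro exI[of _ d] conjI allI impI d(1), rule exI[of _ "{x}"])
      fix a b assume "a \<le> x \<and> x \<le> b \<and> b - a < d"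
      from osc[OF this] show "finite {x} \<and> (\<forall>y\<in>S. \<forall>z\<in>S. a \<le> y \<and> y \<le> z \<and> z \<le> b \<and>
        {x} \<inter> {y..z} = {} \<longrightarrow> \<bar>f y - f z\<bar> < e)" by (intro conjI) simp_all
    qed
  qed
  then show ?thesis by (simp add: S_def)
qed auto

text \<open>The exceptional sets for the tolerances \<open>1 / Suc k\<close> are finite, hence
  closed. A point outside all of them has, for each \<open>k\<close>, a neighbourhood missing the
  \<open>k\<close>-th set, on which the oscillation is below that tolerance.\<close>

lemma cadlag_on_isCont:
  assumes "cadlag_on T f"
  shows "\<exists>D. countable D \<and> (\<forall>x\<in>{0<..<T} - D. isCont f x)"
proof -
  have "\<forall>k::nat. \<exists>D. finite D \<and> (\<forall>x\<in>{0..T}. \<forall>y\<in>{0..T}. x \<le> y \<and> D \<inter> {x..y} = {} \<longrightarrow>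
      \<bar>f x - f y\<bar> < 1 / real (Suc k))"
    using cadlag_on_oscillation[OF assms] by simp
  then obtain D where D: "\<And>k. finite (D k)"
    "\<And>k x y. x \<in> {0..T} \<Longrightarrow> y \<in> {0..T} \<Longrightarrow> x \<le> y \<Longrightarrow> D k \<inter> {x..y} = {} \<Longrightarrow>
      \<bar>f x - f y\<bar> < 1 / real (Suc k)"
    by metis
  have "isCont f x" if x: "x \<in> {0<..<T}" "x \<notin> (\<Union>k. D k)" for x
    unfolding continuous_at_eps_delta
  proof (intro allI impI)
    fix e :: real assume "e > 0"
    then obtain k where k: "1 / real (Suc k) < e" by (metis nat_approx_posE)
    have "open ({0<..<T} - D k)" using D(1) by (intro open_Diff finite_imp_closed) auto
    then obtain d where d: "d > 0" "ball x d \<subseteq> {0<..<T} - D k"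
      using x by (metis DiffI UN_I UNIV_I open_contains_ball)
    have "\<bar>f y - f x\<bar> < e" if "\<bar>y - x\<bar> < d" for y
    proof -
      have sub: "{min x y..max x y} \<subseteq> ball x d" using that by (auto simp: dist_real_def)
      have "\<bar>f (min x y) - f (max x y)\<bar> < 1 / real (Suc k)"
      proof (rule D(2))
        have "min x y \<in> ball x d" "max x y \<in> ball x d" using that by (auto simp: dist_real_def min_def max_def)
        then show "min x y \<in> {0..T}" "max x y \<in> {0..T}" using d(2) by fastforce+
        show "D k \<inter> {min x y..max x y} = {}" using sub d(2) by blast
      qed auto
      then show ?thesis using k by (auto simp: min_def max_def abs_minus_commute split: if_splits)
    qed
    then show "\<exists>d>0. \<forall>y. dist y x < d \<longrightarrow> dist (f y) (f x) < e"
      using d(1) unfolding dist_real_def by blast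
  qed
  then show ?thesis
    using D(1) by (intro exI[of _ "\<Union>k. D k"]) (auto intro: countable_finite)
qed

text \<open>Continuity off a countable set gives measurability; cutting \<open>f\<close> off outside
  \<open>{0..T}\<close> enlarges the exceptional set by the two endpoints only.\<close>

lemma cadlag_on_borel_measurable:
  assumes "cadlag_on T f"
  shows "set_borel_measurable borel {0..T} f"
proof -
  obtain D where D: "countable D" "\<And>x. x \<in> {0<..<T} - D \<Longrightarrow> isCont f x"
    using cadlag_on_isCont[OF assms] by blast
  have "(\<lambda>x. indicator {0..T} x *\<^sub>R f x) \<in> borel_measurable borel"
  proof (rule borel_measurable_continuous_countable_exceptions)
    show "countable (insert 0 (insert T D))" using D(1) by simp
    have "isCont (\<lambda>x. indicator {0..T} x *\<^sub>R f x) x" if x: "x \<notin> insert 0 (insert T D)" for x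
    proof (cases "x \<in> {0<..<T}")
      case True
      have "\<forall>\<^sub>F y in nhds x. y \<in> {0<..<T}" using True by (intro eventually_nhds_in_open) auto
      then have "\<forall>\<^sub>F y in nhds x. indicator {0..T} y *\<^sub>R f y = f y"
        by eventually_elim (auto simp: indicator_def)
      then show ?thesis using D(2)[of x] True x by (subst isCont_cong) auto
    next
      case False
      have "\<forall>\<^sub>F y in nhds x. y \<in> - {0..T}"
        using False x by (intro eventually_nhds_in_open) auto
      then have "\<forall>\<^sub>F y in nhds x. indicator {0..T} y *\<^sub>R f y = 0"
        by eventually_elim (auto simp: indicator_def)
      then show ?thesis by (subst isCont_cong[where g = "\<lambda>_. 0"]) auto
    qed
    then show "continuous_on (- insert 0 (insert T D)) (\<lambda>x. indicator {0..T} x *\<^sub>R f x)"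
      by (intro continuous_at_imp_continuous_on) auto
  qed
  then show ?thesis unfolding set_borel_measurable_def .
qed

section \<open>Integrability of products and Riemann sums with cadlag integrands\<close>

lemma set_integrable_bounded_mult:
  fixes f g :: "real \<Rightarrow> real"
  assumes "set_borel_measurable borel {0..t} f" "\<And>x. x \<in> {0..t} \<Longrightarrow> \<bar>f x\<bar> \<le> B"
    "set_integrable lborel {0..t} g"
  shows "set_integrable lborel {0..t} (\<lambda>s. f s * g s)"
  unfolding set_integrable_def
proof (rule Bochner_Integration.integrable_bound)
  show "integrable lborel (\<lambda>s. B * (indicator {0..t} s *\<^sub>R g s))"
    using assms(3) unfolding set_integrable_def by simp
  \<comment> \<open>Measurability is assumed only for the function cut off outside the interval, so
    the product is treated as a product of two cut-offs.\<close>
  have "(\<lambda>s. (indicator {0..t} s *\<^sub>R f s) * (indicator {0..t} s *\<^sub>R g s)) \<in> borel_measurable lborel"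
    using assms(1,3) unfolding set_borel_measurable_def set_integrable_def
    by (intro borel_measurable_times) auto
  then show "(\<lambda>s. indicator {0..t} s *\<^sub>R (f s * g s)) \<in> borel_measurable lborel"
    by (rule measurable_cong[THEN iffD1, rotated]) (auto simp: indicator_def)
  show "AE s in lborel. norm (indicator {0..t} s *\<^sub>R (f s * g s)) \<le>
      norm (B * (indicator {0..t} s *\<^sub>R g s))"
  proof (rule AE_I2)
    fix s show "norm (indicator {0..t} s *\<^sub>R (f s * g s)) \<le> norm (B * (indicator {0..t} s *\<^sub>R g s))"
      using assms(2)[of s] by (auto simp: indicator_def abs_mult intro!: mult_right_mono)
  qed
qed

lemma cadlag_on_mult_integrable:
  assumes "cadlag_on T f" "set_integrable lborel {0..T} g"
  shows "set_integrable lborel {0..T} (\<lambda>s. f s * g s)"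
  using cadlag_on_bounded[OF assms(1)] assms(2) cadlag_on_borel_measurable[OF assms(1)]
  by (metis set_integrable_bounded_mult)

lemma set_integrable_const_Icc: "set_integrable lborel {a..b} (\<lambda>s::real. c::real)"
  by (intro borel_integrable_atLeastAtMost') auto

lemma cadlag_on_integrable:
  assumes "cadlag_on T f"
  shows "set_integrable lborel {0..T} f"
  using cadlag_on_mult_integrable[OF assms set_integrable_const_Icc[of 0 T 1]] by simp

lemma partition_seq_bounds:
  assumes "partition_seq T k p" "i \<le> k n"
  shows "0 \<le> p n i" "p n i \<le> T"
proof -
  have p: "p n 0 = 0" "p n (k n) = T" "\<And>i. i < k n \<Longrightarrow> p n i \<le> p n (Suc i)"
    using assms(1) by (auto simp: partition_seq_def)
  have "p n i \<le> p n (k n)"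
    using assms(2) by (induction rule: inc_induct) (auto intro: order_trans p(3))
  then show "p n i \<le> T" using p by simp
  show "0 \<le> p n i" using assms(2)
  proof (induction i)
    case (Suc i)
    then show ?case using p(3)[of i] by simp
  qed (simp add: p)
qed

text \<open>The step functions built from the sample points are a.e. convergent, since \<open>f\<close> has only
  countably many discontinuities; summing the indicators of the partition intervals by telescoping
  avoids locating a point in the partition.\<close>

lemma cadlag_on_Riemann_sums:
  assumes f: "cadlag_on T f" and g: "set_integrable lborel {0..T} g"
    and part: "partition_seq T k p"
    and \<xi>: "\<And>n i. i < k n \<Longrightarrow> \<xi> n i \<in> {p n i..p n (Suc i)}"
  shows "(\<lambda>n. \<Sum>i<k n. f (\<xi> n i) * (LBINT s:{p n i..p n (Suc i)}. g s))
    \<longlonglongrightarrow> (LBINT s:{0..T}. f s * g s)"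
proof -
  have p: "p n 0 = 0" "p n (k n) = T" "\<And>i. i < k n \<Longrightarrow> p n i \<le> p n (Suc i)" for n
    using part by (auto simp: partition_seq_def)
  have pb: "0 \<le> p n i" "p n i \<le> T" if "i \<le> k n" for n i
    using partition_seq_bounds[OF part that] by auto
  obtain B where B: "\<And>x. x \<in> {0..T} \<Longrightarrow> \<bar>f x\<bar> \<le> B" using cadlag_on_bounded[OF f] by blast
  \<comment> \<open>Half-open intervals let each point of \<open>[0,T)\<close> belong to exactly one
    partition interval, also when some intervals are degenerate. The lost point \<open>T\<close> is
    a null set.\<close>
  define ind where "ind n i s = (indicator {p n i..<p n (Suc i)} s :: real)" for n i s
  define \<phi> where "\<phi> n s = (\<Sum>i<k n. f (\<xi> n i) * ind n i s)" for n s
  have ind_sum: "(\<Sum>i<k n. ind n i s) = 1" if "0 \<le> s" "s < T" for n s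
  proof -
    have "(\<Sum>i<k n. ind n i s) = (\<Sum>i<k n. indicator {p n i..} s - indicator {p n (Suc i)..} s)"
    proof (rule sum.cong[OF refl])
      fix i assume "i \<in> {..<k n}"
      then have "p n i \<le> p n (Suc i)" using p(3) by simp
      then show "ind n i s = indicator {p n i..} s - indicator {p n (Suc i)..} s"
        by (auto simp: ind_def indicator_def)
    qed
    also have "\<dots> = indicator {p n 0..} s - indicator {p n (k n)..} s"
      by (rule sum_lessThan_telescope')
    finally show ?thesis using that p by simp
  qed
  have ind_nonneg: "0 \<le> ind n i s" for n i s by (simp add: ind_def)
  \<comment> \<open>The weights \<open>ind n i s\<close> are nonnegative with sum one, so
    \<open>\<phi> n s\<close> is an average of sampled values. With \<open>c = 0\<close> this gives
    the dominating bound, with \<open>c = f s\<close> the convergence.\<close>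
  have \<phi>_diff: "\<bar>\<phi> n s - c\<bar> \<le> d"
    if "0 \<le> s" "s < T" and d: "\<And>i. i < k n \<Longrightarrow> s \<in> {p n i..<p n (Suc i)} \<Longrightarrow> \<bar>f (\<xi> n i) - c\<bar> \<le> d"
    for n s c d
  proof -
    have "\<phi> n s - c = (\<Sum>i<k n. f (\<xi> n i) * ind n i s) - c * (\<Sum>i<k n. ind n i s)"
      using ind_sum[OF that(1,2)] by (simp add: \<phi>_def)
    also have "\<dots> = (\<Sum>i<k n. (f (\<xi> n i) - c) * ind n i s)"
      by (simp add: sum_distrib_left sum_subtractf[symmetric] algebra_simps)
    also have "\<bar>\<dots>\<bar> \<le> (\<Sum>i<k n. \<bar>(f (\<xi> n i) - c) * ind n i s\<bar>)" by (rule sum_abs)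
    also have "\<dots> \<le> (\<Sum>i<k n. d * ind n i s)"
      using d by (intro sum_mono) (auto simp: ind_def abs_mult indicator_def)
    also have "\<dots> = d" using ind_sum[OF that(1,2)] by (simp add: sum_distrib_left[symmetric])
    finally show ?thesis .
  qed
  obtain D where D: "countable D" "\<And>x. x \<in> {0<..<T} - D \<Longrightarrow> isCont f x"
    using cadlag_on_isCont[OF f] by blast
  define G where "G s = indicator {0..T} s * g s" for s
  have G: "integrable lborel G" using g by (simp add: G_def[abs_def] set_integrable_def)
  then have [measurable]: "G \<in> borel_measurable borel" by auto
  have conv: "(\<lambda>n. LBINT s. indicator {0..<T} s * (\<phi> n s * G s))
      \<longlonglongrightarrow> (LBINT s. indicator {0..T} s *\<^sub>R (f s * g s))"
  proof (rule integral_dominated_convergence[where w = "\<lambda>s. B * \<bar>G s\<bar>"])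
    show "(\<lambda>s. indicator {0..T} s *\<^sub>R (f s * g s)) \<in> borel_measurable lborel"
      using cadlag_on_mult_integrable[OF f g] by (auto simp: set_integrable_def)
    show "(\<lambda>s. indicator {0..<T} s * (\<phi> n s * G s)) \<in> borel_measurable lborel" for n
      unfolding \<phi>_def ind_def by measurable
    show "integrable lborel (\<lambda>s. B * \<bar>G s\<bar>)" using G by auto
    show "AE s in lborel. norm (indicator {0..<T} s * (\<phi> n s * G s)) \<le> B * \<bar>G s\<bar>" for n
    proof (rule AE_I2)
      fix s
      show "norm (indicator {0..<T} s * (\<phi> n s * G s)) \<le> B * \<bar>G s\<bar>"
      proof (cases "s \<in> {0..<T}")
        case True
        have "\<bar>\<phi> n s - 0\<bar> \<le> B"
        proof (rule \<phi>_diff)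
          fix i assume "i < k n"
          then have "\<xi> n i \<in> {0..T}" using \<xi>[of i n] pb[of i n] pb[of "Suc i" n] by auto
          then show "\<bar>f (\<xi> n i) - 0\<bar> \<le> B" using B by simp
        qed (use True in auto)
        then show ?thesis using True by (auto simp: abs_mult intro!: mult_right_mono)
      next
        case False
        \<comment> \<open>The sign of \<open>B\<close> can only be read off at a point of
          \<open>{0..T}\<close>; elsewhere \<open>G\<close> is zero.\<close>
        have "0 \<le> B \<or> G s = 0" using B[of s] unfolding G_def by (cases "s \<in> {0..T}") auto
        then show ?thesis using False by auto
      qed
    qed
    have "AE s in lborel. s \<notin> insert 0 (insert T D)"
      using D(1) by (intro AE_not_in countable_imp_null_set_lborel) auto
    then show "AE s in lborel. (\<lambda>n. indicator {0..<T} s * (\<phi> n s * G s))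
        \<longlonglongrightarrow> indicator {0..T} s *\<^sub>R (f s * g s)"
    proof eventually_elim
      fix s assume s: "s \<notin> insert 0 (insert T D)"
      show "(\<lambda>n. indicator {0..<T} s * (\<phi> n s * G s)) \<longlonglongrightarrow> indicator {0..T} s *\<^sub>R (f s * g s)"
      proof (cases "s \<in> {0<..<T}")
        case True
        have "(\<lambda>n. \<phi> n s) \<longlonglongrightarrow> f s"
        proof (rule LIMSEQ_I)
          fix e :: real assume "0 < e"
          have "isCont f s" using D(2) True s by auto
          then obtain d where d: "d > 0" "\<And>y. \<bar>y - s\<bar> < d \<Longrightarrow> \<bar>f y - f s\<bar> < e / 2"
            unfolding continuous_at_eps_delta dist_real_def using \<open>0 < e\<close> by (metis half_gt_zero)
          have "\<forall>\<^sub>F n in sequentially. \<forall>i<k n. p n (Suc i) - p n i < d"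
            using part d(1) by (auto simp: partition_seq_def)
          then have "\<forall>\<^sub>F n in sequentially. \<bar>\<phi> n s - f s\<bar> \<le> e / 2"
          proof eventually_elim
            case (elim n)
            show ?case
            proof (rule \<phi>_diff)
              fix i assume i: "i < k n" "s \<in> {p n i..<p n (Suc i)}"
              then have "\<bar>\<xi> n i - s\<bar> < d" using elim[rule_format, OF i(1)] \<xi>[OF i(1)] by auto
              then show "\<bar>f (\<xi> n i) - f s\<bar> \<le> e / 2" using d(2) by (simp add: less_imp_le)
            qed (use True in auto)
          qed
          then have "\<forall>\<^sub>F n in sequentially. norm (\<phi> n s - f s) < e"
            by eventually_elim (use \<open>0 < e\<close> in auto)
          then show "\<exists>N. \<forall>n\<ge>N. norm (\<phi> n s - f s) < e" by (simp add: eventually_sequentially)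
        qed
        then have "(\<lambda>n. \<phi> n s * G s) \<longlonglongrightarrow> f s * G s" by (intro tendsto_intros)
        then show ?thesis using True by (simp add: G_def)
      next
        case False
        then show ?thesis using s by (auto simp: indicator_def)
      qed
    qed
  qed
  have sum_eq: "(LBINT s. indicator {0..<T} s * (\<phi> n s * G s)) =
      (\<Sum>i<k n. f (\<xi> n i) * (LBINT s:{p n i..p n (Suc i)}. g s))" for n
  proof -
    have int: "integrable lborel (\<lambda>s. ind n i s * G s)" for i
      using integrable_mult_indicator[OF _ G, of "{p n i..<p n (Suc i)}"] by (simp add: ind_def)
    have "(LBINT s. indicator {0..<T} s * (\<phi> n s * G s)) =
        (LBINT s. (\<Sum>i<k n. f (\<xi> n i) * (ind n i s * G s)))"
    proof (rule Bochner_Integration.integral_cong[OF refl])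
      fix s
      have "(\<Sum>i<k n. f (\<xi> n i) * (ind n i s * G s)) = \<phi> n s * G s"
        by (simp add: \<phi>_def sum_distrib_right mult.assoc)
      moreover have "\<phi> n s * G s = 0" if "s \<notin> {0..<T}"
      proof -
        have "ind n i s = 0" if "i < k n" for i
          using pb[of i n] pb[of "Suc i" n] that \<open>s \<notin> {0..<T}\<close> by (auto simp: ind_def indicator_def)
        then show ?thesis by (simp add: \<phi>_def)
      qed
      ultimately show "indicator {0..<T} s * (\<phi> n s * G s) = (\<Sum>i<k n. f (\<xi> n i) * (ind n i s * G s))"
        by (auto simp: indicator_def)
    qed
    also have "\<dots> = (\<Sum>i<k n. f (\<xi> n i) * (LBINT s. ind n i s * G s))"
      using int by (subst Bochner_Integration.integral_sum) auto
    also have "\<dots> = (\<Sum>i<k n. f (\<xi> n i) * (LBINT s:{p n i..p n (Suc i)}. g s))"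
    proof (rule sum.cong[OF refl])
      fix i assume "i \<in> {..<k n}"
      then have i: "i < k n" by simp
      have [measurable]: "(\<lambda>s. indicator {p n i..p n (Suc i)} s * g s) \<in> borel_measurable borel"
      proof (rule measurable_cong[THEN iffD1])
        show "(\<lambda>s. indicator {p n i..p n (Suc i)} s * G s) \<in> borel_measurable borel" by measurable
        fix s show "indicator {p n i..p n (Suc i)} s * G s = indicator {p n i..p n (Suc i)} s * g s"
          using pb[of i n] pb[of "Suc i" n] i by (auto simp: G_def indicator_def)
      qed
      have "(LBINT s. ind n i s * G s) = (LBINT s:{p n i..p n (Suc i)}. g s)"
        unfolding set_lebesgue_integral_def
      proof (rule integral_cong_AE)
        show "AE s in lborel. ind n i s * G s = indicator {p n i..p n (Suc i)} s *\<^sub>R g s"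
          using AE_lborel_singleton[of "p n (Suc i)"]
        proof eventually_elim
          case (elim s)
          then show ?case using pb[of i n] pb[of "Suc i" n] i by (auto simp: G_def ind_def indicator_def)
        qed
      qed (auto simp: ind_def)
      then show "f (\<xi> n i) * (LBINT s. ind n i s * G s) = f (\<xi> n i) * (LBINT s:{p n i..p n (Suc i)}. g s)"
        by simp
    qed
    finally show ?thesis .
  qed
  show ?thesis using conv unfolding sum_eq set_lebesgue_integral_def .
qed

section \<open>The impact equation along a path\<close>

lemma continuous_on_cadlag_on:
  assumes "continuous_on {0..T} f"
  shows "cadlag_on T f"
  unfolding cadlag_on_def
proof (intro conjI allI impI)
  fix t assume t: "0 \<le> t \<and> t < T"
  have "continuous_on {t..T} f" by (rule continuous_on_subset[OF assms]) (use t in auto)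
  then show "(f \<longlongrightarrow> f t) (at_right t)" using t by (intro continuous_on_Icc_at_rightD) auto
next
  fix t assume t: "0 < t \<and> t \<le> T"
  have "continuous_on {0..t} f" by (rule continuous_on_subset[OF assms]) (use t in auto)
  then have "(f \<longlongrightarrow> f t) (at_left t)" using t by (intro continuous_on_Icc_at_leftD) auto
  then show "\<exists>l. (f \<longlongrightarrow> l) (at_left t)" by blast
qed

lemma cadlag_on_add:
  assumes "cadlag_on T f" "cadlag_on T g"
  shows "cadlag_on T (\<lambda>t. f t + g t)"
  unfolding cadlag_on_def
proof (intro conjI allI impI)
  fix t assume "0 \<le> t \<and> t < T"
  then show "((\<lambda>t. f t + g t) \<longlongrightarrow> f t + g t) (at_right t)"
    using assms by (intro tendsto_add) (auto simp: cadlag_on_def)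
next
  fix t assume t: "0 < t \<and> t \<le> T"
  obtain l m where "(f \<longlongrightarrow> l) (at_left t)" "(g \<longlongrightarrow> m) (at_left t)"
    using assms t unfolding cadlag_on_def by metis
  then show "\<exists>l. ((\<lambda>t. f t + g t) \<longlongrightarrow> l) (at_left t)" by (intro exI[of _ "l + m"] tendsto_add)
qed

lemma cadlag_on_mult:
  assumes "cadlag_on T f" "cadlag_on T g"
  shows "cadlag_on T (\<lambda>t. f t * g t)"
  unfolding cadlag_on_def
proof (intro conjI allI impI)
  fix t assume "0 \<le> t \<and> t < T"
  then show "((\<lambda>t. f t * g t) \<longlongrightarrow> f t * g t) (at_right t)"
    using assms by (intro tendsto_mult) (auto simp: cadlag_on_def)
next
  fix t assume t: "0 < t \<and> t \<le> T"
  obtain l m where "(f \<longlongrightarrow> l) (at_left t)" "(g \<longlongrightarrow> m) (at_left t)"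
    using assms t unfolding cadlag_on_def by metis
  then show "\<exists>l. ((\<lambda>t. f t * g t) \<longlongrightarrow> l) (at_left t)" by (intro exI[of _ "l * m"] tendsto_mult)
qed

lemma set_integrable_Icc_subset:
  fixes f :: "real \<Rightarrow> real"
  shows "set_integrable lborel {0..T} f \<Longrightarrow> t \<le> T \<Longrightarrow> set_integrable lborel {0..t} f"
  by (erule set_integrable_subset) auto

lemma indefinite_integral_continuous_on:
  fixes f :: "real \<Rightarrow> real"
  assumes "set_integrable lborel {0..T} f"
  shows "continuous_on {0..T} (\<lambda>t. LBINT s:{0..t}. f s)"
proof -
  have "continuous_on {0..T} (\<lambda>t. integral {0..t} f)"
    using set_borel_integral_eq_integral(1)[OF assms] by (rule indefinite_integral_continuous_1)
  then show ?thesis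
    by (rule continuous_on_cong[THEN iffD1, rotated -1, OF _ refl])
      (simp add: set_borel_integral_eq_integral(2) set_integrable_Icc_subset[OF assms])
qed

lemma set_integral_Icc_diff:
  fixes f :: "real \<Rightarrow> real"
  assumes "set_integrable lborel {0..T} f" "0 \<le> a" "a \<le> b" "b \<le> T"
  shows "(LBINT s:{0..b}. f s) - (LBINT s:{0..a}. f s) = (LBINT s:{a..b}. f s)"
proof -
  have "integral {0..a} f + integral {a..b} f = integral {0..b} f"
    using assms set_borel_integral_eq_integral(1)[OF set_integrable_Icc_subset[OF assms(1), of b]]
    by (intro Henstock_Kurzweil_Integration.integral_combine) auto
  moreover have "set_integrable lborel {a..b} f"
    by (rule set_integrable_subset[OF assms(1)]) (use assms in auto)
  ultimately show ?thesis
    using assms by (simp add: set_borel_integral_eq_integral(2) set_integrable_Icc_subset[OF assms(1)])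
qed

lemma set_integral_singleton [simp]: "(LBINT s:{a::real}. (f s :: real)) = 0"
proof -
  have "AE s in lborel. indicator {a} s *\<^sub>R f s = 0"
    using AE_lborel_singleton[of a] by eventually_elim auto
  then show ?thesis
    unfolding set_lebesgue_integral_def by (rule integral_eq_zero_AE)
qed

lemma continuous_on_mult_integrable:
  fixes g w :: "real \<Rightarrow> real"
  assumes "set_integrable lborel {0..t} g" "continuous_on {0..t} w"
  shows "set_integrable lborel {0..t} (\<lambda>s. g s * w s)"
  using cadlag_on_mult_integrable[OF continuous_on_cadlag_on[OF assms(2)] assms(1)]
  by (simp add: mult.commute)

text \<open>Since \<open>g\<close> is merely integrable, its primitive may fail to have derivative
  \<open>g\<close> at some points, and the product rule is replaced by Fubini on the triangle
  \<open>r \<le> s \<le> t\<close>. Integrating \<open>w'\<close> over \<open>{r..t}\<close> first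
  gives \<open>w t - w r\<close>, which is where the two terms on the right come from.\<close>

lemma indefinite_integral_by_parts:
  fixes g w w' :: "real \<Rightarrow> real"
  assumes t: "0 \<le> t" and g: "set_integrable lborel {0..t} g"
    and w: "\<And>x. x \<in> {0..t} \<Longrightarrow> (w has_real_derivative w' x) (at x)"
    and w': "continuous_on {0..t} w'"
  shows "(LBINT s:{0..t}. (LBINT r:{0..s}. g r) * w' s)
    = w t * (LBINT s:{0..t}. g s) - (LBINT s:{0..t}. g s * w s)"
proof -
  define a where "a s = indicator {0..t} s * w' s" for s
  define b where "b r = indicator {0..t} r * g r" for r
  have a: "integrable lborel a"
    using borel_integrable_atLeastAtMost'[OF w'] by (simp add: a_def[abs_def] set_integrable_def)
  have b: "integrable lborel b"
    using g by (simp add: b_def[abs_def] set_integrable_def)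
  have [measurable]: "a \<in> borel_measurable borel" "b \<in> borel_measurable borel" using a b by auto
  define h where "h s r = a s * (b r * indicator {..s} r)" for s r
  have [measurable]: "case_prod h \<in> borel_measurable (borel \<Otimes>\<^sub>M borel)"
  proof -
    have "case_prod h = (\<lambda>(s, r). if r \<le> s then a s * b r else 0)" by (auto simp: h_def fun_eq_iff)
    also have "\<dots> \<in> borel_measurable (borel \<Otimes>\<^sub>M borel)" by measurable
    finally show ?thesis .
  qed
  have inth: "integrable lborel (\<lambda>r. b r * indicator {..s} r)" for s
    using integrable_mult_indicator[OF _ b, of "{..s}"] by (simp add: mult.commute)
  have "integrable (lborel \<Otimes>\<^sub>M lborel) (case_prod h)"
  proof (rule lborel_pair.Fubini_integrable)
    show "AE s in lborel. integrable lborel (\<lambda>r. case_prod h (s, r))"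
      using inth by (auto simp: h_def)
    show "integrable lborel (\<lambda>s. LBINT r. norm (case_prod h (s, r)))"
    \<comment> \<open>Dropping the cut-off \<open>r \<le> s\<close> in the inner integral bounds it
      by a constant, so \<open>a\<close> alone controls the outer integral.\<close>
    proof (rule Bochner_Integration.integrable_bound)
      show "integrable lborel (\<lambda>s. a s * (LBINT r. \<bar>b r\<bar>))" using a by simp
      show "AE s in lborel. norm (LBINT r. norm (case_prod h (s, r))) \<le> norm (a s * (LBINT r. \<bar>b r\<bar>))"
      proof (rule AE_I2)
        fix s
        have "(LBINT r. norm (h s r)) = \<bar>a s\<bar> * (LBINT r. \<bar>b r * indicator {..s} r\<bar>)"
          by (simp add: h_def abs_mult)
        also have "\<dots> \<le> \<bar>a s\<bar> * (LBINT r. \<bar>b r\<bar>)"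
          using inth[of s] b by (intro mult_left_mono integral_mono) (auto simp: indicator_def)
        finally show "norm (LBINT r. norm (case_prod h (s, r))) \<le> norm (a s * (LBINT r. \<bar>b r\<bar>))"
          by (simp add: abs_mult)
      qed
    qed simp
  qed simp
  then have fub: "(LBINT r. (LBINT s. h s r)) = (LBINT s. (LBINT r. h s r))"
    by (rule lborel_pair.Fubini_integral)
  have "(LBINT r. h s r) = indicator {0..t} s *\<^sub>R ((LBINT r:{0..s}. g r) * w' s)" for s
  proof (cases "s \<in> {0..t}")
    case True
    then have "b r * indicator {..s} r = indicator {0..s} r *\<^sub>R g r" for r
      by (auto simp: b_def indicator_def)
    then show ?thesis using True by (simp add: h_def set_lebesgue_integral_def a_def)
  qed (simp add: h_def a_def)
  then have 1: "(LBINT s. (LBINT r. h s r)) = (LBINT s:{0..t}. (LBINT r:{0..s}. g r) * w' s)"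
    unfolding set_lebesgue_integral_def by simp
  have "(LBINT s. h s r) = w t * (indicator {0..t} r *\<^sub>R g r) - indicator {0..t} r *\<^sub>R (g r * w r)" for r
  proof (cases "r \<in> {0..t}")
    case True
    then have "a s * indicator {..s} r = indicator {r..t} s *\<^sub>R w' s" for s
      by (auto simp: a_def indicator_def)
    then have "h s r = b r * (indicator {r..t} s *\<^sub>R w' s)" for s
      by (simp add: h_def mult.left_commute)
    then have "(LBINT s. h s r) = b r * (LBINT s. indicator {r..t} s *\<^sub>R w' s)" by simp
    also have "(LBINT s. indicator {r..t} s *\<^sub>R w' s) = w t - w r"
      using True w by (intro integral_FTC_atLeastAtMost)
        (auto intro: continuous_on_subset[OF w'] has_field_derivative_at_within
          simp: has_real_derivative_iff_has_vector_derivative[symmetric])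
    finally show ?thesis using True by (simp add: b_def algebra_simps)
  qed (simp add: h_def b_def)
  then have "(LBINT r. (LBINT s. h s r)) =
      (LBINT r. w t * (indicator {0..t} r *\<^sub>R g r) - indicator {0..t} r *\<^sub>R (g r * w r))" by simp
  also have "\<dots> = w t * (LBINT s:{0..t}. g s) - (LBINT s:{0..t}. g s * w s)"
  proof -
    have "continuous_on {0..t} w"
      using w by (intro DERIV_continuous_on[of _ w]) (auto intro: has_field_derivative_at_within)
    then have "set_integrable lborel {0..t} (\<lambda>s. g s * w s)"
      using g by (rule continuous_on_mult_integrable[rotated])
    then show ?thesis using g unfolding set_integrable_def set_lebesgue_integral_def
      by (subst Bochner_Integration.integral_diff) auto
  qed
  finally show ?thesis using fub 1 by simp
qed

section \<open>Explicit solution of the impact equation\<close>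

text \<open>Variation of constants with zero initial impact, that is \<open>lam\<close> times the
  integral of \<open>exp (- \<beta> * (t - s))\<close> against \<open>dq s\<close>. It is integrated
  by parts, so a path that is only cadlag enters through its values and a Lebesgue integral.\<close>

definition impact_path :: "real \<Rightarrow> real \<Rightarrow> (real \<Rightarrow> real) \<Rightarrow> real \<Rightarrow> real" where
  "impact_path \<beta> lam q t = lam * (q t - \<beta> * exp (- \<beta> * t) * (LBINT s:{0..t}. q s * exp (\<beta> * s)))"

lemma impact_path_solves:
  assumes q: "cadlag_on T q"
  shows "solves_impact T \<beta> lam 0 q (impact_path \<beta> lam q)"
proof -
  define G where "G t = (LBINT s:{0..t}. q s * exp (\<beta> * s))" for t
  have int: "set_integrable lborel {0..T} (\<lambda>s. q s * exp (\<beta> * s))"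
    by (intro continuous_on_mult_integrable cadlag_on_integrable q continuous_intros)
  have G: "continuous_on {0..T} G"
    unfolding G_def using int by (rule indefinite_integral_continuous_on)
  define H where "H t = - \<beta> * exp (- \<beta> * t) * G t" for t
  have Hc: "cadlag_on T H"
    unfolding H_def by (intro continuous_on_cadlag_on continuous_intros G)
  have eq: "impact_path \<beta> lam q t = lam * q t + lam * H t" for t
    by (simp add: impact_path_def H_def G_def algebra_simps)
  have "cadlag_on T (impact_path \<beta> lam q)"
    unfolding eq[abs_def]
    by (intro cadlag_on_add cadlag_on_mult q Hc) (auto intro: continuous_on_cadlag_on continuous_intros)
  moreover have "impact_path \<beta> lam q t = 0 - \<beta> * (LBINT s:{0..t}. impact_path \<beta> lam q s) + lam * q t"
    if t: "t \<in> {0..T}" for t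
  proof -
    have i1: "set_integrable lborel {0..t} q"
      using t cadlag_on_subset[OF q] by (intro cadlag_on_integrable) auto
    have i2: "set_integrable lborel {0..t} H"
      using t cadlag_on_subset[OF Hc] by (intro cadlag_on_integrable) auto
    \<comment> \<open>Integration by parts against \<open>exp (- \<beta> * s)\<close>: the two
      exponentials cancel in the last term and leave the plain integral of \<open>q\<close>, as
      required by the integrated equation.\<close>
    have "(LBINT s:{0..t}. G s * (- \<beta> * exp (- \<beta> * s))) =
        exp (- \<beta> * t) * G t - (LBINT s:{0..t}. q s * exp (\<beta> * s) * exp (- \<beta> * s))"
      unfolding G_def
      by (rule indefinite_integral_by_parts)
        (use t set_integrable_Icc_subset[OF int] in \<open>auto intro!: derivative_eq_intros continuous_intros\<close>)
    also have "(LBINT s:{0..t}. q s * exp (\<beta> * s) * exp (- \<beta> * s)) = (LBINT s:{0..t}. q s)"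
      by (simp add: mult.assoc exp_minus_inverse)
    finally have ibp: "(LBINT s:{0..t}. H s) = exp (- \<beta> * t) * G t - (LBINT s:{0..t}. q s)"
      by (simp add: H_def mult.commute)
    have "(LBINT s:{0..t}. impact_path \<beta> lam q s) =
        lam * (LBINT s:{0..t}. q s) + lam * (LBINT s:{0..t}. H s)"
      unfolding eq using i1 i2 by (subst set_integral_add) auto
    then show ?thesis unfolding ibp by (simp add: eq H_def algebra_simps)
  qed
  ultimately show ?thesis unfolding solves_impact_def by blast
qed

text \<open>Only the primitive of \<open>f\<close> has to be determined: it satisfies a linear
  equation with integrating factor \<open>exp (\<beta> * s)\<close>, and the equation itself then
  returns \<open>f t\<close>. Consequently the choice made in \<open>impact\<close> does not matter
  on \<open>{0..T}\<close>.\<close>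

lemma solves_impact_unique:
  assumes f: "solves_impact T \<beta> lam 0 q f" and q: "cadlag_on T q" and t: "t \<in> {0..T}"
  shows "f t = impact_path \<beta> lam q t"
proof -
  have fc: "cadlag_on T f" and feq: "\<And>s. s \<in> {0..T} \<Longrightarrow> f s = - \<beta> * (LBINT r:{0..s}. f r) + lam * q s"
    using f by (auto simp: solves_impact_def)
  have fi: "set_integrable lborel {0..t} f"
    using t cadlag_on_subset[OF fc] by (intro cadlag_on_integrable) auto
  have Fi: "set_integrable lborel {0..t} (\<lambda>s. (LBINT r:{0..s}. f r) * (\<beta> * exp (\<beta> * s)))"
    by (intro continuous_on_mult_integrable borel_integrable_atLeastAtMost'
        indefinite_integral_continuous_on fi continuous_intros)
  have qi: "set_integrable lborel {0..t} (\<lambda>s. q s * exp (\<beta> * s))"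
    using t cadlag_on_subset[OF q]
    by (intro continuous_on_mult_integrable cadlag_on_integrable continuous_intros) auto
  have "(LBINT s:{0..t}. (LBINT r:{0..s}. f r) * (\<beta> * exp (\<beta> * s))) =
      exp (\<beta> * t) * (LBINT s:{0..t}. f s) - (LBINT s:{0..t}. f s * exp (\<beta> * s))"
    using t fi by (intro indefinite_integral_by_parts) (auto intro!: derivative_eq_intros continuous_intros)
  also have "(LBINT s:{0..t}. f s * exp (\<beta> * s)) =
      (LBINT s:{0..t}. lam * (q s * exp (\<beta> * s)) - (LBINT r:{0..s}. f r) * (\<beta> * exp (\<beta> * s)))"
  proof (rule set_lebesgue_integral_cong)
    show "\<forall>s. s \<in> {0..t} \<longrightarrow> f s * exp (\<beta> * s) =
        lam * (q s * exp (\<beta> * s)) - (LBINT r:{0..s}. f r) * (\<beta> * exp (\<beta> * s))"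
    proof (intro allI impI)
      fix s assume "s \<in> {0..t}"
      then have fs: "f s = - \<beta> * (LBINT r:{0..s}. f r) + lam * q s" using t by (intro feq) auto
      show "f s * exp (\<beta> * s) =
          lam * (q s * exp (\<beta> * s)) - (LBINT r:{0..s}. f r) * (\<beta> * exp (\<beta> * s))"
        by (subst fs) (simp add: algebra_simps)
    qed
  qed simp
  also have "\<dots> = lam * (LBINT s:{0..t}. q s * exp (\<beta> * s)) -
      (LBINT s:{0..t}. (LBINT r:{0..s}. f r) * (\<beta> * exp (\<beta> * s)))"
    using qi Fi by (subst set_integral_diff) auto
  finally have "exp (\<beta> * t) * (LBINT s:{0..t}. f s) = lam * (LBINT s:{0..t}. q s * exp (\<beta> * s))" by simp
  then have "(LBINT s:{0..t}. f s) = exp (- \<beta> * t) * (lam * (LBINT s:{0..t}. q s * exp (\<beta> * s)))"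
    by (simp add: exp_minus field_simps)
  then show ?thesis using feq[OF t] by (simp add: impact_path_def algebra_simps)
qed

section \<open>The execution cost of a single path\<close>

definition path_cost :: "real \<Rightarrow> real \<Rightarrow> real \<Rightarrow> (real \<Rightarrow> real) \<Rightarrow> real" where
  "path_cost T \<beta> lam Y = (Y T)\<^sup>2 / (2 * lam) + \<beta> / lam * (LBINT s:{0..T}. (Y s)\<^sup>2)"

text \<open>On a partition interval \<open>lam\<close> times the increment of \<open>q\<close> is
  the increment of \<open>Y\<close> plus \<open>\<beta>\<close> times the integral of
  \<open>Y\<close>. Multiplied by the mean of the two endpoint values of \<open>Y\<close>, the
  former gives exactly half a difference of squares, the latter the average of a left and a right
  Riemann sum with weight \<open>Y\<close>.\<close>

lemma stratonovich_sums_tendsto: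
  assumes Y: "solves_impact T \<beta> lam 0 q Y" and lam: "lam \<noteq> 0" and part: "partition_seq T k p"
  shows "(\<lambda>n. integral_sum 0 Y 0 q (k n) (p n) + 1 / 2 * covariation_sum 0 Y 0 q (k n) (p n))
    \<longlonglongrightarrow> path_cost T \<beta> lam Y"
proof -
  have p: "p n 0 = 0" "p n (k n) = T" "\<And>i. i < k n \<Longrightarrow> p n i \<le> p n (Suc i)" for n
    using part by (auto simp: partition_seq_def)
  have pb: "0 \<le> p n i" "p n i \<le> T" if "i \<le> k n" for n i
    using partition_seq_bounds[OF part that] by auto
  have T: "0 \<le> T" using pb[of 0 0] by simp
  have Yc: "cadlag_on T Y" and Yeq: "\<And>s. s \<in> {0..T} \<Longrightarrow> Y s = - \<beta> * (LBINT r:{0..s}. Y r) + lam * q s"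
    using Y by (auto simp: solves_impact_def)
  have Yi: "set_integrable lborel {0..T} Y" using Yc by (rule cadlag_on_integrable)
  define I where "I n i = (LBINT s:{p n i..p n (Suc i)}. Y s)" for n i
  have lim: "(\<lambda>n. (Y T)\<^sup>2 / (2 * lam) + \<beta> / (2 * lam) *
      ((\<Sum>i<k n. Y (p n i) * I n i) + (\<Sum>i<k n. Y (p n (Suc i)) * I n i)))
    \<longlonglongrightarrow> (Y T)\<^sup>2 / (2 * lam) + \<beta> / (2 * lam) *
      ((LBINT s:{0..T}. Y s * Y s) + (LBINT s:{0..T}. Y s * Y s))"
    unfolding I_def using p(3)
    by (intro tendsto_intros cadlag_on_Riemann_sums[OF Yc Yi part]) auto
  have "integral_sum 0 Y 0 q (k n) (p n) + 1 / 2 * covariation_sum 0 Y 0 q (k n) (p n) =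
      (Y T)\<^sup>2 / (2 * lam) + \<beta> / (2 * lam) *
      ((\<Sum>i<k n. Y (p n i) * I n i) + (\<Sum>i<k n. Y (p n (Suc i)) * I n i))" for n
  proof -
    have step: "Y (p n i) * (q (p n (Suc i)) - q (p n i)) +
        1 / 2 * ((Y (p n (Suc i)) - Y (p n i)) * (q (p n (Suc i)) - q (p n i))) =
        ((Y (p n (Suc i)))\<^sup>2 - (Y (p n i))\<^sup>2) / (2 * lam) +
        \<beta> / (2 * lam) * (Y (p n i) * I n i + Y (p n (Suc i)) * I n i)" if i: "i < k n" for i
    proof -
      have "I n i = (LBINT s:{0..p n (Suc i)}. Y s) - (LBINT s:{0..p n i}. Y s)"
        unfolding I_def using pb[of i n] pb[of "Suc i" n] p(3)[OF i] i
        by (intro set_integral_Icc_diff[OF Yi, symmetric]) auto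
      then have "\<beta> * I n i = \<beta> * (LBINT s:{0..p n (Suc i)}. Y s) - \<beta> * (LBINT s:{0..p n i}. Y s)"
        by (simp add: right_diff_distrib)
      moreover have "Y (p n i) = - \<beta> * (LBINT s:{0..p n i}. Y s) + lam * q (p n i)"
        "Y (p n (Suc i)) = - \<beta> * (LBINT s:{0..p n (Suc i)}. Y s) + lam * q (p n (Suc i))"
        using pb[of i n] pb[of "Suc i" n] i by (intro Yeq; simp)+
      ultimately have "lam * q (p n (Suc i)) - lam * q (p n i) = Y (p n (Suc i)) - Y (p n i) + \<beta> * I n i"
        by linarith
      then have dq: "q (p n (Suc i)) - q (p n i) = (Y (p n (Suc i)) - Y (p n i) + \<beta> * I n i) / lam"
        using lam by (simp add: field_simps)
      show ?thesis unfolding dq using lam by (simp add: field_simps power2_eq_square)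
    qed
    \<comment> \<open>The jump at time zero enters through the covariation only, with weight one
      half. It contributes \<open>(Y 0)\<^sup>2 / (2 * lam)\<close> and cancels the lower end of the
      telescoping sum.\<close>
    have "Y 0 = lam * q 0" using Yeq[of 0] T by simp
    then have q0: "q 0 = Y 0 / lam" using lam by simp
    have "integral_sum 0 Y 0 q (k n) (p n) + 1 / 2 * covariation_sum 0 Y 0 q (k n) (p n) =
        1 / 2 * (Y 0 * q 0) + (\<Sum>i<k n. Y (p n i) * (q (p n (Suc i)) - q (p n i)) +
        1 / 2 * ((Y (p n (Suc i)) - Y (p n i)) * (q (p n (Suc i)) - q (p n i))))"
      by (simp add: integral_sum_def covariation_sum_def sum.distrib sum_distrib_left[symmetric]
          sum_divide_distrib[symmetric])
    also have "\<dots> = 1 / 2 * (Y 0 * q 0) + (\<Sum>i<k n. ((Y (p n (Suc i)))\<^sup>2 - (Y (p n i))\<^sup>2) / (2 * lam) +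
        \<beta> / (2 * lam) * (Y (p n i) * I n i + Y (p n (Suc i)) * I n i))"
      using step by simp
    also have "\<dots> = 1 / 2 * (Y 0 * q 0) + (\<Sum>i<k n. (Y (p n (Suc i)))\<^sup>2 - (Y (p n i))\<^sup>2) / (2 * lam) +
        \<beta> / (2 * lam) * ((\<Sum>i<k n. Y (p n i) * I n i) + (\<Sum>i<k n. Y (p n (Suc i)) * I n i))"
      by (simp only: sum.distrib sum_distrib_left[symmetric] sum_divide_distrib[symmetric] add.assoc)
    also have "(\<Sum>i<k n. (Y (p n (Suc i)))\<^sup>2 - (Y (p n i))\<^sup>2) = (Y T)\<^sup>2 - (Y 0)\<^sup>2"
      using sum_lessThan_telescope[of "\<lambda>i. (Y (p n i))\<^sup>2" "k n"] p by simp
    finally show ?thesis using lam by (simp add: q0 field_simps power2_eq_square)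
  qed
  then show ?thesis using lim lam by (simp add: path_cost_def power2_eq_square)
qed

lemma path_cost_lower_bound:
  assumes Y: "solves_impact T \<beta> lam 0 q Y" and pos: "0 \<le> T" "0 < \<beta>" "0 < lam"
  shows "lam * (q T)\<^sup>2 / (\<beta> * T + 2) \<le> path_cost T \<beta> lam Y"
proof -
  \<comment> \<open>Impact \<open>c\<close> before \<open>T\<close> and \<open>2 * c\<close> at
    \<open>T\<close> satisfies the integrated equation at \<open>T\<close> exactly if
    \<open>\<beta> * c * T + 2 * c = lam * q T\<close>.\<close>
  define c where "c = lam * q T / (\<beta> * T + 2)"
  have den: "\<beta> * T + 2 > 0" using pos by (simp add: add_nonneg_pos)
  have Yc: "cadlag_on T Y" and YT: "Y T = - \<beta> * (LBINT r:{0..T}. Y r) + lam * q T"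
    using Y pos by (auto simp: solves_impact_def)
  have i1: "set_integrable lborel {0..T} Y" using Yc by (rule cadlag_on_integrable)
  have i2: "set_integrable lborel {0..T} (\<lambda>s. (Y s)\<^sup>2)"
    unfolding power2_eq_square using Yc by (intro cadlag_on_mult_integrable i1)
  have "(LBINT s:{0..T}. (Y s - c)\<^sup>2) = (LBINT s:{0..T}. (Y s)\<^sup>2 - 2 * c * Y s + c\<^sup>2)"
    by (simp add: power2_diff algebra_simps)
  also have "\<dots> = (LBINT s:{0..T}. (Y s)\<^sup>2) - 2 * c * (LBINT s:{0..T}. Y s) + c\<^sup>2 * T"
    using i1 i2 pos set_integrable_const_Icc[of 0 T "c\<^sup>2"]
    by (subst set_integral_add, (auto intro!: set_integral_diff)[2], subst set_integral_diff)
      (auto simp: set_lebesgue_integral_def)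
  finally have sq: "(LBINT s:{0..T}. (Y s - c)\<^sup>2) =
      (LBINT s:{0..T}. (Y s)\<^sup>2) - 2 * c * (LBINT s:{0..T}. Y s) + c\<^sup>2 * T" .
  have "0 \<le> (LBINT s:{0..T}. (Y s - c)\<^sup>2)"
    unfolding set_lebesgue_integral_def by (intro Bochner_Integration.integral_nonneg) auto
  then have "0 \<le> \<beta> / lam * (LBINT s:{0..T}. (Y s - c)\<^sup>2) + (Y T - 2 * c)\<^sup>2 / (2 * lam)"
    using pos by simp
  \<comment> \<open>The doubling at \<open>T\<close> balances the weights
    \<open>\<beta> / lam\<close> and \<open>1 / (2 * lam)\<close>: the linear terms combine to
    \<open>\<beta> * (LBINT s:{0..T}. Y s) + Y T\<close>, which equals
    \<open>lam * q T\<close>.\<close>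
  also have "\<dots> = path_cost T \<beta> lam Y - 2 * c / lam * (\<beta> * (LBINT s:{0..T}. Y s) + Y T)
      + c\<^sup>2 * (\<beta> * T + 2) / lam"
    unfolding sq path_cost_def using pos by (simp add: field_simps power2_eq_square)
  also have "\<dots> = path_cost T \<beta> lam Y - lam * (q T)\<^sup>2 / (\<beta> * T + 2)"
  proof -
    have "c * (\<beta> * T + 2) = lam * q T" using den by (simp add: c_def)
    then have "c\<^sup>2 * (\<beta> * T + 2) / lam = c * q T"
      using pos by (simp add: power2_eq_square mult.assoc)
    moreover have "2 * c / lam * (\<beta> * (LBINT s:{0..T}. Y s) + Y T) = 2 * c * q T"
      unfolding YT using pos by simp
    moreover have "c * q T = lam * (q T)\<^sup>2 / (\<beta> * T + 2)" by (simp add: c_def power2_eq_square)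
    ultimately show ?thesis by simp
  qed
  finally show ?thesis by simp
qed

text \<open>\<open>Y\<close> is the primitive of \<open>g = lam * u - \<beta> * Y\<close>, which is
  integrated by parts against \<open>w\<close>. The equation for \<open>w\<close> cancels the
  integrals of \<open>Y * w\<close> and leaves those of \<open>Y * Z\<close>; the condition
  \<open>w T = Z T / 2\<close> turns the boundary term into the terminal part of the cost.\<close>

lemma euler_lagrange_identity:
  assumes T: "0 \<le> T" and u: "set_integrable lborel {0..T} u"
    and Y: "solves_impact T \<beta> lam 0 (\<lambda>t. LBINT s:{0..t}. u s) Y" and lam: "lam \<noteq> 0"
    and w: "\<And>x. (w has_real_derivative \<beta> * (w x - Z x)) (at x)"
    and Z: "continuous_on {0..T} Z" and wT: "w T = Z T / 2"
  shows "Y T * Z T / (2 * lam) + \<beta> / lam * (LBINT s:{0..T}. Y s * Z s) = (LBINT s:{0..T}. u s * w s)"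
proof -
  have Yc: "cadlag_on T Y"
    and Yeq: "\<And>t. t \<in> {0..T} \<Longrightarrow> Y t = - \<beta> * (LBINT s:{0..t}. Y s) + lam * (LBINT s:{0..t}. u s)"
    using Y by (auto simp: solves_impact_def)
  have Yi: "set_integrable lborel {0..T} Y" using Yc by (rule cadlag_on_integrable)
  have wc: "continuous_on {0..T} w"
    using w by (intro DERIV_continuous_on[of _ w]) (auto intro: has_field_derivative_at_within)
  define g where "g s = lam * u s - \<beta> * Y s" for s
  have gi: "set_integrable lborel {0..T} g"
    unfolding g_def using u Yi by (intro set_integral_diff) auto
  have Yg: "(LBINT s:{0..t}. g s) = Y t" if "t \<in> {0..T}" for t
    using that set_integrable_Icc_subset[OF u, of t] set_integrable_Icc_subset[OF Yi, of t] Yeq[OF that]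
    unfolding g_def by (subst set_integral_diff) auto
  have i: "set_integrable lborel {0..T} (\<lambda>s. u s * w s)" "set_integrable lborel {0..T} (\<lambda>s. Y s * w s)"
    "set_integrable lborel {0..T} (\<lambda>s. Y s * Z s)"
    by (intro continuous_on_mult_integrable u Yi wc Z)+
  have "(LBINT s:{0..T}. (LBINT r:{0..s}. g r) * (\<beta> * (w s - Z s))) =
      w T * (LBINT s:{0..T}. g s) - (LBINT s:{0..T}. g s * w s)"
    using T gi w by (intro indefinite_integral_by_parts continuous_intros wc Z)
  moreover have "(LBINT s:{0..T}. (LBINT r:{0..s}. g r) * (\<beta> * (w s - Z s))) =
      (LBINT s:{0..T}. \<beta> * (Y s * w s) - \<beta> * (Y s * Z s))"
    using Yg by (intro set_lebesgue_integral_cong) (auto simp: algebra_simps)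
  moreover have "\<dots> = \<beta> * (LBINT s:{0..T}. Y s * w s) - \<beta> * (LBINT s:{0..T}. Y s * Z s)"
    using i by (subst set_integral_diff) auto
  moreover have "(LBINT s:{0..T}. g s * w s) = (LBINT s:{0..T}. lam * (u s * w s) - \<beta> * (Y s * w s))"
    by (simp add: g_def algebra_simps)
  moreover have "\<dots> = lam * (LBINT s:{0..T}. u s * w s) - \<beta> * (LBINT s:{0..T}. Y s * w s)"
    using i by (subst set_integral_diff) auto
  ultimately have "lam * (LBINT s:{0..T}. u s * w s) = Y T * Z T / 2 + \<beta> * (LBINT s:{0..T}. Y s * Z s)"
    using Yg[of T] T wT by (simp add: algebra_simps)
  then show ?thesis using lam by (simp add: field_simps)
qed

section \<open>Costs of random strategies\<close>

text \<open>The densities given by the positive and negative parts of \<open>f - g\<close> define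
  measures that agree and are finite on all rays \<open>{x<..}\<close>, hence coincide; uniqueness
  of densities makes the two parts equal almost everywhere. This identifies a rate picked by choice
  with an explicit one.\<close>

lemma indefinite_integral_eq_imp_AE_eq:
  fixes f g :: "real \<Rightarrow> real"
  assumes f: "set_integrable lborel {0..T} f" and g: "set_integrable lborel {0..T} g"
    and eq: "\<And>t. t \<in> {0..T} \<Longrightarrow> (LBINT s:{0..t}. f s) = (LBINT s:{0..t}. g s)"
  shows "AE s in lborel. s \<in> {0..T} \<longrightarrow> f s = g s"
proof (cases "0 \<le> T")
  case T: True
  define H where "H s = indicator {0..T} s * (f s - g s)" for s
  have H: "integrable lborel H"
    using set_integral_diff(1)[OF f g] by (simp add: H_def[abs_def] set_integrable_def)
  then have [measurable]: "H \<in> borel_measurable borel" by auto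
  have int: "integrable lborel (\<lambda>s. H s * indicator A s)" if "A \<in> sets borel" for A
    using integrable_mult_indicator[OF _ H, of A] that by (simp add: mult.commute)
  have H0: "(LBINT s. H s * indicator {..x} s) = 0" for x
  proof (cases "0 \<le> x")
    case True
    have "(LBINT s. H s * indicator {..x} s) = (LBINT s:{0..min x T}. f s - g s)"
      unfolding set_lebesgue_integral_def
      by (intro Bochner_Integration.integral_cong) (auto simp: H_def indicator_def)
    also have "\<dots> = 0"
      using eq[of "min x T"] True T set_integrable_Icc_subset[OF f, of "min x T"]
        set_integrable_Icc_subset[OF g, of "min x T"]
      by (subst set_integral_diff) auto
    finally show ?thesis .
  next
    case False
    then have "(\<lambda>s. H s * indicator {..x} s) = (\<lambda>_. 0)" by (auto simp: H_def indicator_def fun_eq_iff)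
    then show ?thesis by (simp only: Bochner_Integration.integral_zero)
  qed
  have HT: "(LBINT s. H s) = 0"
  proof -
    have "(\<lambda>s. H s * indicator {..T} s) = H" by (auto simp: H_def indicator_def fun_eq_iff)
    then show ?thesis using H0[of T] by (simp only:)
  qed
  have tail: "(LBINT s. max 0 (H s) * indicator {x<..} s) = (LBINT s. max 0 (- H s) * indicator {x<..} s)" for x
  proof -
    have i: "integrable lborel (\<lambda>s. max 0 (H s) * indicator {x<..} s)"
      "integrable lborel (\<lambda>s. max 0 (- H s) * indicator {x<..} s)"
      by (rule Bochner_Integration.integrable_bound[OF H]; auto simp: indicator_def)+
    have "(LBINT s. max 0 (H s) * indicator {x<..} s) - (LBINT s. max 0 (- H s) * indicator {x<..} s) =
        (LBINT s. max 0 (H s) * indicator {x<..} s - max 0 (- H s) * indicator {x<..} s)"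
      using i by simp
    also have "\<dots> = (LBINT s. H s - H s * indicator {..x} s)"
      by (intro Bochner_Integration.integral_cong) (auto simp: indicator_def)
    also have "\<dots> = 0"
      using H int[of "{..x}"] H0 HT by simp
    finally show ?thesis by simp
  qed
  have em: "emeasure (density lborel (\<lambda>s. ennreal (max 0 (h s)))) {x<..} =
      ennreal (LBINT s. max 0 (h s) * indicator {x<..} s)"
    if h: "integrable lborel h" for h :: "real \<Rightarrow> real" and x
  proof -
    have [measurable]: "h \<in> borel_measurable borel" using h by auto
    have "emeasure (density lborel (\<lambda>s. ennreal (max 0 (h s)))) {x<..} =
        (\<integral>\<^sup>+s. ennreal (max 0 (h s) * indicator {x<..} s) \<partial>lborel)"
      by (subst emeasure_density) (auto intro!: nn_integral_cong simp: indicator_def)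
    also have "\<dots> = ennreal (LBINT s. max 0 (h s) * indicator {x<..} s)"
      by (intro nn_integral_eq_integral Bochner_Integration.integrable_bound[OF h])
        (auto simp: indicator_def)
    finally show ?thesis .
  qed
  have "density lborel (\<lambda>s. ennreal (max 0 (H s))) = density lborel (\<lambda>s. ennreal (max 0 (- H s)))"
  proof (rule measure_eqI_lessThan)
    have H': "integrable lborel (\<lambda>s. - H s)" using H by simp
    show "emeasure (density lborel (\<lambda>s. ennreal (max 0 (H s)))) {x<..} < \<infinity>" for x
      unfolding em[OF H] by simp
    show "emeasure (density lborel (\<lambda>s. ennreal (max 0 (H s)))) {x<..} =
        emeasure (density lborel (\<lambda>s. ennreal (max 0 (- H s)))) {x<..}" for x
      unfolding em[OF H] em[OF H'] tail ..
  qed simp_all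
  then have "AE s in lborel. ennreal (max 0 (H s)) = ennreal (max 0 (- H s))"
    by (intro sigma_finite_measure.density_unique[OF sigma_finite_lborel]) auto
  then show ?thesis
  proof eventually_elim
    case (elim s)
    then have "H s = 0" by (auto simp: max_def split: if_splits)
    then show ?case by (auto simp: H_def)
  qed
qed auto

lemma finite_variation_on_Lipschitz:
  assumes "\<And>x y. 0 \<le> x \<Longrightarrow> x \<le> y \<Longrightarrow> y \<le> T \<Longrightarrow> \<bar>f y - f x\<bar> \<le> L * (y - x)" "0 \<le> L"
  shows "finite_variation_on T f"
  unfolding finite_variation_on_def
proof (intro exI[of _ "L * T"] allI impI)
  fix n :: nat and p :: "nat \<Rightarrow> real"
  assume p: "0 \<le> p 0 \<and> p n \<le> T \<and> (\<forall>i<n. p i \<le> p (Suc i))"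
  have up: "p i \<le> p n" if "i \<le> n" for i
    using that by (induction rule: inc_induct) (use p in \<open>auto intro: order_trans\<close>)
  have lo: "0 \<le> p i" if "i \<le> n" for i
    using that p by (induction i) (auto intro: order_trans)
  have "(\<Sum>i<n. \<bar>f (p (Suc i)) - f (p i)\<bar>) \<le> (\<Sum>i<n. L * (p (Suc i) - p i))"
  proof (intro sum_mono assms(1))
    fix i assume "i \<in> {..<n}"
    then show "0 \<le> p i" "p i \<le> p (Suc i)" "p (Suc i) \<le> T"
      using p lo[of i] up[of "Suc i"] by auto
  qed
  also have "\<dots> = L * (p n - p 0)"
    using sum_lessThan_telescope[of p n] by (simp add: sum_distrib_left[symmetric])
  also have "\<dots> \<le> L * T" using p assms(2) by (intro mult_left_mono) auto
  finally show "(\<Sum>i<n. \<bar>f (p (Suc i)) - f (p i)\<bar>) \<le> L * T" .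
qed

lemma abs_set_integral_Icc_le:
  fixes h :: "real \<Rightarrow> real"
  assumes "set_integrable lborel {a..b} h" "a \<le> b" "\<And>s. s \<in> {a..b} \<Longrightarrow> \<bar>h s\<bar> \<le> B"
  shows "\<bar>LBINT s:{a..b}. h s\<bar> \<le> B * (b - a)"
proof -
  have "\<bar>LBINT s:{a..b}. h s\<bar> \<le> (LBINT s:{a..b}. \<bar>h s\<bar>)"
    using set_integral_norm_bound[OF assms(1)] by simp
  also have "\<dots> \<le> (LBINT s:{a..b}. B)"
    using assms set_integrable_abs[OF assms(1)] set_integrable_const_Icc by (intro set_integral_mono) auto
  also have "\<dots> = B * (b - a)" using assms(2) by (simp add: set_lebesgue_integral_def)
  finally show ?thesis .
qed

lemma solves_impact_cong:
  assumes "solves_impact T \<beta> lam y q f" "\<And>t. t \<in> {0..T} \<Longrightarrow> q t = q' t"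
  shows "solves_impact T \<beta> lam y q' f"
  using assms unfolding solves_impact_def by simp

lemma impact_solves:
  assumes "cadlag_on T (\<lambda>s. Q s \<omega>)"
  shows "solves_impact T \<beta> lam 0 (\<lambda>s. Q s \<omega>) (\<lambda>t. impact T \<beta> lam 0 Q t \<omega>)"
  unfolding impact_def using impact_path_solves[OF assms]
  by (rule someI[where P = "solves_impact T \<beta> lam 0 (\<lambda>s. Q s \<omega>)"])

lemma impact_eq_impact_path:
  assumes "cadlag_on T (\<lambda>s. Q s \<omega>)" "t \<in> {0..T}"
  shows "impact T \<beta> lam 0 Q t \<omega> = impact_path \<beta> lam (\<lambda>s. Q s \<omega>) t"
  using solves_impact_unique[OF impact_solves[of T Q \<omega>, OF assms(1)] assms] .

lemma path_cost_cong:
  assumes "0 \<le> T" "\<And>t. t \<in> {0..T} \<Longrightarrow> Y t = Z t"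
  shows "path_cost T \<beta> lam Y = path_cost T \<beta> lam Z"
  using assms by (auto simp: path_cost_def intro!: set_lebesgue_integral_cong)

lemma path_cost_nonneg: "0 < lam \<Longrightarrow> 0 \<le> \<beta> \<Longrightarrow> 0 \<le> path_cost T \<beta> lam Y"
  unfolding path_cost_def set_lebesgue_integral_def
  by (intro add_nonneg_nonneg mult_nonneg_nonneg Bochner_Integration.integral_nonneg) auto

text \<open>\<open>K\<close> is uniform over all paths, so the cost of a strategy is dominated by a
  multiple of the squared running maximum, which the strategy class makes integrable.\<close>

lemma path_cost_le:
  assumes T: "0 \<le> T" and pos: "0 < \<beta>" "0 < lam"
  shows "\<exists>K>0. \<forall>q S. cadlag_on T q \<longrightarrow> (\<forall>t\<in>{0..T}. \<bar>q t\<bar> \<le> S) \<longrightarrow>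
    path_cost T \<beta> lam (impact_path \<beta> lam q) \<le> K * S\<^sup>2"
proof -
  \<comment> \<open>\<open>C * S\<close> bounds the impact in \<open>impact_path\<close>, using
    \<open>exp (\<beta> * s) \<le> exp (\<beta> * T)\<close> under the integral and
    \<open>exp (- \<beta> * t) \<le> 1\<close> in front of it.\<close>
  define C where "C = lam * (1 + \<beta> * (exp (\<beta> * T) * T))"
  have C: "C > 0" unfolding C_def using pos T by (intro mult_pos_pos add_pos_nonneg) auto
  define K where "K = C\<^sup>2 / (2 * lam) + \<beta> / lam * (C\<^sup>2 * T)"
  have "K > 0" unfolding K_def using C pos T by (intro add_pos_nonneg) auto
  moreover have "path_cost T \<beta> lam (impact_path \<beta> lam q) \<le> K * S\<^sup>2"
    if q: "cadlag_on T q" and S: "\<And>t. t \<in> {0..T} \<Longrightarrow> \<bar>q t\<bar> \<le> S" for q S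
  proof -
    have S0: "0 \<le> S" using S[of 0] T by auto
    have Y: "\<bar>impact_path \<beta> lam q t\<bar> \<le> C * S" if t: "t \<in> {0..T}" for t
    proof -
      have "\<bar>LBINT s:{0..t}. q s * exp (\<beta> * s)\<bar> \<le> S * exp (\<beta> * T) * (t - 0)"
      proof (rule abs_set_integral_Icc_le)
        show "set_integrable lborel {0..t} (\<lambda>s. q s * exp (\<beta> * s))"
          using t cadlag_on_subset[OF q]
          by (intro continuous_on_mult_integrable cadlag_on_integrable continuous_intros) auto
        fix s assume "s \<in> {0..t}"
        then show "\<bar>q s * exp (\<beta> * s)\<bar> \<le> S * exp (\<beta> * T)"
          using S[of s] t pos S0 by (auto simp: abs_mult intro!: mult_mono)
      qed (use t in auto)
      also have "\<dots> \<le> S * exp (\<beta> * T) * T" using t S0 by (intro mult_left_mono) auto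
      finally have i: "\<bar>LBINT s:{0..t}. q s * exp (\<beta> * s)\<bar> \<le> S * exp (\<beta> * T) * T" .
      have e: "exp (- \<beta> * t) \<le> 1" using pos t by simp
      have "\<bar>q t - \<beta> * exp (- \<beta> * t) * (LBINT s:{0..t}. q s * exp (\<beta> * s))\<bar> \<le>
          \<bar>q t\<bar> + \<beta> * exp (- \<beta> * t) * \<bar>LBINT s:{0..t}. q s * exp (\<beta> * s)\<bar>"
        using pos abs_triangle_ineq4[of "q t" "\<beta> * exp (- \<beta> * t) * (LBINT s:{0..t}. q s * exp (\<beta> * s))"]
        by (simp add: abs_mult)
      also have "\<dots> \<le> S + \<beta> * 1 * (S * exp (\<beta> * T) * T)"
        using S[OF t] e i pos S0 by (intro add_mono mult_mono) auto
      finally have "\<bar>q t - \<beta> * exp (- \<beta> * t) * (LBINT s:{0..t}. q s * exp (\<beta> * s))\<bar> \<le>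
          S + \<beta> * 1 * (S * exp (\<beta> * T) * T)" .
      then have "lam * \<bar>q t - \<beta> * exp (- \<beta> * t) * (LBINT s:{0..t}. q s * exp (\<beta> * s))\<bar> \<le>
          lam * (S + \<beta> * 1 * (S * exp (\<beta> * T) * T))" using pos by (intro mult_left_mono) auto
      also have "\<dots> = C * S" by (simp add: C_def algebra_simps)
      finally show ?thesis using pos by (simp add: impact_path_def abs_mult)
    qed
    have Yc: "cadlag_on T (impact_path \<beta> lam q)"
      using impact_path_solves[OF q] by (simp add: solves_impact_def)
    have sq: "\<bar>(impact_path \<beta> lam q t)\<^sup>2\<bar> \<le> C\<^sup>2 * S\<^sup>2" if "t \<in> {0..T}" for t
      using power_mono[OF Y[OF that], of 2] by (simp add: power_mult_distrib)
    have "\<bar>LBINT s:{0..T}. (impact_path \<beta> lam q s)\<^sup>2\<bar> \<le> C\<^sup>2 * S\<^sup>2 * (T - 0)"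
      using T sq cadlag_on_mult_integrable[OF Yc cadlag_on_integrable[OF Yc]]
      by (intro abs_set_integral_Icc_le) (auto simp: power2_eq_square)
    then have "(impact_path \<beta> lam q T)\<^sup>2 / (2 * lam) + \<beta> / lam * (LBINT s:{0..T}. (impact_path \<beta> lam q s)\<^sup>2)
      \<le> C\<^sup>2 * S\<^sup>2 / (2 * lam) + \<beta> / lam * (C\<^sup>2 * S\<^sup>2 * T)"
      using sq[of T] T pos by (intro add_mono divide_right_mono mult_left_mono) auto
    then show ?thesis by (simp add: path_cost_def K_def algebra_simps)
  qed
  ultimately show ?thesis by blast
qed

text \<open>The indicators of the deviation events tend to zero pointwise and are bounded by one, so
  dominated convergence applies to their expectations. Measurability of \<open>Z\<close> is
  inherited from the sequence.\<close>

lemma (in prob_space) conv_in_prob_pointwise: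
  assumes [measurable]: "\<And>n. S n \<in> borel_measurable M"
    and lim: "\<And>\<omega>. \<omega> \<in> space M \<Longrightarrow> (\<lambda>n. S n \<omega>) \<longlonglongrightarrow> Z \<omega>"
  shows "conv_in_prob M S Z"
proof -
  have [measurable]: "Z \<in> borel_measurable M"
    using lim assms(1) by (rule borel_measurable_LIMSEQ_real)
  have "(\<lambda>n. prob {\<omega>\<in>space M. e < \<bar>S n \<omega> - Z \<omega>\<bar>}) \<longlonglongrightarrow> 0" if e: "e > 0" for e
  proof -
    define A where "A n = {\<omega>\<in>space M. e < \<bar>S n \<omega> - Z \<omega>\<bar>}" for n
    have [measurable]: "A n \<in> sets M" for n unfolding A_def by measurable
    have "(\<lambda>n. \<integral>\<omega>. indicator (A n) \<omega> \<partial>M) \<longlonglongrightarrow> (\<integral>\<omega>. (0::real) \<partial>M)"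
    proof (rule integral_dominated_convergence[where w = "\<lambda>_. 1"])
      show "AE \<omega> in M. (\<lambda>n. indicator (A n) \<omega> :: real) \<longlonglongrightarrow> 0"
      proof (rule AE_I2)
        fix \<omega> assume "\<omega> \<in> space M"
        have "\<forall>\<^sub>F n in sequentially. \<bar>S n \<omega> - Z \<omega>\<bar> < e"
          using tendstoD[OF lim[OF \<open>\<omega> \<in> space M\<close>] e] by (simp add: dist_real_def)
        then have "\<forall>\<^sub>F n in sequentially. indicator (A n) \<omega> = (0::real)"
          by eventually_elim (auto simp: A_def)
        then show "(\<lambda>n. indicator (A n) \<omega> :: real) \<longlonglongrightarrow> 0"
          by (rule tendsto_eventually)
      qed
    qed (auto simp: indicator_def)
    then show ?thesis by (simp add: A_def)
  qed
  then show ?thesis by (simp add: conv_in_prob_def)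
qed

section \<open>Measurability, integrability and the expected execution cost\<close>

context usual_filtered_prob_space
begin

lemma adapted_cadlag_measurable:
  assumes "adapted_cadlag M F T Q" "t \<in> {0..T}"
  shows "Q t \<in> borel_measurable M"
  using assms by (auto simp: adapted_cadlag_def intro: measurable_from_subalg[OF subalg])

text \<open>The time integral in the explicit solution is, path by path, a limit of Riemann sums in
  finitely many values of \<open>Q\<close>, each of which is a random variable.\<close>

lemma impact_measurable:
  assumes Q: "adapted_cadlag M F T Q" and t: "t \<in> {0..T}"
  shows "(\<lambda>\<omega>. impact T \<beta> lam 0 Q t \<omega>) \<in> borel_measurable M"
proof -
  have path: "cadlag_on T (\<lambda>s. Q s \<omega>)" if "\<omega> \<in> space M" for \<omega>
    using Q that by (simp add: adapted_cadlag_def)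
  have "(\<lambda>\<omega>. LBINT s:{0..t}. Q s \<omega> * exp (\<beta> * s)) \<in> borel_measurable M"
  proof (cases "t = 0")
    case False
    then obtain k p where kp: "partition_seq t k p"
      using exists_partition_seq[of t] t by auto
    show ?thesis
    proof (rule borel_measurable_LIMSEQ_real)
      fix \<omega> assume "\<omega> \<in> space M"
      then have "cadlag_on t (\<lambda>s. Q s \<omega>)" using path t cadlag_on_subset by auto
      then show "(\<lambda>n. \<Sum>i<k n. Q (p n i) \<omega> * (LBINT s:{p n i..p n (Suc i)}. exp (\<beta> * s)))
          \<longlonglongrightarrow> (LBINT s:{0..t}. Q s \<omega> * exp (\<beta> * s))"
        using kp by (intro cadlag_on_Riemann_sums[OF _ _ kp] borel_integrable_atLeastAtMost' continuous_intros)
          (auto simp: partition_seq_def)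
    next
      fix n
      have "Q (p n i) \<in> borel_measurable M" if "i < k n" for i
        using partition_seq_bounds[OF kp, of i n] that t
        by (intro adapted_cadlag_measurable[OF Q]) auto
      then show "(\<lambda>\<omega>. \<Sum>i<k n. Q (p n i) \<omega> * (LBINT s:{p n i..p n (Suc i)}. exp (\<beta> * s)))
          \<in> borel_measurable M" by measurable
    qed
  qed simp
  then have "(\<lambda>\<omega>. impact_path \<beta> lam (\<lambda>s. Q s \<omega>) t) \<in> borel_measurable M"
    unfolding impact_path_def using adapted_cadlag_measurable[OF Q t] by measurable
  then show ?thesis
    by (rule measurable_cong[THEN iffD1, rotated])
      (simp add: impact_eq_impact_path[where Q = Q, OF path t])
qed

lemma path_cost_is_execution_cost:
  assumes Q: "adapted_cadlag M F T Q" and lam: "lam \<noteq> 0"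
  shows "is_execution_cost M T \<beta> lam 0 Q (\<lambda>\<omega>. path_cost T \<beta> lam (\<lambda>t. impact T \<beta> lam 0 Q t \<omega>))"
  unfolding is_execution_cost_def
proof (intro allI impI conv_in_prob_pointwise)
  fix k p n assume kp: "partition_seq T k p"
  have [measurable]: "Q (p n i) \<in> borel_measurable M" "(\<lambda>\<omega>. impact T \<beta> lam 0 Q (p n i) \<omega>) \<in> borel_measurable M"
    if "i \<le> k n" for i
    using partition_seq_bounds[OF kp, of i n] that
    by (auto intro: adapted_cadlag_measurable[OF Q] impact_measurable[OF Q])
  have [measurable]: "Q 0 \<in> borel_measurable M" "(\<lambda>\<omega>. impact T \<beta> lam 0 Q 0 \<omega>) \<in> borel_measurable M"
    using T_pos by (auto intro: adapted_cadlag_measurable[OF Q] impact_measurable[OF Q])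
  show "(\<lambda>\<omega>. integral_sum 0 (\<lambda>t. impact T \<beta> lam 0 Q t \<omega>) 0 (\<lambda>t. Q t \<omega>) (k n) (p n) +
      1 / 2 * covariation_sum 0 (\<lambda>t. impact T \<beta> lam 0 Q t \<omega>) 0 (\<lambda>t. Q t \<omega>) (k n) (p n)) \<in> borel_measurable M"
    unfolding integral_sum_def covariation_sum_def by measurable
next
  fix k p \<omega> assume kp: "partition_seq T k p" and "\<omega> \<in> space M"
  then have "cadlag_on T (\<lambda>s. Q s \<omega>)" using Q by (simp add: adapted_cadlag_def)
  then show "(\<lambda>n. integral_sum 0 (\<lambda>t. impact T \<beta> lam 0 Q t \<omega>) 0 (\<lambda>t. Q t \<omega>) (k n) (p n) +
      1 / 2 * covariation_sum 0 (\<lambda>t. impact T \<beta> lam 0 Q t \<omega>) 0 (\<lambda>t. Q t \<omega>) (k n) (p n))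
    \<longlonglongrightarrow> path_cost T \<beta> lam (\<lambda>t. impact T \<beta> lam 0 Q t \<omega>)"
    by (intro stratonovich_sums_tendsto[OF _ lam kp] impact_solves)
qed

lemma execution_cost_measurable:
  assumes "is_execution_cost M T \<beta> lam y Q Z"
  shows "Z \<in> borel_measurable M"
  using assms exists_partition_seq[OF T_pos] unfolding is_execution_cost_def conv_in_prob_def by blast

text \<open>The random variable selected in \<open>J0\<close> and the pathwise cost are limits in
  probability of the same sums along one partition sequence, hence almost surely equal.\<close>

lemma J0_eq_expectation:
  assumes Q: "adapted_cadlag M F T Q" and lam: "lam \<noteq> 0"
  shows "J0 M T \<beta> lam 0 Q = (\<integral>\<omega>. path_cost T \<beta> lam (\<lambda>t. impact T \<beta> lam 0 Q t \<omega>) \<partial>M)"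
proof -
  note Z = path_cost_is_execution_cost[OF assms, of \<beta>]
  then have W: "is_execution_cost M T \<beta> lam 0 Q (SOME Z. is_execution_cost M T \<beta> lam 0 Q Z)"
    by (rule someI[where P = "is_execution_cost M T \<beta> lam 0 Q"])
  obtain k p where kp: "partition_seq T k p"
    using exists_partition_seq[OF T_pos] by blast
  have "AE \<omega> in M. (SOME Z. is_execution_cost M T \<beta> lam 0 Q Z) \<omega> =
      path_cost T \<beta> lam (\<lambda>t. impact T \<beta> lam 0 Q t \<omega>)"
    using W Z kp unfolding is_execution_cost_def by (intro conv_in_prob_unique) blast+
  then show ?thesis
    unfolding J0_def using execution_cost_measurable[OF W] execution_cost_measurable[OF Z]
    by (intro integral_cong_AE) auto
qed

lemma strategiesD:
  assumes "Q \<in> strategies M F T \<Xi>"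
  shows "adapted_cadlag M F T Q" "AE \<omega> in M. Q T \<omega> = \<Xi>"
  using assms by (auto simp: strategies_def semimartingale_def)

text \<open>After division by \<open>K\<close> the cost lies below the supremum of
  \<open>\<bar>Q t \<omega>\<bar>\<^sup>2\<close>. A path with infinite supremum satisfies this
  trivially; otherwise the root of the supremum serves as the bound on the path.\<close>

lemma path_cost_integrable:
  assumes Q: "Q \<in> strategies M F T \<Xi>" and pos: "0 < \<beta>" "0 < lam"
  shows "integrable M (\<lambda>\<omega>. path_cost T \<beta> lam (\<lambda>t. impact T \<beta> lam 0 Q t \<omega>))"
proof -
  note ad = strategiesD(1)[OF Q]
  define Z where "Z \<omega> = path_cost T \<beta> lam (\<lambda>t. impact T \<beta> lam 0 Q t \<omega>)" for \<omega>
  have [measurable]: "Z \<in> borel_measurable M"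
    unfolding Z_def using execution_cost_measurable[OF path_cost_is_execution_cost[OF ad]] pos by simp
  obtain K where K: "K > 0" "\<And>q S. cadlag_on T q \<Longrightarrow> (\<forall>t\<in>{0..T}. \<bar>q t\<bar> \<le> S) \<Longrightarrow>
      path_cost T \<beta> lam (impact_path \<beta> lam q) \<le> K * S\<^sup>2"
    using path_cost_le[of T \<beta> lam] T_pos pos by auto
  have Z0: "0 \<le> Z \<omega>" for \<omega> unfolding Z_def using pos by (intro path_cost_nonneg) auto
  have "ennreal (Z \<omega> / K) \<le> (SUP t\<in>{0..T}. ennreal (\<bar>Q t \<omega>\<bar>\<^sup>2))" if \<omega>: "\<omega> \<in> space M" for \<omega>
  proof (cases "(SUP t\<in>{0..T}. ennreal (\<bar>Q t \<omega>\<bar>\<^sup>2))")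
    case (real r)
    have path: "cadlag_on T (\<lambda>s. Q s \<omega>)" using ad \<omega> by (simp add: adapted_cadlag_def)
    have "\<bar>Q t \<omega>\<bar> \<le> sqrt r" if "t \<in> {0..T}" for t
    proof -
      have "ennreal (\<bar>Q t \<omega>\<bar>\<^sup>2) \<le> ennreal r"
        unfolding real(2)[symmetric] using that by (rule SUP_upper)
      then have "\<bar>Q t \<omega>\<bar>\<^sup>2 \<le> r" using real(1) by (simp add: ennreal_le_iff)
      then show ?thesis by (rule real_le_rsqrt)
    qed
    then have "path_cost T \<beta> lam (impact_path \<beta> lam (\<lambda>s. Q s \<omega>)) \<le> K * (sqrt r)\<^sup>2"
      using K(2)[OF path] by blast
    moreover have "Z \<omega> = path_cost T \<beta> lam (impact_path \<beta> lam (\<lambda>s. Q s \<omega>))"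
      unfolding Z_def using T_pos by (intro path_cost_cong) (auto simp: impact_eq_impact_path[where Q = Q, OF path])
    ultimately have "Z \<omega> / K \<le> r" using K(1) real(1) by (simp add: field_simps)
    then show ?thesis unfolding real(2) using real(1) by (simp add: ennreal_leI)
  next
    case top
    show ?thesis unfolding top by simp
  qed
  then have "(\<integral>\<^sup>+\<omega>. ennreal (Z \<omega> / K) \<partial>M) \<le> (\<integral>\<^sup>+\<omega>. (SUP t\<in>{0..T}. ennreal (\<bar>Q t \<omega>\<bar>\<^sup>2)) \<partial>M)"
    by (rule nn_integral_mono)
  also have "\<dots> < \<infinity>" using Q by (simp add: strategies_def)
  finally have "integrable M (\<lambda>\<omega>. Z \<omega> / K)"
    using Z0 K(1) by (intro integrableI_nonneg) auto
  then have "integrable M (\<lambda>\<omega>. K * (Z \<omega> / K))" by (rule integrable_mult_right)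
  then show ?thesis using K(1) by (simp add: Z_def)
qed

lemma J0_lower_bound:
  assumes Q: "Q \<in> strategies M F T \<Xi>" and pos: "0 < \<beta>" "0 < lam"
  shows "lam * \<Xi>\<^sup>2 / (\<beta> * T + 2) \<le> J0 M T \<beta> lam 0 Q"
proof -
  have "AE \<omega> in M. lam * \<Xi>\<^sup>2 / (\<beta> * T + 2) \<le> path_cost T \<beta> lam (\<lambda>t. impact T \<beta> lam 0 Q t \<omega>)"
    using strategiesD(2)[OF Q] AE_space
  proof eventually_elim
    case (elim \<omega>)
    then have "cadlag_on T (\<lambda>s. Q s \<omega>)" using strategiesD(1)[OF Q] by (simp add: adapted_cadlag_def)
    then show ?case
      using path_cost_lower_bound[OF impact_solves, of T Q \<omega> \<beta> lam] elim T_pos pos by simp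
  qed
  then have "(\<integral>\<omega>. lam * \<Xi>\<^sup>2 / (\<beta> * T + 2) \<partial>M) \<le> (\<integral>\<omega>. path_cost T \<beta> lam (\<lambda>t. impact T \<beta> lam 0 Q t \<omega>) \<partial>M)"
    using path_cost_integrable[OF Q pos] by (intro integral_mono_AE) auto
  then show ?thesis
    using J0_eq_expectation[OF strategiesD(1)[OF Q], of lam \<beta>] pos by (simp add: prob_space)
qed

text \<open>Progressive measurability at the final time, after swapping coordinates and extending by
  zero, is joint measurability on the product with \<open>lborel\<close>. Tonelli makes the square
  integrable there, and Fubini gives the claims about its sections and their integrals.\<close>

lemma rate_square_integrable:
  assumes u: "is_rate M F T Q u"
  shows "AE \<omega> in M. set_integrable lborel {0..T} (\<lambda>s. (u s \<omega>)\<^sup>2)"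
    and "AE \<omega> in M. set_integrable lborel {0..T} (\<lambda>s. u s \<omega>)"
    and "integrable M (\<lambda>\<omega>. LBINT s:{0..T}. (u s \<omega>)\<^sup>2)"
proof -
  interpret pair_sigma_finite M lborel ..
  have sub: "subalgebra M (F T)" using subalg T_pos by simp
  define v where "v \<omega> s = indicator {0..T} s * u s \<omega>" for \<omega> s
  have "(\<lambda>(s, \<omega>). u s \<omega>) \<in> borel_measurable (restrict_space borel {0..T} \<Otimes>\<^sub>M F T)"
    using u T_pos by (auto simp: is_rate_def progressively_measurable_def)
  moreover have "(\<lambda>(\<omega>, s). (s, \<omega>)) \<in> restrict_space (M \<Otimes>\<^sub>M borel) (space M \<times> {0..T}) \<rightarrow>\<^sub>M
      restrict_space borel {0..T} \<Otimes>\<^sub>M F T"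
  proof -
    have id: "(\<lambda>\<omega>. \<omega>) \<in> M \<rightarrow>\<^sub>M F T"
      using sub by (auto simp: measurable_def subalgebra_def)
    have "fst \<in> restrict_space (M \<Otimes>\<^sub>M borel) (space M \<times> {0..T}) \<rightarrow>\<^sub>M F T"
      by (intro measurable_restrict_space1)
        (rule measurable_compose[OF measurable_fst id])
    moreover have "snd \<in> restrict_space (M \<Otimes>\<^sub>M borel) (space M \<times> {0..T}) \<rightarrow>\<^sub>M restrict_space borel {0..T}"
      by (intro measurable_restrict_space2 measurable_restrict_space1)
        (auto simp: space_restrict_space)
    ultimately have "(\<lambda>x. (snd x, fst x)) \<in> restrict_space (M \<Otimes>\<^sub>M borel) (space M \<times> {0..T}) \<rightarrow>\<^sub>M
        restrict_space borel {0..T} \<Otimes>\<^sub>M F T" by measurable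
    then show ?thesis by (simp add: case_prod_beta')
  qed
  ultimately have "(\<lambda>x. case (case x of (\<omega>, s) \<Rightarrow> (s, \<omega>)) of (s, \<omega>) \<Rightarrow> u s \<omega>) \<in>
      borel_measurable (restrict_space (M \<Otimes>\<^sub>M borel) (space M \<times> {0..T}))"
    by (rule measurable_compose[rotated])
  then have "(\<lambda>x. indicator (space M \<times> {0..T}) x *\<^sub>R u (snd x) (fst x)) \<in> borel_measurable (M \<Otimes>\<^sub>M borel)"
    by (subst (asm) borel_measurable_restrict_space_iff) (auto simp: case_prod_beta')
  then have "case_prod v \<in> borel_measurable (M \<Otimes>\<^sub>M borel)"
    by (rule measurable_cong[THEN iffD1, rotated]) (auto simp: v_def space_pair_measure indicator_def)
  then have [measurable]: "case_prod v \<in> borel_measurable (M \<Otimes>\<^sub>M lborel)"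
    by (simp add: measurable_lborel1 cong: measurable_cong_sets sets_pair_measure_cong)
  have "(\<integral>\<^sup>+x. ennreal (norm ((case_prod v x)\<^sup>2)) \<partial>(M \<Otimes>\<^sub>M lborel)) =
      (\<integral>\<^sup>+\<omega>. (\<integral>\<^sup>+s. ennreal ((v \<omega> s)\<^sup>2) \<partial>lborel) \<partial>M)"
    by (subst lborel.nn_integral_fst[symmetric]) auto
  also have "\<dots> = (\<integral>\<^sup>+\<omega>. (\<integral>\<^sup>+s\<in>{0..T}. ennreal ((u s \<omega>)\<^sup>2) \<partial>lborel) \<partial>M)"
    by (intro nn_integral_cong) (auto simp: v_def indicator_def)
  also have "\<dots> < \<infinity>" using u by (simp add: is_rate_def)
  finally have int: "integrable (M \<Otimes>\<^sub>M lborel) (\<lambda>x. (case_prod v x)\<^sup>2)"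
    by (intro integrableI_bounded) auto
  have v2: "(v \<omega> s)\<^sup>2 = indicator {0..T} s *\<^sub>R (u s \<omega>)\<^sup>2" for \<omega> s
    by (auto simp: v_def indicator_def)
  show sq: "AE \<omega> in M. set_integrable lborel {0..T} (\<lambda>s. (u s \<omega>)\<^sup>2)"
    using AE_integrable_fst'[OF int] by (simp add: v2 set_integrable_def)
  show "integrable M (\<lambda>\<omega>. LBINT s:{0..T}. (u s \<omega>)\<^sup>2)"
    using integrable_fst'[OF int] by (simp add: v2 set_lebesgue_integral_def)
  show "AE \<omega> in M. set_integrable lborel {0..T} (\<lambda>s. u s \<omega>)"
    using sq AE_space
  proof eventually_elim
    case (elim \<omega>)
    have [measurable]: "v \<omega> \<in> borel_measurable borel"
      using measurable_Pair2[OF \<open>case_prod v \<in> borel_measurable (M \<Otimes>\<^sub>M borel)\<close> elim(2)] by simp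
    have "integrable lborel (v \<omega>)"
    proof (rule Bochner_Integration.integrable_bound)
      show "integrable lborel (\<lambda>s. indicator {0..T} s *\<^sub>R (u s \<omega>)\<^sup>2 + indicator {0..T} s *\<^sub>R 1)"
        using elim(1) set_integrable_const_Icc[of 0 T 1] unfolding set_integrable_def
        by (rule Bochner_Integration.integrable_add)
      \<comment> \<open>On a bounded interval the constant one is integrable, so square
        integrability of the rate implies integrability.\<close>
      have "\<bar>x\<bar> \<le> x\<^sup>2 + 1" for x :: real
        using zero_le_power2[of "\<bar>x\<bar> - 1"] by (simp add: power2_diff)
      then show "AE s in lborel. norm (v \<omega> s) \<le>
          norm (indicator {0..T} s *\<^sub>R (u s \<omega>)\<^sup>2 + indicator {0..T} s *\<^sub>R (1::real))"
        by (auto simp: v_def indicator_def)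
    qed simp
    then show ?case by (simp add: set_integrable_def v_def[abs_def])
  qed
qed

lemma is_rate_rate:
  assumes "Q \<in> ac_strategies M F T \<Xi>"
  shows "is_rate M F T Q (rate M F T Q)"
  using assms unfolding ac_strategies_def rate_def by (auto intro: someI_ex[of "is_rate M F T Q"])

end

section \<open>Stationary pairs and the regularised problem\<close>

text \<open>Eliminating \<open>Z\<close> from the adjoint and state equations gives
  \<open>w'' = \<kappa>\<^sup>2 * w - \<beta> * lam / \<epsilon>\<close>, so \<open>kappa\<close> is
  the exponential rate of the layers at the two ends.\<close>

definition kappa :: "real \<Rightarrow> real \<Rightarrow> real \<Rightarrow> real" where
  "kappa \<beta> lam \<epsilon> = sqrt (\<beta>\<^sup>2 + \<beta> * lam / \<epsilon>)"

text \<open>The quotient of \<open>cosh\<close> and \<open>sinh\<close> is a hyperbolic cotangent.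
  As \<open>\<epsilon>\<close> tends to zero, \<open>lam / (lam + \<beta> * \<epsilon>)\<close>
  tends to one and \<open>\<beta> / kappa\<close> to zero, so the limit is
  \<open>(\<beta> * T + 2) / lam\<close>: the integral of the impact and its terminal doubling
  account for the two summands.\<close>

definition unit_position :: "real \<Rightarrow> real \<Rightarrow> real \<Rightarrow> real \<Rightarrow> real" where
  "unit_position T \<beta> lam \<epsilon> =
     (\<beta> * T + 2 * (lam / (lam + \<beta> * \<epsilon>)) /
       (1 + \<beta> / kappa \<beta> lam \<epsilon> * (cosh (kappa \<beta> lam \<epsilon> * T / 2) / sinh (kappa \<beta> lam \<epsilon> * T / 2)))) /
     (lam + \<beta> * \<epsilon>)"

text \<open>\<open>w\<close> is \<open>lam\<close> times the adjoint state of \<open>Z\<close>, and \<open>(1 - w) / \<epsilon>\<close> the stationary rate when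
  the terminal constraint has multiplier 1; this rate reaches the position \<open>unit_position\<close> at \<open>T\<close>.\<close>

definition stationary_pair ::
  "real \<Rightarrow> real \<Rightarrow> real \<Rightarrow> real \<Rightarrow> (real \<Rightarrow> real) \<Rightarrow> (real \<Rightarrow> real) \<Rightarrow> bool" where
  "stationary_pair T \<beta> lam \<epsilon> w Z \<longleftrightarrow>
     (\<forall>x. (w has_real_derivative \<beta> * (w x - Z x)) (at x)) \<and> continuous_on UNIV Z \<and>
     w T = Z T / 2 \<and> solves_impact T \<beta> lam 0 (\<lambda>t. LBINT s:{0..t}. (1 - w s) / \<epsilon>) Z"

lemma kappa_pos: "0 < \<beta> \<Longrightarrow> 0 < lam \<Longrightarrow> 0 < \<epsilon> \<Longrightarrow> 0 < kappa \<beta> lam \<epsilon>"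
  by (simp add: kappa_def add_pos_pos)

lemma unit_position_pos:
  assumes "0 < T" "0 < \<beta>" "0 < lam" "0 < \<epsilon>"
  shows "0 < unit_position T \<beta> lam \<epsilon>"
proof -
  have "0 \<le> \<beta> / kappa \<beta> lam \<epsilon> * (cosh (kappa \<beta> lam \<epsilon> * T / 2) / sinh (kappa \<beta> lam \<epsilon> * T / 2))"
    using assms kappa_pos[OF assms(2-4)]
    by (intro mult_nonneg_nonneg divide_nonneg_nonneg) (auto simp: sinh_real_nonneg_iff)
  then show ?thesis
    unfolding unit_position_def using assms
    by (intro divide_pos_pos add_pos_pos mult_pos_pos add_pos_nonneg) auto
qed

lemma stationary_pair_exists:
  assumes T: "0 < T" and pos: "0 < \<beta>" "0 < lam" "0 < \<epsilon>"
  shows "\<exists>w Z. stationary_pair T \<beta> lam \<epsilon> w Z \<and>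
    (LBINT s:{0..T}. (1 - w s) / \<epsilon>) = unit_position T \<beta> lam \<epsilon>"
proof -
  define k where "k = kappa \<beta> lam \<epsilon>"
  have k: "k > 0" unfolding k_def using pos by (rule kappa_pos)
  have k2: "\<epsilon> * (k * k) = \<beta> * (lam + \<beta> * \<epsilon>)"
    using pos by (simp add: k_def kappa_def field_simps power2_eq_square real_sqrt_mult_self add_pos_pos less_imp_le flip: real_sqrt_mult)
  define C where "C = cosh (k * T / 2)"
  define S where "S = sinh (k * T / 2)"
  have S: "S > 0" and C: "C > 0" using k T by (simp_all add: S_def C_def)
  have den: "k * S + \<beta> * C > 0" using k S C pos by (simp add: add_pos_pos)
  have lb: "lam + \<beta> * \<epsilon> > 0" using pos by (simp add: add_pos_pos)
  \<comment> \<open>The equilibrium of the second-order equation for \<open>w\<close>.\<close>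
  define m where "m = lam / (lam + \<beta> * \<epsilon>)"
  have m1: "1 - m = \<beta> * \<epsilon> / (lam + \<beta> * \<epsilon>)" using lb by (simp add: m_def field_simps)
  \<comment> \<open>The hyperbolic cosine is centred at \<open>T / 2\<close>, so the initial
    condition \<open>Z 0 = 0\<close> and the terminal condition \<open>w T = Z T / 2\<close> reduce
    to the same linear equation, and one amplitude meets both.\<close>
  define A where "A = - \<beta> * m / (k * S + \<beta> * C)"
  have A: "A * (k * S + \<beta> * C) = - \<beta> * m" using den by (simp add: A_def)
  define w where "w t = m + A * cosh (k * (t - T / 2))" for t
  define Z where "Z t = w t - A * k / \<beta> * sinh (k * (t - T / 2))" for t
  have dw: "(w has_real_derivative \<beta> * (w x - Z x)) (at x)" for x
    unfolding w_def Z_def using pos by (auto intro!: derivative_eq_intros)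
  have Z0: "Z 0 = 0"
  proof -
    have "\<beta> * Z 0 = \<beta> * m + A * (k * S + \<beta> * C)"
      using pos by (simp add: Z_def w_def S_def C_def field_simps)
    then show ?thesis using A pos by simp
  qed
  have ZT: "w T = Z T / 2"
  proof -
    have "\<beta> * (2 * w T - Z T) = \<beta> * m + A * (k * S + \<beta> * C)"
      using pos by (simp add: Z_def w_def S_def C_def field_simps)
    then show ?thesis using A pos by simp
  qed
  have wc: "continuous_on UNIV w" and Zc: "continuous_on UNIV Z"
    unfolding Z_def w_def by (intro continuous_intros)+
  \<comment> \<open>The state equation in differential form; \<open>k2\<close> matches the
    coefficients of \<open>cosh\<close> and the value of \<open>m\<close> matches the constants.
    Integrating it from \<open>Z 0 = 0\<close> yields the impact equation.\<close>
  have dZ: "(Z has_real_derivative lam * ((1 - w x) / \<epsilon>) - \<beta> * Z x) (at x)" for x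
  proof -
    have "lam * (1 - m) / \<epsilon> = \<beta> * m" unfolding m1 unfolding m_def using pos by simp
    moreover have "k * k / \<beta> = lam / \<epsilon> + \<beta>" using k2 pos by (simp add: field_simps)
    then have "A * (k * k / \<beta>) * cosh (k * (x - T / 2)) = A * (lam / \<epsilon> + \<beta>) * cosh (k * (x - T / 2))"
      by simp
    moreover have "lam * ((1 - w x) / \<epsilon>) = lam * (1 - m) / \<epsilon> - A * (lam / \<epsilon>) * cosh (k * (x - T / 2))"
      using pos unfolding w_def by (simp add: field_simps)
    moreover have "\<beta> * Z x = \<beta> * m + A * \<beta> * cosh (k * (x - T / 2)) - A * k * sinh (k * (x - T / 2))"
      using pos by (simp add: Z_def w_def right_diff_distrib distrib_left)
    ultimately have "A * k * sinh (k * (x - T / 2)) - A * (k * k / \<beta>) * cosh (k * (x - T / 2)) =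
        lam * ((1 - w x) / \<epsilon>) - \<beta> * Z x"
      by (simp add: distrib_left distrib_right)
    moreover have "(Z has_real_derivative
        A * k * sinh (k * (x - T / 2)) - A * (k * k / \<beta>) * cosh (k * (x - T / 2))) (at x)"
      unfolding Z_def w_def using pos by (auto intro!: derivative_eq_intros)
    ultimately show ?thesis by simp
  qed
  have vi: "set_integrable lborel {a..b} (\<lambda>s. (1 - w s) / \<epsilon>)" for a b
    using pos by (intro borel_integrable_atLeastAtMost' continuous_intros continuous_on_subset[OF wc]) auto
  have Zi: "set_integrable lborel {a..b} Z" for a b
    by (intro borel_integrable_atLeastAtMost' continuous_on_subset[OF Zc]) auto
  have "Z t = - \<beta> * (LBINT s:{0..t}. Z s) + lam * (LBINT s:{0..t}. (1 - w s) / \<epsilon>)" if t: "0 \<le> t" for t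
  proof -
    have "(LBINT s:{0..t}. lam * ((1 - w s) / \<epsilon>) - \<beta> * Z s) = Z t - Z 0"
      unfolding set_lebesgue_integral_def using t dZ pos
      by (intro integral_FTC_atLeastAtMost)
        (auto intro!: continuous_intros continuous_on_subset[OF wc] continuous_on_subset[OF Zc]
          intro: has_field_derivative_at_within simp: has_real_derivative_iff_has_vector_derivative[symmetric])
    moreover have "(LBINT s:{0..t}. lam * ((1 - w s) / \<epsilon>) - \<beta> * Z s) =
        lam * (LBINT s:{0..t}. (1 - w s) / \<epsilon>) - \<beta> * (LBINT s:{0..t}. Z s)"
      using vi Zi
      by (subst set_integral_diff) (auto intro!: set_integrable_mult_right simp del: times_divide_eq_right)
    ultimately show ?thesis using Z0 by simp
  qed
  then have "solves_impact T \<beta> lam 0 (\<lambda>t. LBINT s:{0..t}. (1 - w s) / \<epsilon>) Z"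
    unfolding solves_impact_def
    by (auto intro: continuous_on_cadlag_on continuous_on_subset[OF Zc])
  moreover have "(LBINT s:{0..T}. (1 - w s) / \<epsilon>) = unit_position T \<beta> lam \<epsilon>"
  proof -
    define W where "W t = ((1 - m) * t - A / k * sinh (k * (t - T / 2))) / \<epsilon>" for t
    have "(W has_real_derivative (1 - w x) / \<epsilon>) (at x)" for x
      unfolding W_def w_def using k pos by (auto intro!: derivative_eq_intros simp: field_simps)
    then have "(LBINT s:{0..T}. (1 - w s) / \<epsilon>) = W T - W 0"
      unfolding set_lebesgue_integral_def using T pos
      by (intro integral_FTC_atLeastAtMost)
        (auto intro!: continuous_intros continuous_on_subset[OF wc]
          intro: has_field_derivative_at_within simp: has_real_derivative_iff_has_vector_derivative[symmetric])
    also have "\<dots> = (1 - m) * T / \<epsilon> - 2 * A * S / (k * \<epsilon>)"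
      using k pos by (simp add: W_def S_def field_simps)
    also have "(1 - m) * T / \<epsilon> = \<beta> * T / (lam + \<beta> * \<epsilon>)" using pos by (simp add: m1)
    also have "2 * A * S / (k * \<epsilon>) = - (2 * m / (1 + \<beta> / k * (C / S)) / (lam + \<beta> * \<epsilon>))"
    proof -
      have "1 + \<beta> / k * (C / S) = (k * S + \<beta> * C) / (k * S)" using k S by (simp add: field_simps)
      then have "2 * m / (1 + \<beta> / k * (C / S)) / (lam + \<beta> * \<epsilon>) =
          2 * m * (k * S) / (k * S + \<beta> * C) / (lam + \<beta> * \<epsilon>)" by simp
      also have "\<dots> = 2 * m * \<beta> * S / (k * S + \<beta> * C) * (k / (\<beta> * (lam + \<beta> * \<epsilon>)))"
        using pos by simp
      \<comment> \<open>By \<open>k2\<close> the denominator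
        \<open>\<beta> * (lam + \<beta> * \<epsilon>)\<close> is
        \<open>\<epsilon> * (k * k)\<close>, which trades the factor
        \<open>1 / (k * \<epsilon>)\<close> for the form used in
        \<open>unit_position\<close>.\<close>
      also have "k / (\<beta> * (lam + \<beta> * \<epsilon>)) = 1 / (k * \<epsilon>)"
        unfolding k2[symmetric] using k pos by simp
      finally show ?thesis by (simp add: A_def)
    qed
    finally show ?thesis
      by (simp add: unit_position_def k_def[symmetric] C_def[symmetric] S_def[symmetric]
          m_def[symmetric] add_divide_distrib)
  qed
  ultimately show ?thesis
    unfolding stationary_pair_def using dw Zc ZT by blast
qed

section \<open>Completing the square for the penalised cost\<close>

text \<open>The penalty pairs \<open>u\<close> with \<open>1 - w\<close>, and the two cost terms
  equal the integral of \<open>u * w\<close>; adding them removes \<open>w\<close>.\<close>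

lemma stationary_pair_pairing:
  assumes st: "stationary_pair T \<beta> lam \<epsilon> w Z" and T: "0 \<le> T" and pos: "lam \<noteq> 0" "\<epsilon> \<noteq> 0"
    and u: "set_integrable lborel {0..T} u"
    and Y: "solves_impact T \<beta> lam 0 (\<lambda>t. LBINT s:{0..t}. u s) Y"
  shows "Y T * Z T / (2 * lam) + \<beta> / lam * (LBINT s:{0..T}. Y s * Z s) +
    \<epsilon> * (LBINT s:{0..T}. u s * ((1 - w s) / \<epsilon>)) = (LBINT s:{0..T}. u s)"
proof -
  have dw: "\<And>x. (w has_real_derivative \<beta> * (w x - Z x)) (at x)" and Zc: "continuous_on {0..T} Z"
    and wT: "w T = Z T / 2"
    using st continuous_on_subset by (auto simp: stationary_pair_def)
  have wc: "continuous_on {0..T} w"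
    using dw by (intro DERIV_continuous_on[of _ w]) (auto intro: has_field_derivative_at_within)
  have "Y T * Z T / (2 * lam) + \<beta> / lam * (LBINT s:{0..T}. Y s * Z s) = (LBINT s:{0..T}. u s * w s)"
    by (rule euler_lagrange_identity[OF T u Y pos(1) dw Zc wT])
  moreover have "\<epsilon> * (LBINT s:{0..T}. u s * ((1 - w s) / \<epsilon>)) = (LBINT s:{0..T}. u s - u s * w s)"
    unfolding set_integral_mult_right[symmetric] using pos
    by (intro set_lebesgue_integral_cong) (auto simp: field_simps)
  moreover have "\<dots> = (LBINT s:{0..T}. u s) - (LBINT s:{0..T}. u s * w s)"
    using u continuous_on_mult_integrable[OF u wc] by (rule set_integral_diff(2))
  ultimately show ?thesis by simp
qed

text \<open>The stationary pair paired with itself.\<close>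

lemma stationary_pair_cost:
  assumes st: "stationary_pair T \<beta> lam \<epsilon> w Z" and T: "0 \<le> T" and pos: "lam \<noteq> 0" "\<epsilon> \<noteq> 0"
  shows "path_cost T \<beta> lam Z + \<epsilon> * (LBINT s:{0..T}. ((1 - w s) / \<epsilon>)\<^sup>2) = (LBINT s:{0..T}. (1 - w s) / \<epsilon>)"
proof -
  have "continuous_on {0..T} w"
    using st by (intro DERIV_continuous_on[of _ w])
      (auto simp: stationary_pair_def intro: has_field_derivative_at_within)
  then have "set_integrable lborel {0..T} (\<lambda>s. (1 - w s) / \<epsilon>)"
    using pos by (intro borel_integrable_atLeastAtMost' continuous_intros) auto
  from stationary_pair_pairing[OF st T pos this, of Z] show ?thesis
    using st by (simp add: stationary_pair_def path_cost_def power2_eq_square)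
qed

text \<open>Expanding the nonnegative cost of \<open>(Y - c Z, u - c v)\<close>; the cross term only depends on
  the final position.\<close>

lemma regularised_cost_lower_bound:
  assumes st: "stationary_pair T \<beta> lam \<epsilon> w Z" and T: "0 \<le> T" and pos: "0 < \<beta>" "0 < lam" "0 < \<epsilon>"
    and u: "set_integrable lborel {0..T} u" and u2: "set_integrable lborel {0..T} (\<lambda>s. (u s)\<^sup>2)"
    and Y: "solves_impact T \<beta> lam 0 (\<lambda>t. LBINT s:{0..t}. u s) Y"
  shows "2 * c * (LBINT s:{0..T}. u s) - c\<^sup>2 * (LBINT s:{0..T}. (1 - w s) / \<epsilon>) \<le>
    path_cost T \<beta> lam Y + \<epsilon> * (LBINT s:{0..T}. (u s)\<^sup>2)"
proof -
  define v where "v s = (1 - w s) / \<epsilon>" for s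
  have dw: "\<And>x. (w has_real_derivative \<beta> * (w x - Z x)) (at x)" and Zc: "continuous_on {0..T} Z"
    using st continuous_on_subset by (auto simp: stationary_pair_def)
  have wc: "continuous_on {0..T} w"
    using dw by (intro DERIV_continuous_on[of _ w]) (auto intro: has_field_derivative_at_within)
  have vc: "continuous_on {0..T} v" unfolding v_def using pos by (intro continuous_intros wc) auto
  have Yc: "cadlag_on T Y" using Y by (simp add: solves_impact_def)
  have Yi: "set_integrable lborel {0..T} Y" using Yc by (rule cadlag_on_integrable)
  \<comment> \<open>Used for \<open>(Y, Z)\<close> and for \<open>(u, v)\<close>. The first function
    may be rough but is square integrable, the second is continuous, so all three integrals
    exist.\<close>
  have sq: "(LBINT s:{0..T}. (f s - c * g s)\<^sup>2) =
      (LBINT s:{0..T}. (f s)\<^sup>2) - 2 * c * (LBINT s:{0..T}. f s * g s) + c\<^sup>2 * (LBINT s:{0..T}. (g s)\<^sup>2)"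
    if f: "set_integrable lborel {0..T} f" and f2: "set_integrable lborel {0..T} (\<lambda>s. (f s)\<^sup>2)"
      and g: "continuous_on {0..T} g" for f g :: "real \<Rightarrow> real"
  proof -
    have i: "set_integrable lborel {0..T} (\<lambda>s. 2 * c * (f s * g s))"
      "set_integrable lborel {0..T} (\<lambda>s. c\<^sup>2 * (g s)\<^sup>2)"
      using continuous_on_mult_integrable[OF f g]
      by (auto intro!: borel_integrable_atLeastAtMost' continuous_intros g)
    have "(LBINT s:{0..T}. (f s - c * g s)\<^sup>2) =
        (LBINT s:{0..T}. ((f s)\<^sup>2 - 2 * c * (f s * g s)) + c\<^sup>2 * (g s)\<^sup>2)"
      by (intro set_lebesgue_integral_cong) (simp_all add: power2_diff power_mult_distrib algebra_simps)
    also have "\<dots> = (LBINT s:{0..T}. (f s)\<^sup>2 - 2 * c * (f s * g s)) + (LBINT s:{0..T}. c\<^sup>2 * (g s)\<^sup>2)"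
      using i f2 by (intro set_integral_add(2) set_integral_diff(1))
    also have "(LBINT s:{0..T}. (f s)\<^sup>2 - 2 * c * (f s * g s)) =
        (LBINT s:{0..T}. (f s)\<^sup>2) - (LBINT s:{0..T}. 2 * c * (f s * g s))"
      using i f2 by (intro set_integral_diff(2))
    finally show ?thesis by simp
  qed
  have nonneg: "0 \<le> (LBINT s:{0..T}. (f s)\<^sup>2)" for f :: "real \<Rightarrow> real"
    unfolding set_lebesgue_integral_def by (intro Bochner_Integration.integral_nonneg) auto
  note pairing = stationary_pair_pairing[OF st T, folded v_def]
  note self = stationary_pair_cost[OF st T, folded v_def]
  have Y2: "set_integrable lborel {0..T} (\<lambda>s. (Y s)\<^sup>2)"
    unfolding power2_eq_square using Yc Yi by (rule cadlag_on_mult_integrable)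
  have "0 \<le> (Y T - c * Z T)\<^sup>2 / (2 * lam) + \<beta> / lam * (LBINT s:{0..T}. (Y s - c * Z s)\<^sup>2) +
      \<epsilon> * (LBINT s:{0..T}. (u s - c * v s)\<^sup>2)"
    using pos nonneg[of "\<lambda>s. Y s - c * Z s"] nonneg[of "\<lambda>s. u s - c * v s"]
    by (intro add_nonneg_nonneg mult_nonneg_nonneg) auto
  also have "\<dots> = path_cost T \<beta> lam Y + \<epsilon> * (LBINT s:{0..T}. (u s)\<^sup>2) -
      2 * c * (Y T * Z T / (2 * lam) + \<beta> / lam * (LBINT s:{0..T}. Y s * Z s) + \<epsilon> * (LBINT s:{0..T}. u s * v s))
      + c\<^sup>2 * (path_cost T \<beta> lam Z + \<epsilon> * (LBINT s:{0..T}. (v s)\<^sup>2))"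
    unfolding sq[OF Yi Y2 Zc] sq[OF u u2 vc] path_cost_def using pos
    by (simp add: field_simps power2_eq_square)
  also have "\<dots> = path_cost T \<beta> lam Y + \<epsilon> * (LBINT s:{0..T}. (u s)\<^sup>2) - 2 * c * (LBINT s:{0..T}. u s)
      + c\<^sup>2 * (LBINT s:{0..T}. v s)"
    using pairing[OF _ _ u Y] self pos by simp
  finally show "2 * c * (LBINT s:{0..T}. u s) - c\<^sup>2 * (LBINT s:{0..T}. (1 - w s) / \<epsilon>) \<le>
      path_cost T \<beta> lam Y + \<epsilon> * (LBINT s:{0..T}. (u s)\<^sup>2)" by (simp add: v_def)
qed

section \<open>Values and their asymptotics\<close>

lemma continuous_set_integrable_Icc:
  fixes f :: "real \<Rightarrow> real"
  assumes "continuous_on UNIV f"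
  shows "set_integrable lborel {a..b} f"
  using assms by (intro borel_integrable_atLeastAtMost') (auto intro: continuous_on_subset)

section \<open>Exact value of the penalised problem\<close>

context usual_filtered_prob_space
begin

lemma J_eps_lower_bound:
  assumes Q: "Q \<in> ac_strategies M F T \<Xi>" and pos: "0 < \<beta>" "0 < lam" "0 < \<epsilon>"
  shows "\<Xi>\<^sup>2 / unit_position T \<beta> lam \<epsilon> \<le> J_eps M F T \<beta> lam 0 \<epsilon> Q"
proof -
  define u where "u = rate M F T Q"
  define Z where "Z \<omega> = path_cost T \<beta> lam (\<lambda>t. impact T \<beta> lam 0 Q t \<omega>)" for \<omega>
  define R where "R \<omega> = (LBINT s:{0..T}. (u s \<omega>)\<^sup>2)" for \<omega>
  define K where "K = unit_position T \<beta> lam \<epsilon>"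
  have K: "K > 0" unfolding K_def using T_pos pos by (rule unit_position_pos)
  have QS: "Q \<in> strategies M F T \<Xi>" using Q by (simp add: ac_strategies_def)
  have u: "is_rate M F T Q u" unfolding u_def using Q by (rule is_rate_rate)
  obtain w Y where st: "stationary_pair T \<beta> lam \<epsilon> w Y" and wK: "(LBINT s:{0..T}. (1 - w s) / \<epsilon>) = K"
    using stationary_pair_exists[OF T_pos pos] unfolding K_def by blast
  have "AE \<omega> in M. \<forall>t\<in>{0..T}. Q t \<omega> = (LBINT s:{0..t}. u s \<omega>)" using u by (simp add: is_rate_def)
  then have "AE \<omega> in M. \<Xi>\<^sup>2 / K \<le> Z \<omega> + \<epsilon> * R \<omega>"
    using strategiesD(2)[OF QS] AE_space rate_square_integrable(1,2)[OF u]
  proof eventually_elim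
    case (elim \<omega>)
    have "cadlag_on T (\<lambda>s. Q s \<omega>)"
      using strategiesD(1)[OF QS] elim by (simp add: adapted_cadlag_def)
    then have "solves_impact T \<beta> lam 0 (\<lambda>t. LBINT s:{0..t}. u s \<omega>) (\<lambda>t. impact T \<beta> lam 0 Q t \<omega>)"
      using elim(1) by (intro solves_impact_cong[OF impact_solves]) auto
    \<comment> \<open>The multiple \<open>\<Xi> / K\<close> maximises
      \<open>2 * c * \<Xi> - c\<^sup>2 * K\<close> over \<open>c\<close>.\<close>
    from regularised_cost_lower_bound[OF st _ pos elim(5,4) this, of "\<Xi> / K"]
    have "2 * (\<Xi> / K) * (LBINT s:{0..T}. u s \<omega>) - (\<Xi> / K)\<^sup>2 * K \<le> Z \<omega> + \<epsilon> * R \<omega>"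
      using T_pos unfolding wK by (simp add: Z_def R_def)
    moreover have "(LBINT s:{0..T}. u s \<omega>) = \<Xi>" using elim(1,2) T_pos by simp
    moreover have "2 * (\<Xi> / K) * \<Xi> - (\<Xi> / K)\<^sup>2 * K = \<Xi>\<^sup>2 / K"
      using K by (simp add: field_simps power2_eq_square)
    ultimately show ?case by simp
  qed
  moreover have int: "integrable M Z" "integrable M R"
    unfolding Z_def R_def using path_cost_integrable[OF QS pos(1,2)] rate_square_integrable(3)[OF u] .
  ultimately have "(\<integral>\<omega>. \<Xi>\<^sup>2 / K \<partial>M) \<le> (\<integral>\<omega>. Z \<omega> + \<epsilon> * R \<omega> \<partial>M)"
    by (intro integral_mono_AE) auto
  also have "\<dots> = J_eps M F T \<beta> lam 0 \<epsilon> Q"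
    using int J0_eq_expectation[OF strategiesD(1)[OF QS], of lam \<beta>] pos
    by (simp add: J_eps_def Z_def[symmetric] R_def[symmetric] u_def[symmetric])
  finally show ?thesis by (simp add: K_def prob_space)
qed

text \<open>The semimartingale decomposition is the trivial one: the martingale part is zero and the
  whole path is the finite-variation part.\<close>

lemma deterministic_Lipschitz_strategy:
  assumes L: "\<And>x y. 0 \<le> x \<Longrightarrow> x \<le> y \<Longrightarrow> y \<le> T \<Longrightarrow> \<bar>q y - q x\<bar> \<le> L * (y - x)" "0 \<le> L"
    and q: "continuous_on {0..T} q" "q 0 = 0" "q T = \<Xi>"
  shows "(\<lambda>t \<omega>. q t) \<in> strategies M F T \<Xi>"
proof -
  have qc: "cadlag_on T q" using q(1) by (rule continuous_on_cadlag_on)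
  have ad: "adapted_cadlag M F T (\<lambda>t \<omega>. q t)"
    using qc by (simp add: adapted_cadlag_def)
  have ad0: "adapted_cadlag M F T (\<lambda>t \<omega>. 0)"
    by (simp add: adapted_cadlag_def cadlag_on_def) (blast intro: tendsto_const)
  have mart: "cadlag_martingale M F T (\<lambda>t \<omega>. 0)"
    unfolding cadlag_martingale_def
  proof (intro conjI ad0 allI impI ballI)
    fix s t assume st: "0 \<le> s \<and> s \<le> t \<and> t \<le> T"
    then interpret finite_measure_subalgebra M "F s"
      by unfold_locales (use subalg in auto)
    show "AE \<omega> in M. real_cond_exp M (F s) (\<lambda>\<omega>. 0) \<omega> = 0"
      by (rule real_cond_exp_F_meas) auto
  qed simp
  \<comment> \<open>The constant time \<open>T\<close> stops nothing before the horizon; each event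
    \<open>T \<le> t\<close> is empty or the whole space.\<close>
  have loc: "localising_sequence M F T (\<lambda>n \<omega>. T)"
    unfolding localising_sequence_def
  proof (intro conjI allI ballI)
    fix t assume "t \<in> {0..T}"
    then have "space (F t) = space M" using subalg by (simp add: subalgebra_def)
    then show "{\<omega> \<in> space M. T \<le> t} \<in> sets (F t)" by (metis (lifting) Collect_cong Collect_mem_eq sets.sets_Collect_const)
  qed (use T_pos in auto)
  have "local_martingale M F T (\<lambda>t \<omega>. 0)"
    unfolding local_martingale_def using ad0 mart loc by blast
  moreover have "finite_variation_on T q" using L by (rule finite_variation_on_Lipschitz)
  ultimately have "semimartingale M F T (\<lambda>t \<omega>. q t)"
    unfolding semimartingale_def using ad q(2)
    by (intro conjI exI[of _ "\<lambda>t \<omega>. 0"] exI[of _ "\<lambda>t \<omega>. q t"]) auto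
  moreover have "(\<integral>\<^sup>+\<omega>. (SUP t\<in>{0..T}. ennreal (\<bar>q t\<bar>\<^sup>2)) \<partial>M) < \<infinity>"
  proof -
    obtain B where B: "\<forall>t\<in>{0..T}. \<bar>q t\<bar> \<le> B" using cadlag_on_bounded[OF qc] by blast
    have "(SUP t\<in>{0..T}. ennreal (\<bar>q t\<bar>\<^sup>2)) \<le> ennreal (B\<^sup>2)"
    proof (rule SUP_least)
      fix t assume "t \<in> {0..T}"
      then have "\<bar>q t\<bar>\<^sup>2 \<le> B\<^sup>2" using B by (intro power_mono) auto
      then show "ennreal (\<bar>q t\<bar>\<^sup>2) \<le> ennreal (B\<^sup>2)" by (rule ennreal_leI)
    qed
    then have "(SUP t\<in>{0..T}. ennreal (\<bar>q t\<bar>\<^sup>2)) < \<infinity>"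
      using ennreal_less_top le_less_trans by (metis infinity_ennreal_def)
    then show ?thesis by (simp add: emeasure_space_1)
  qed
  ultimately show ?thesis using q(3) by (simp add: strategies_def)
qed

text \<open>The stationary pair, scaled by \<open>c\<close> so as to reach \<open>\<Xi>\<close>, has
  cost \<open>c\<^sup>2 * K\<close>. The penalty is evaluated at the rate chosen by
  \<open>rate\<close>, which has to be matched with \<open>c * v\<close> beforehand.\<close>

lemma optimal_ac_strategy:
  assumes pos: "0 < \<beta>" "0 < lam" "0 < \<epsilon>"
  shows "\<exists>Q\<in>ac_strategies M F T \<Xi>. J_eps M F T \<beta> lam 0 \<epsilon> Q = \<Xi>\<^sup>2 / unit_position T \<beta> lam \<epsilon>"
proof -
  define K where "K = unit_position T \<beta> lam \<epsilon>"
  have K: "K > 0" unfolding K_def using T_pos pos by (rule unit_position_pos)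
  define c where "c = \<Xi> / K"
  have cK: "c * K = \<Xi>" "c\<^sup>2 * K = \<Xi>\<^sup>2 / K" using K by (simp_all add: c_def power2_eq_square)
  obtain w Z where st: "stationary_pair T \<beta> lam \<epsilon> w Z" and wK: "(LBINT s:{0..T}. (1 - w s) / \<epsilon>) = K"
    using stationary_pair_exists[OF T_pos pos] unfolding K_def by blast
  define v where "v s = (1 - w s) / \<epsilon>" for s
  define q where "q t = c * (LBINT s:{0..t}. v s)" for t
  have "continuous_on UNIV w"
    using st by (intro DERIV_continuous_on[of _ w]) (auto simp: stationary_pair_def)
  then have vc: "continuous_on UNIV v"
    unfolding v_def using pos by (intro continuous_intros) auto
  have vi: "set_integrable lborel {a..b} v" for a b
    using vc by (rule continuous_set_integrable_Icc)
  have qeq: "q t = (LBINT s:{0..t}. c * v s)" for t by (simp add: q_def)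
  have qc: "continuous_on {0..T} q"
    unfolding q_def by (intro continuous_intros indefinite_integral_continuous_on vi)
  obtain B where B: "\<forall>t\<in>{0..T}. \<bar>v t\<bar> \<le> B"
    using cadlag_on_bounded[OF continuous_on_cadlag_on] continuous_on_subset[OF vc] by (metis subset_UNIV)
  have QS: "(\<lambda>t \<omega>. q t) \<in> strategies M F T \<Xi>"
  proof (rule deterministic_Lipschitz_strategy)
    fix x y assume xy: "0 \<le> x" "x \<le> y" "y \<le> T"
    have "q y - q x = c * (LBINT s:{x..y}. v s)"
      unfolding q_def set_integral_Icc_diff[OF vi xy, symmetric] by (simp add: right_diff_distrib)
    moreover have "\<bar>LBINT s:{x..y}. v s\<bar> \<le> B * (y - x)"
      using B xy by (intro abs_set_integral_Icc_le vi) auto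
    ultimately show "\<bar>q y - q x\<bar> \<le> \<bar>c\<bar> * B * (y - x)"
      by (simp add: abs_mult mult.assoc mult_left_mono)
  next
    have "0 \<le> B" using B T_pos by (auto dest!: bspec[of _ _ 0])
    then show "0 \<le> \<bar>c\<bar> * B" by simp
  qed (use qc wK cK in \<open>auto simp: q_def v_def\<close>)
  have ru: "is_rate M F T (\<lambda>t \<omega>. q t) (\<lambda>s \<omega>. c * v s)"
    unfolding is_rate_def progressively_measurable_def
  proof (intro conjI ballI)
    fix t assume "t \<in> {0..T}"
    have "v \<in> borel_measurable borel" using vc by (rule borel_measurable_continuous_onI)
    then have "(\<lambda>s. c * v s) \<in> borel_measurable (restrict_space borel {0..t})"
      by (intro measurable_restrict_space1) measurable
    from measurable_compose[OF measurable_fst this]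
    show "(\<lambda>(s, \<omega>). c * v s) \<in> borel_measurable (restrict_space borel {0..t} \<Otimes>\<^sub>M F t)"
      by (simp add: case_prod_beta')
  next
    have "set_integrable lborel {0..T} (\<lambda>s. (c * v s)\<^sup>2)"
      by (intro continuous_set_integrable_Icc continuous_intros vc)
    then have "(\<integral>\<^sup>+s. ennreal (norm (indicator {0..T} s *\<^sub>R (c * v s)\<^sup>2)) \<partial>lborel) < \<infinity>"
      unfolding set_integrable_def integrable_iff_bounded by blast
    also have "(\<integral>\<^sup>+s. ennreal (norm (indicator {0..T} s *\<^sub>R (c * v s)\<^sup>2)) \<partial>lborel) =
        (\<integral>\<^sup>+s\<in>{0..T}. ennreal ((c * v s)\<^sup>2) \<partial>lborel)"
      by (intro nn_integral_cong) (auto simp: indicator_def)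
    finally show "(\<integral>\<^sup>+\<omega>. (\<integral>\<^sup>+s\<in>{0..T}. ennreal ((c * v s)\<^sup>2) \<partial>lborel) \<partial>M) < \<infinity>"
      by (simp add: emeasure_space_1)
  qed (simp add: qeq)
  then have Q: "(\<lambda>t \<omega>. q t) \<in> ac_strategies M F T \<Xi>"
    using QS by (auto simp: ac_strategies_def)
  define u where "u = rate M F T (\<lambda>t \<omega>. q t)"
  have u: "is_rate M F T (\<lambda>t \<omega>. q t) u" unfolding u_def using Q by (rule is_rate_rate)
  define R where "R \<omega> = (LBINT s:{0..T}. (u s \<omega>)\<^sup>2)" for \<omega>
  have "AE \<omega> in M. \<forall>t\<in>{0..T}. q t = (LBINT s:{0..t}. u s \<omega>)" using u by (simp add: is_rate_def)
  then have "AE \<omega> in M. R \<omega> = (LBINT s:{0..T}. (c * v s)\<^sup>2)"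
    using rate_square_integrable(1,2)[OF u]
  proof eventually_elim
    case (elim \<omega>)
    \<comment> \<open>For almost every \<open>\<omega>\<close> the chosen rate and
      \<open>c * v\<close> have the same primitive on \<open>{0..T}\<close>.\<close>
    have "AE s in lborel. s \<in> {0..T} \<longrightarrow> u s \<omega> = c * v s"
      using elim(1) vi by (intro indefinite_integral_eq_imp_AE_eq elim(3)) (auto simp: qeq)
    then show ?case
      unfolding R_def set_lebesgue_integral_def
    proof (intro integral_cong_AE)
      show "(\<lambda>s. indicator {0..T} s *\<^sub>R (u s \<omega>)\<^sup>2) \<in> borel_measurable lborel"
        using elim(2) by (auto simp: set_integrable_def)
      show "(\<lambda>s. indicator {0..T} s *\<^sub>R (c * v s)\<^sup>2) \<in> borel_measurable lborel"
        using borel_measurable_continuous_onI[OF vc] by measurable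
    qed (auto simp: indicator_def elim!: eventually_mono)
  qed
  then have ER: "(\<integral>\<omega>. R \<omega> \<partial>M) = (LBINT s:{0..T}. (c * v s)\<^sup>2)"
    using rate_square_integrable(3)[OF u]
    by (subst integral_cong_AE[where g = "\<lambda>_. LBINT s:{0..T}. (c * v s)\<^sup>2"]) (auto simp: R_def[abs_def] prob_space)
  have "solves_impact T \<beta> lam 0 (\<lambda>t. LBINT s:{0..t}. v s) Z"
    using st by (simp add: stationary_pair_def v_def)
  then have Zc: "cadlag_on T Z"
    and Zeq: "\<And>t. t \<in> {0..T} \<Longrightarrow> Z t = - \<beta> * (LBINT s:{0..t}. Z s) + lam * (LBINT s:{0..t}. v s)"
    by (auto simp: solves_impact_def)
  have cZ: "solves_impact T \<beta> lam 0 q (\<lambda>t. c * Z t)"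
    unfolding solves_impact_def
  proof (intro conjI ballI cadlag_on_mult Zc continuous_on_cadlag_on continuous_on_const)
    fix t assume "t \<in> {0..T}"
    then show "c * Z t = 0 - \<beta> * (LBINT s:{0..t}. c * Z s) + lam * q t"
      by (subst Zeq) (simp_all add: q_def algebra_simps)
  qed
  have qcad: "cadlag_on T q" using qc by (rule continuous_on_cadlag_on)
  have "impact T \<beta> lam 0 (\<lambda>t \<omega>. q t) t \<omega> = c * Z t" if "t \<in> {0..T}" for t and \<omega> :: 'a
    using impact_eq_impact_path[of T "\<lambda>t \<omega>. q t" \<omega> t] solves_impact_unique[OF cZ qcad that] qcad that by simp
  then have "path_cost T \<beta> lam (\<lambda>t. impact T \<beta> lam 0 (\<lambda>t \<omega>. q t) t \<omega>) = path_cost T \<beta> lam (\<lambda>t. c * Z t)" for \<omega> :: 'a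
    using T_pos by (intro path_cost_cong) auto
  then have "J0 M T \<beta> lam 0 (\<lambda>t \<omega>. q t) = path_cost T \<beta> lam (\<lambda>t. c * Z t)"
    using J0_eq_expectation[OF strategiesD(1)[OF QS], of lam \<beta>] pos by (simp add: prob_space)
  then have "J_eps M F T \<beta> lam 0 \<epsilon> (\<lambda>t \<omega>. q t) =
      path_cost T \<beta> lam (\<lambda>t. c * Z t) + \<epsilon> * (LBINT s:{0..T}. (c * v s)\<^sup>2)"
    unfolding J_eps_def ER[unfolded R_def u_def] by simp
  also have "\<dots> = c\<^sup>2 * (path_cost T \<beta> lam Z + \<epsilon> * (LBINT s:{0..T}. (v s)\<^sup>2))"
    by (simp add: path_cost_def power_mult_distrib algebra_simps)
  also have "path_cost T \<beta> lam Z + \<epsilon> * (LBINT s:{0..T}. (v s)\<^sup>2) = K"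
    using stationary_pair_cost[OF st] T_pos pos wK by (simp add: v_def)
  finally show ?thesis using Q cK by (auto simp: K_def)
qed

lemma V_eq:
  assumes pos: "0 < \<beta>" "0 < lam" "0 < \<epsilon>"
  shows "V M F T \<beta> lam 0 \<Xi> \<epsilon> = \<Xi>\<^sup>2 / unit_position T \<beta> lam \<epsilon>"
proof -
  obtain Q where Q: "Q \<in> ac_strategies M F T \<Xi>"
    "J_eps M F T \<beta> lam 0 \<epsilon> Q = \<Xi>\<^sup>2 / unit_position T \<beta> lam \<epsilon>"
    using optimal_ac_strategy[OF pos] by blast
  have "(INF Q\<in>ac_strategies M F T \<Xi>. J_eps M F T \<beta> lam 0 \<epsilon> Q) = \<Xi>\<^sup>2 / unit_position T \<beta> lam \<epsilon>"
    using J_eps_lower_bound[OF _ pos]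
    by (intro cInf_eq_minimum) (use Q in \<open>auto intro!: rev_image_eqI[of Q]\<close>)
  then show ?thesis using pos by (simp add: V_def)
qed

end

section \<open>Expansion for a vanishing penalty\<close>

text \<open>With \<open>1 / unit_position = (lam + \<beta> * \<epsilon>) / D\<close>, everything
  rests on \<open>D0 - D = 2 * s + O(\<epsilon>)\<close>. The first-order coefficient is then
  \<open>2 * lam * s / D0\<^sup>2\<close>, and
  \<open>lam * s = sqrt (\<beta> * lam) * sqrt \<epsilon>\<close>.\<close>

lemma unit_position_asymptotics:
  assumes "0 < T" "0 < \<beta>" "0 < lam"
  shows "(\<lambda>\<epsilon>. 1 / unit_position T \<beta> lam \<epsilon> - (lam / (\<beta> * T + 2) + 2 * sqrt (\<beta> * lam) / (\<beta> * T + 2)\<^sup>2 * sqrt \<epsilon>))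
    \<in> O[at_right 0](\<lambda>\<epsilon>. \<epsilon>)"
proof -
  define D0 where "D0 = \<beta> * T + 2"
  have D0: "D0 > 0" using assms by (simp add: D0_def add_pos_pos)
  \<comment> \<open>The leading term of \<open>\<beta> / kappa\<close>, where
    \<open>\<beta> * lam / \<epsilon>\<close> dominates under the root.\<close>
  define s where "s \<epsilon> = \<beta> / sqrt (\<beta> * lam) * sqrt \<epsilon>" for \<epsilon>
  define r where "r \<epsilon> = \<beta> / kappa \<beta> lam \<epsilon> * (cosh (kappa \<beta> lam \<epsilon> * T / 2) / sinh (kappa \<beta> lam \<epsilon> * T / 2))" for \<epsilon>
  define m where "m \<epsilon> = lam / (lam + \<beta> * \<epsilon>)" for \<epsilon>
  define D where "D \<epsilon> = \<beta> * T + 2 * m \<epsilon> / (1 + r \<epsilon>)" for \<epsilon>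
  have ev: "\<forall>\<^sub>F \<epsilon>::real in at_right 0. 0 < \<epsilon>" by (simp add: eventually_at_right_less)
  have rpos: "0 \<le> r \<epsilon>" if "0 < \<epsilon>" for \<epsilon>
    unfolding r_def using kappa_pos[OF assms(2,3) that] assms by (intro mult_nonneg_nonneg divide_nonneg_nonneg) auto
  have mpos: "0 < m \<epsilon>" if "0 < \<epsilon>" for \<epsilon>
    unfolding m_def using assms that by (intro divide_pos_pos add_pos_pos) auto
  have Dge: "\<beta> * T \<le> D \<epsilon>" if "0 < \<epsilon>" for \<epsilon>
    unfolding D_def using rpos[OF that] mpos[OF that] by simp
  have bT: "0 < \<beta> * T" using assms by simp
  have s_O: "s \<in> O[at_right 0](sqrt)"
    unfolding s_def using assms by real_asymp
  have m1: "(\<lambda>\<epsilon>. 1 - m \<epsilon>) \<in> O[at_right 0](\<lambda>\<epsilon>. \<epsilon>)"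
    unfolding m_def using assms by real_asymp
  have "(\<lambda>\<epsilon>. 1 - sqrt (m \<epsilon>)) \<in> O[at_right 0](\<lambda>\<epsilon>. 1 - m \<epsilon>)"
  proof (rule bigoI[where c = 1])
    show "\<forall>\<^sub>F \<epsilon> in at_right 0. norm (1 - sqrt (m \<epsilon>)) \<le> 1 * norm (1 - m \<epsilon>)"
      using ev
    proof eventually_elim
      case (elim \<epsilon>)
      have "m \<epsilon> \<le> 1"
        using assms elim by (simp add: m_def divide_le_eq add_pos_pos)
      moreover have "m \<epsilon> \<le> sqrt (m \<epsilon>)"
        using mpos[OF elim] \<open>m \<epsilon> \<le> 1\<close> by (intro real_le_rsqrt) (simp add: power2_eq_square mult_left_le)
      ultimately show ?case by simp
    qed
  qed
  then have sm: "(\<lambda>\<epsilon>. 1 - sqrt (m \<epsilon>)) \<in> O[at_right 0](\<lambda>\<epsilon>. \<epsilon>)" using m1 by (rule landau_o.big_trans)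
  have s_1: "s \<in> O[at_right 0](\<lambda>_. 1)"
    unfolding s_def using assms by real_asymp
  \<comment> \<open>The relation \<open>\<beta> / kappa = s * sqrt m\<close> is exact, so the error
    is \<open>s * (1 - sqrt m)\<close> up to sign.\<close>
  have r1: "(\<lambda>\<epsilon>. \<beta> / kappa \<beta> lam \<epsilon> - s \<epsilon>) \<in> O[at_right 0](\<lambda>\<epsilon>. \<epsilon>)"
  proof -
    have "(\<lambda>\<epsilon>. - (s \<epsilon> * (1 - sqrt (m \<epsilon>)))) \<in> O[at_right 0](\<lambda>\<epsilon>. \<epsilon>)"
      using landau_o.big.mult[OF s_1 sm] by simp
    moreover have "\<forall>\<^sub>F \<epsilon> in at_right 0. - (s \<epsilon> * (1 - sqrt (m \<epsilon>))) = \<beta> / kappa \<beta> lam \<epsilon> - s \<epsilon>"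
      using ev
    proof eventually_elim
      case (elim \<epsilon>)
      have pos: "0 < \<beta> * \<epsilon>" "0 < lam + \<beta> * \<epsilon>" "0 \<le> \<beta>\<^sup>2 + \<beta> * lam / \<epsilon>"
        using assms elim by (simp_all add: add_pos_pos add_nonneg_nonneg)
      have "(\<beta> / kappa \<beta> lam \<epsilon>)\<^sup>2 = \<beta>\<^sup>2 / (\<beta>\<^sup>2 + \<beta> * lam / \<epsilon>)"
        using pos by (simp add: kappa_def power_divide)
      also have "\<beta>\<^sup>2 + \<beta> * lam / \<epsilon> = \<beta> * (lam + \<beta> * \<epsilon>) / \<epsilon>"
        using elim by (simp add: field_simps power2_eq_square)
      also have "\<beta>\<^sup>2 / (\<beta> * (lam + \<beta> * \<epsilon>) / \<epsilon>) = \<beta> * \<epsilon> / (lam + \<beta> * \<epsilon>)"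
        using assms by (simp add: power2_eq_square)
      also have "\<dots> = \<beta>\<^sup>2 / (\<beta> * lam) * \<epsilon> * m \<epsilon>"
        using assms by (simp add: m_def power2_eq_square)
      also have "\<dots> = (s \<epsilon> * sqrt (m \<epsilon>))\<^sup>2"
        using assms elim mpos[OF elim] by (simp add: s_def power_mult_distrib power_divide)
      finally have "\<beta> / kappa \<beta> lam \<epsilon> = s \<epsilon> * sqrt (m \<epsilon>)"
      proof (rule power2_eq_imp_eq)
        show "0 \<le> \<beta> / kappa \<beta> lam \<epsilon>" using kappa_pos[OF assms(2,3) elim] assms by simp
        show "0 \<le> s \<epsilon> * sqrt (m \<epsilon>)" using assms elim mpos[OF elim] by (simp add: s_def)
      qed
      then show ?case by (simp add: right_diff_distrib)
    qed
    ultimately show ?thesis by (subst (asm) landau_o.big.in_cong) simp_all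
  qed
  have r2: "(\<lambda>\<epsilon>. \<beta> / kappa \<beta> lam \<epsilon>) \<in> O[at_right 0](\<lambda>_. 1)"
    unfolding kappa_def using assms by real_asymp
  \<comment> \<open>The hyperbolic cotangent tends to one exponentially fast in
    \<open>kappa\<close>, which grows like the inverse root of \<open>\<epsilon>\<close>; this error
    is smaller than any power of \<open>\<epsilon>\<close>.\<close>
  have r3: "(\<lambda>\<epsilon>. cosh (kappa \<beta> lam \<epsilon> * T / 2) / sinh (kappa \<beta> lam \<epsilon> * T / 2) - 1) \<in> O[at_right 0](\<lambda>\<epsilon>. \<epsilon>)"
    unfolding kappa_def using assms by real_asymp
  have rs: "(\<lambda>\<epsilon>. r \<epsilon> - s \<epsilon>) \<in> O[at_right 0](\<lambda>\<epsilon>. \<epsilon>)"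
  proof -
    have "r \<epsilon> - s \<epsilon> = (\<beta> / kappa \<beta> lam \<epsilon> - s \<epsilon>) +
        \<beta> / kappa \<beta> lam \<epsilon> * (cosh (kappa \<beta> lam \<epsilon> * T / 2) / sinh (kappa \<beta> lam \<epsilon> * T / 2) - 1)" for \<epsilon>
      unfolding r_def right_diff_distrib by simp
    moreover have "(\<lambda>\<epsilon>. \<beta> / kappa \<beta> lam \<epsilon> *
        (cosh (kappa \<beta> lam \<epsilon> * T / 2) / sinh (kappa \<beta> lam \<epsilon> * T / 2) - 1)) \<in> O[at_right 0](\<lambda>\<epsilon>. \<epsilon>)"
      using landau_o.big.mult[OF r2 r3] by simp
    ultimately show ?thesis
      using sum_in_bigo(1)[OF r1] by presburger
  qed
  have id_sqrt: "(\<lambda>\<epsilon>::real. \<epsilon>) \<in> O[at_right 0](sqrt)" by real_asymp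
  have r_O: "r \<in> O[at_right 0](sqrt)"
    using sum_in_bigo(1)[OF landau_o.big_trans[OF rs id_sqrt] s_O] by simp
  have sqrt2: "(\<lambda>\<epsilon>. sqrt \<epsilon> * sqrt \<epsilon>) \<in> O[at_right 0](\<lambda>\<epsilon>::real. \<epsilon>)" by real_asymp
  have sr: "(\<lambda>\<epsilon>. s \<epsilon> * r \<epsilon>) \<in> O[at_right 0](\<lambda>\<epsilon>. \<epsilon>)"
    using landau_o.big_trans[OF landau_o.big.mult[OF s_O r_O] sqrt2] .
  have i1: "(\<lambda>\<epsilon>. 2 / (1 + r \<epsilon>)) \<in> O[at_right 0](\<lambda>_. 1)"
  proof (rule bigoI[where c = 2])
    show "\<forall>\<^sub>F \<epsilon> in at_right 0. norm (2 / (1 + r \<epsilon>)) \<le> 2 * norm (1::real)"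
      using ev
    proof eventually_elim
      case (elim \<epsilon>)
      then show ?case using rpos[OF elim] by (simp add: divide_le_eq add_pos_nonneg)
    qed
  qed
  have i2: "(\<lambda>\<epsilon>. 1 / D \<epsilon>) \<in> O[at_right 0](\<lambda>_. 1)"
  proof (rule bigoI[where c = "1 / (\<beta> * T)"])
    show "\<forall>\<^sub>F \<epsilon> in at_right 0. norm (1 / D \<epsilon>) \<le> 1 / (\<beta> * T) * norm (1::real)"
      using ev
    proof eventually_elim
      case (elim \<epsilon>)
      then show ?case using Dge[OF elim] bT by (auto intro!: divide_left_mono)
    qed
  qed
  have d: "(\<lambda>\<epsilon>. D0 - D \<epsilon> - 2 * s \<epsilon>) \<in> O[at_right 0](\<lambda>\<epsilon>. \<epsilon>)"
  proof -
    have "(\<lambda>\<epsilon>. 2 / (1 + r \<epsilon>) * ((r \<epsilon> - s \<epsilon>) + (1 - m \<epsilon>) - s \<epsilon> * r \<epsilon>)) \<in> O[at_right 0](\<lambda>\<epsilon>. 1 * \<epsilon>)"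
      by (intro landau_o.big.mult i1 sum_in_bigo rs m1 sr)
    moreover have "\<forall>\<^sub>F \<epsilon> in at_right 0. 2 / (1 + r \<epsilon>) * ((r \<epsilon> - s \<epsilon>) + (1 - m \<epsilon>) - s \<epsilon> * r \<epsilon>) =
        D0 - D \<epsilon> - 2 * s \<epsilon>"
      using ev
    proof eventually_elim
      case (elim \<epsilon>)
      then have "1 + r \<epsilon> \<noteq> 0" using rpos[OF elim] by linarith
      then show ?case by (simp add: D_def D0_def field_simps)
    qed
    ultimately show ?thesis by (subst (asm) landau_o.big.in_cong) simp_all
  qed
  have d2: "(\<lambda>\<epsilon>. D0 - D \<epsilon>) \<in> O[at_right 0](sqrt)"
  proof -
    have "(\<lambda>\<epsilon>. 2 * s \<epsilon>) \<in> O[at_right 0](sqrt)" using s_O by simp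
    from sum_in_bigo(1)[OF landau_o.big_trans[OF d id_sqrt] this] show ?thesis by simp
  qed
  have dd: "(\<lambda>\<epsilon>. (D0 - D \<epsilon>) * (D0 - D \<epsilon>)) \<in> O[at_right 0](\<lambda>\<epsilon>. \<epsilon>)"
    using landau_o.big_trans[OF landau_o.big.mult[OF d2 d2] sqrt2] .
  have mult1: "(\<lambda>\<epsilon>. f \<epsilon> * g \<epsilon>) \<in> O[at_right 0](\<lambda>\<epsilon>. \<epsilon>)"
    if "f \<in> O[at_right 0](\<lambda>_. 1)" "g \<in> O[at_right 0](\<lambda>\<epsilon>. \<epsilon>)" for f g :: "real \<Rightarrow> real"
    using landau_o.big.mult[OF that] by simp
  \<comment> \<open>The three error terms come from splitting off
    \<open>\<beta> * \<epsilon> / D\<close> and from the exact second-order identity \<open>1 / D =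
    1 / D0 + (D0 - D) / D0\<^sup>2 + (D0 - D)\<^sup>2 / (D0\<^sup>2 * D)\<close>.\<close>
  have "(\<lambda>\<epsilon>. 1 / D \<epsilon> * (\<beta> * \<epsilon>)) \<in> O[at_right 0](\<lambda>\<epsilon>. \<epsilon>)"
    by (rule mult1[OF i2]) simp
  moreover have "(\<lambda>\<epsilon>. lam / D0\<^sup>2 * (D0 - D \<epsilon> - 2 * s \<epsilon>)) \<in> O[at_right 0](\<lambda>\<epsilon>. \<epsilon>)"
    by (rule mult1[OF bigo_const d])
  moreover have "(\<lambda>\<epsilon>. lam / D0\<^sup>2 * (1 / D \<epsilon> * ((D0 - D \<epsilon>) * (D0 - D \<epsilon>)))) \<in> O[at_right 0](\<lambda>\<epsilon>. \<epsilon>)"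
    by (rule mult1[OF bigo_const mult1[OF i2 dd]])
  ultimately have "(\<lambda>\<epsilon>. 1 / D \<epsilon> * (\<beta> * \<epsilon>) + (lam / D0\<^sup>2 * (D0 - D \<epsilon> - 2 * s \<epsilon>) +
      lam / D0\<^sup>2 * (1 / D \<epsilon> * ((D0 - D \<epsilon>) * (D0 - D \<epsilon>))))) \<in> O[at_right 0](\<lambda>\<epsilon>. \<epsilon>)"
    by (rule sum_in_bigo(1)[OF _ sum_in_bigo(1)])
  moreover have "\<forall>\<^sub>F \<epsilon> in at_right 0. 1 / D \<epsilon> * (\<beta> * \<epsilon>) + (lam / D0\<^sup>2 * (D0 - D \<epsilon> - 2 * s \<epsilon>) +
      lam / D0\<^sup>2 * (1 / D \<epsilon> * ((D0 - D \<epsilon>) * (D0 - D \<epsilon>)))) =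
      1 / unit_position T \<beta> lam \<epsilon> - (lam / (\<beta> * T + 2) + 2 * sqrt (\<beta> * lam) / (\<beta> * T + 2)\<^sup>2 * sqrt \<epsilon>)"
    using ev
  proof eventually_elim
    case (elim \<epsilon>)
    have Dp: "D \<epsilon> > 0" using Dge[OF elim] bT by linarith
    have "1 / unit_position T \<beta> lam \<epsilon> = (lam + \<beta> * \<epsilon>) / D \<epsilon>"
      by (simp add: unit_position_def D_def m_def r_def)
    moreover have "sqrt (\<beta> * lam) * sqrt \<epsilon> = lam * s \<epsilon>"
    proof -
      have "sqrt (\<beta> * lam) * sqrt (\<beta> * lam) = \<beta> * lam" using assms by simp
      then show ?thesis using assms by (simp add: s_def field_simps)
    qed
    then have "2 * sqrt (\<beta> * lam) / (\<beta> * T + 2)\<^sup>2 * sqrt \<epsilon> = 2 * lam * s \<epsilon> / D0\<^sup>2" by (simp add: D0_def)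
    moreover have "1 / D \<epsilon> * (\<beta> * \<epsilon>) + (lam / D0\<^sup>2 * (D0 - D \<epsilon> - 2 * s \<epsilon>) +
        lam / D0\<^sup>2 * (1 / D \<epsilon> * ((D0 - D \<epsilon>) * (D0 - D \<epsilon>)))) =
        (lam + \<beta> * \<epsilon>) / D \<epsilon> - (lam / D0 + 2 * lam * s \<epsilon> / D0\<^sup>2)"
      using Dp D0 by (simp add: field_simps power2_eq_square)
    ultimately show ?case using D0 by (simp add: D0_def)
  qed
  ultimately show ?thesis by (subst (asm) landau_o.big.in_cong) simp_all
qed

text \<open>For the upper bound, the penalised optimiser is itself admissible without penalty, where
  its cost can only be smaller.\<close>

lemma (in usual_filtered_prob_space) V_0_eq:
  assumes pos: "0 < \<beta>" "0 < lam"
  shows "V M F T \<beta> lam 0 \<Xi> 0 = lam * \<Xi>\<^sup>2 / (\<beta> * T + 2)"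
proof (rule antisym)
  \<comment> \<open>A real infimum is meaningful only for a nonempty set bounded below; the bound
    comes from \<open>J0_lower_bound\<close>, nonemptiness from any penalised optimiser.\<close>
  obtain Q1 where Q1: "Q1 \<in> ac_strategies M F T \<Xi>" using optimal_ac_strategy[OF pos, of 1] by auto
  then have ne: "strategies M F T \<Xi> \<noteq> {}" by (auto simp: ac_strategies_def)
  show "lam * \<Xi>\<^sup>2 / (\<beta> * T + 2) \<le> V M F T \<beta> lam 0 \<Xi> 0"
    unfolding V_def using ne J0_lower_bound[OF _ pos] by (auto intro!: cINF_greatest)
  have le: "V M F T \<beta> lam 0 \<Xi> 0 \<le> \<Xi>\<^sup>2 * (1 / unit_position T \<beta> lam \<epsilon>)" if eps: "0 < \<epsilon>" for \<epsilon>
  proof -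
    obtain Q where Q: "Q \<in> ac_strategies M F T \<Xi>"
      "J_eps M F T \<beta> lam 0 \<epsilon> Q = \<Xi>\<^sup>2 / unit_position T \<beta> lam \<epsilon>"
      using optimal_ac_strategy[OF pos eps] by blast
    have "V M F T \<beta> lam 0 \<Xi> 0 \<le> J0 M T \<beta> lam 0 Q"
      unfolding V_def using Q(1) J0_lower_bound[OF _ pos]
      by (auto intro!: cINF_lower bdd_belowI2 simp: ac_strategies_def)
    also have "\<dots> \<le> J_eps M F T \<beta> lam 0 \<epsilon> Q"
      unfolding J_eps_def set_lebesgue_integral_def using eps
      by (auto intro!: mult_nonneg_nonneg Bochner_Integration.integral_nonneg)
    finally show ?thesis by (simp add: Q(2))
  qed
  define b where "b \<epsilon> = lam / (\<beta> * T + 2) + 2 * sqrt (\<beta> * lam) / (\<beta> * T + 2)\<^sup>2 * sqrt \<epsilon>" for \<epsilon>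
  have small: "(\<lambda>\<epsilon>::real. \<epsilon>) \<in> o[at_right 0](\<lambda>_. 1)" by real_asymp
  have "((\<lambda>\<epsilon>. 1 / unit_position T \<beta> lam \<epsilon> - b \<epsilon>) \<longlongrightarrow> 0) (at_right 0)"
    using smalloD_tendsto[OF landau_o.big_small_trans[OF unit_position_asymptotics[OF T_pos pos] small]]
    by (simp add: b_def)
  moreover have "(b \<longlongrightarrow> lam / (\<beta> * T + 2) + 2 * sqrt (\<beta> * lam) / (\<beta> * T + 2)\<^sup>2 * sqrt 0) (at_right 0)"
    unfolding b_def by (intro tendsto_intros)
  ultimately have "((\<lambda>\<epsilon>. (1 / unit_position T \<beta> lam \<epsilon> - b \<epsilon>) + b \<epsilon>) \<longlongrightarrow>
      0 + (lam / (\<beta> * T + 2) + 2 * sqrt (\<beta> * lam) / (\<beta> * T + 2)\<^sup>2 * sqrt 0)) (at_right 0)"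
    by (rule tendsto_add)
  then have "((\<lambda>\<epsilon>. \<Xi>\<^sup>2 * (1 / unit_position T \<beta> lam \<epsilon>)) \<longlongrightarrow> \<Xi>\<^sup>2 * (lam / (\<beta> * T + 2))) (at_right 0)"
    by (intro tendsto_mult_left) simp
  then have "V M F T \<beta> lam 0 \<Xi> 0 \<le> \<Xi>\<^sup>2 * (lam / (\<beta> * T + 2))"
  proof (rule tendsto_lowerbound)
    show "\<forall>\<^sub>F \<epsilon> in at_right 0. V M F T \<beta> lam 0 \<Xi> 0 \<le> \<Xi>\<^sup>2 * (1 / unit_position T \<beta> lam \<epsilon>)"
      using eventually_at_right_less[of "0::real"] by eventually_elim (rule le)
  qed simp
  then show "V M F T \<beta> lam 0 \<Xi> 0 \<le> lam * \<Xi>\<^sup>2 / (\<beta> * T + 2)" by (simp add: mult.commute)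
qed

theorem proposition5p9:
  fixes M :: "'a measure" and F :: "real \<Rightarrow> 'a measure" and T \<beta> lam \<Xi> :: real
  assumes "usual_filtered_prob_space M F T"
    and "0 < \<beta>" and "0 < lam"
  shows
    "(\<lambda>\<epsilon>. V M F T \<beta> lam 0 \<Xi> \<epsilon> -
        (lam * \<Xi>\<^sup>2 / (\<beta> * T + 2) +
         2 * sqrt (\<beta> * lam) * \<Xi>\<^sup>2 / (\<beta> * T + 2)\<^sup>2 * sqrt \<epsilon>)) \<in> O[at_right 0](\<lambda>\<epsilon>. \<epsilon>) \<and>
     (\<Xi> \<noteq> 0 \<longrightarrow>
        (\<lambda>\<epsilon>. V M F T \<beta> lam 0 \<Xi> \<epsilon> - V M F T \<beta> lam 0 \<Xi> 0) \<sim>[at_right 0]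
          (\<lambda>\<epsilon>. 2 * sqrt (\<beta> * lam) * \<Xi>\<^sup>2 / (\<beta> * T + 2)\<^sup>2 * sqrt \<epsilon>) \<and>
        (\<lambda>\<epsilon>. V M F T \<beta> lam 0 \<Xi> \<epsilon> - V M F T \<beta> lam 0 \<Xi> 0) \<in> \<Theta>[at_right 0](sqrt))"
proof -
  interpret usual_filtered_prob_space M F T by (rule assms(1))
  define b where "b = 2 * sqrt (\<beta> * lam) * \<Xi>\<^sup>2 / (\<beta> * T + 2)\<^sup>2"
  have "(\<lambda>\<epsilon>. \<Xi>\<^sup>2 * (1 / unit_position T \<beta> lam \<epsilon> -
      (lam / (\<beta> * T + 2) + 2 * sqrt (\<beta> * lam) / (\<beta> * T + 2)\<^sup>2 * sqrt \<epsilon>))) \<in> O[at_right 0](\<lambda>\<epsilon>. \<epsilon>)"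
    using landau_o.big.mult[OF bigo_const[of "\<Xi>\<^sup>2"] unit_position_asymptotics[OF T_pos assms(2,3)]] by simp
  moreover have "\<forall>\<^sub>F \<epsilon> in at_right 0. \<Xi>\<^sup>2 * (1 / unit_position T \<beta> lam \<epsilon> -
      (lam / (\<beta> * T + 2) + 2 * sqrt (\<beta> * lam) / (\<beta> * T + 2)\<^sup>2 * sqrt \<epsilon>)) =
      V M F T \<beta> lam 0 \<Xi> \<epsilon> - (lam * \<Xi>\<^sup>2 / (\<beta> * T + 2) + b * sqrt \<epsilon>)"
    using eventually_at_right_less[of "0::real"]
    by eventually_elim (simp add: V_eq[OF assms(2,3)] b_def algebra_simps)
  ultimately have main: "(\<lambda>\<epsilon>. V M F T \<beta> lam 0 \<Xi> \<epsilon> - (lam * \<Xi>\<^sup>2 / (\<beta> * T + 2) + b * sqrt \<epsilon>))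
      \<in> O[at_right 0](\<lambda>\<epsilon>. \<epsilon>)"
    by (subst (asm) landau_o.big.in_cong) simp_all
  have "(\<lambda>\<epsilon>. V M F T \<beta> lam 0 \<Xi> \<epsilon> - V M F T \<beta> lam 0 \<Xi> 0) \<sim>[at_right 0] (\<lambda>\<epsilon>. b * sqrt \<epsilon>) \<and>
      (\<lambda>\<epsilon>. V M F T \<beta> lam 0 \<Xi> \<epsilon> - V M F T \<beta> lam 0 \<Xi> 0) \<in> \<Theta>[at_right 0](sqrt)" if "\<Xi> \<noteq> 0"
  proof -
    have "\<beta> * T + 2 > 0" using assms T_pos by (simp add: add_pos_pos)
    then have b: "b > 0" unfolding b_def using assms(2,3) that by simp
    \<comment> \<open>Positivity of \<open>b\<close> makes the \<open>O(\<epsilon>)\<close>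
      remainder negligible relative to the leading term; this is where
      \<open>\<Xi> \<noteq> 0\<close> enters.\<close>
    have "(\<lambda>\<epsilon>::real. \<epsilon>) \<in> o[at_right 0](\<lambda>\<epsilon>. b * sqrt \<epsilon>)" using b by real_asymp
    with main have "(\<lambda>\<epsilon>. V M F T \<beta> lam 0 \<Xi> \<epsilon> - (lam * \<Xi>\<^sup>2 / (\<beta> * T + 2) + b * sqrt \<epsilon>))
        \<in> o[at_right 0](\<lambda>\<epsilon>. b * sqrt \<epsilon>)" by (rule landau_o.big_small_trans)
    then have eq: "(\<lambda>\<epsilon>. V M F T \<beta> lam 0 \<Xi> \<epsilon> - V M F T \<beta> lam 0 \<Xi> 0) \<sim>[at_right 0] (\<lambda>\<epsilon>. b * sqrt \<epsilon>)"
      unfolding asymp_equiv_altdef by (simp add: V_0_eq[OF assms(2,3)] algebra_simps)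
    have "(\<lambda>\<epsilon>. b * sqrt \<epsilon>) \<in> \<Theta>[at_right 0](sqrt)" using b by simp
    with asymp_equiv_imp_bigtheta[OF eq] eq show ?thesis by (blast intro: landau_theta.trans)
  qed
  with main show ?thesis unfolding b_def by blast
qed

end
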